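(* Let $G$ be a finite simple graph that is claw-free (it has no induced subgraph isomorphic to $K_{1,3}$) and subcubic (every vertex has degree at most $3$). If no connected component of $G$ is isomorphic to the triangular prism, then $\chi'_s(G)\le 7$.
   Context: Two distinct edges $e,e'$ of a graph are at distance $1$ if they share an end vertex, and at distance $2$ if they are not adjacent but both are adjacent to a common edge. For a positive integer $k$, a strong $k$-edge-coloring of $G$ is a map $\phi:E(G)\to\{1,\dots,k\}$ such that $\phi(e)\ne\phi(e')$ whenever $e,e'$ are at distance $1$ or $2$. The strong chromatic index $\chi'_s(G)$ is the least $k$ for which $G$ has a strong $k$-edge-coloring. The triangular prism ($3$-prism) is the cubic graph on $6$ vertices consisting of two disjoint triangles $a_1a_2a_3$ and $b_1b_2b_3$ together with the edges $a_1b_1,a_2b_2,a_3b_3$. *)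

theory Defs
  imports Main
begin

type_synonym 'a ugraph = "'a set \<times> 'a set set"

definition verts :: "'a ugraph \<Rightarrow> 'a set" where
  "verts G = fst G"

definition edges :: "'a ugraph \<Rightarrow> 'a set set" where
  "edges G = snd G"

definition finite_simple_graph :: "'a ugraph \<Rightarrow> bool" where
  "finite_simple_graph G \<longleftrightarrow>
     finite (verts G) \<and> (\<forall>e\<in>edges G. e \<subseteq> verts G \<and> card e = 2)"

definition degree :: "'a ugraph \<Rightarrow> 'a \<Rightarrow> nat" where
  "degree G v = card {e \<in> edges G. v \<in> e}"

definition subcubic :: "'a ugraph \<Rightarrow> bool" where
  "subcubic G \<longleftrightarrow> (\<forall>v\<in>verts G. degree G v \<le> 3)"

definition induced_subgraph :: "'a ugraph \<Rightarrow> 'a set \<Rightarrow> 'a ugraph" where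
  "induced_subgraph G S = (S, {e \<in> edges G. e \<subseteq> S})"

definition graph_isomorphic :: "'a ugraph \<Rightarrow> 'b ugraph \<Rightarrow> bool" where
  "graph_isomorphic G H \<longleftrightarrow>
     (\<exists>f. bij_betw f (verts G) (verts H) \<and>
          (\<forall>u\<in>verts G. \<forall>v\<in>verts G. {u, v} \<in> edges G \<longleftrightarrow> {f u, f v} \<in> edges H))"

definition claw :: "nat ugraph" where
  "claw = ({0, 1, 2, 3}, {{0, 1}, {0, 2}, {0, 3}})"

definition claw_free :: "'a ugraph \<Rightarrow> bool" where
  "claw_free G \<longleftrightarrow> \<not> (\<exists>S \<subseteq> verts G. graph_isomorphic (induced_subgraph G S) claw)"

text \<open>The triangles are \<open>0 1 2\<close> (the vertices \<open>a\<^sub>1, a\<^sub>2, a\<^sub>3\<close>) and \<open>3 4 5\<close>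
  (the vertices \<open>b\<^sub>1, b\<^sub>2, b\<^sub>3\<close>).\<close>

definition triangular_prism :: "nat ugraph" where
  "triangular_prism =
     ({0, 1, 2, 3, 4, 5},
      {{0, 1}, {1, 2}, {0, 2}, {3, 4}, {4, 5}, {3, 5}, {0, 3}, {1, 4}, {2, 5}})"

definition reachable :: "'a ugraph \<Rightarrow> 'a \<Rightarrow> 'a \<Rightarrow> bool" where
  "reachable G = (\<lambda>u v. {u, v} \<in> edges G)\<^sup>*\<^sup>*"

definition connected_components :: "'a ugraph \<Rightarrow> 'a ugraph set" where
  "connected_components G =
     {induced_subgraph G {u \<in> verts G. reachable G v u} | v. v \<in> verts G}"

definition edges_at_distance_1 :: "'a set \<Rightarrow> 'a set \<Rightarrow> bool" where
  "edges_at_distance_1 e e' \<longleftrightarrow> e \<noteq> e' \<and> e \<inter> e' \<noteq> {}"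

definition edges_at_distance_2 :: "'a ugraph \<Rightarrow> 'a set \<Rightarrow> 'a set \<Rightarrow> bool" where
  "edges_at_distance_2 G e e' \<longleftrightarrow>
     e \<noteq> e' \<and> \<not> edges_at_distance_1 e e' \<and>
     (\<exists>g\<in>edges G. edges_at_distance_1 e g \<and> edges_at_distance_1 e' g)"

definition strong_edge_coloring :: "'a ugraph \<Rightarrow> nat \<Rightarrow> ('a set \<Rightarrow> nat) \<Rightarrow> bool" where
  "strong_edge_coloring G k \<phi> \<longleftrightarrow>
     \<phi> ` edges G \<subseteq> {1..k} \<and>
     (\<forall>e\<in>edges G. \<forall>e'\<in>edges G.
        edges_at_distance_1 e e' \<or> edges_at_distance_2 G e e' \<longrightarrow> \<phi> e \<noteq> \<phi> e')"

definition strong_chromatic_index :: "'a ugraph \<Rightarrow> nat" where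
  "strong_chromatic_index G = (LEAST k. 0 < k \<and> (\<exists>\<phi>. strong_edge_coloring G k \<phi>))"

text \<open>The minimum in the strong chromatic index is taken over a nonempty set.\<close>

lemma strong_edge_coloring_exists:
  assumes "finite_simple_graph G"
  shows "\<exists>k>0. \<exists>\<phi>. strong_edge_coloring G k \<phi>"
proof -
  have "edges G \<subseteq> Pow (verts G)" "finite (verts G)"
    using assms by (auto simp: finite_simple_graph_def)
  then have "finite (edges G)"
    by (meson finite_Pow_iff finite_subset)
  then obtain h where h: "bij_betw h (edges G) {0..<card (edges G)}"
    using ex_bij_betw_finite_nat by blast
  have "strong_edge_coloring G (Suc (card (edges G))) (\<lambda>e. Suc (h e))"
    unfolding strong_edge_coloring_def
  proof (intro conjI ballI impI)
    show "(\<lambda>e. Suc (h e)) ` edges G \<subseteq> {1..Suc (card (edges G))}"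
      using bij_betw_apply[OF h] by fastforce
  next
    fix e e' assume "e \<in> edges G" "e' \<in> edges G"
      and "edges_at_distance_1 e e' \<or> edges_at_distance_2 G e e'"
    moreover from this have "e \<noteq> e'"
      by (auto simp: edges_at_distance_1_def edges_at_distance_2_def)
    ultimately show "Suc (h e) \<noteq> Suc (h e')"
      using bij_betw_imp_inj_on[OF h] by (auto dest: inj_onD)
  qed
  then show ?thesis by blast
qed

end

theory Submission
  imports Defs
begin

text \<open>In a claw-free subcubic graph every vertex of degree 3 lies in a triangle. Consider a counterexample with the fewest
  edges. Deleting a few vertices leaves a graph with a strong 7-edge-colouring, and this colouring extends back whenever the
  counterexample contains a pendant edge, two adjacent vertices of degree 2, a triangle with a corner of degree 2, two
  triangles joined by two edges, two triangles sharing an edge, or a vertex of degree 2. So the counterexample is cubic, its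
  vertices are partitioned into triangles, and any two triangles are joined by at most one edge. Three pairwise joined
  triangles can be recoloured as well. Hence there is a path of three triangles whose ends are not joined. Delete it and, for each end
  triangle, join its two outer neighbours outside the path by a new edge; the exclusions above say that no prism arises. In a
  colouring of this smaller graph the colours at the two outer neighbours are disjoint, which leaves enough freedom to
  recolour the path.

  Colouring steps with many free parameters are reduced by renaming colours to finitely many cases, which are evaluated.\<close>

section \<open>Choosing colours\<close>


text \<open>The prism has to be excluded because its nine edges are pairwise at distance at most 2.
  Greedy counting does not yield seven colours: in a cubic graph made of disjoint triangles, a
  triangle edge may have nine edges within distance 2, and a link between triangles ten. Only a
  pendant edge is cheap: once the triangle at one end is gone, a link sees at most five edges. So
  whole triangles must be recoloured together, and the colour lemmas below are these local problems,
  with the colours seen from outside as parameters. For the path of three triangles, deletion gives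
  no control over how the colours at the two outer neighbours of an end triangle overlap. The added
  edge supplies it, and its colour stays useful: folding a corner of the end triangle onto an outer
  neighbour turns the added edge into a link, after which the other link is a pendant edge. Colours
  form a seven-element type, so that renaming is a bijection of the type and the remaining cases can
  be executed.\<close>

datatype colour = Col0 | Col1 | Col2 | Col3 | Col4 | Col5 | Col6

lemma UNIV_colour: "UNIV = {Col0, Col1, Col2, Col3, Col4, Col5, Col6}"
  using colour.exhaust by auto

lemma finite_colour [simp]: "finite (S :: colour set)"
  by (rule finite_subset[OF subset_UNIV]) (simp add: UNIV_colour)

lemma card_UNIV_colour: "card (UNIV :: colour set) = 7"
  by (simp add: UNIV_colour)

text \<open>Each disequation is recorded in both directions, so that the simplifier closes goals of
  either orientation.\<close>

primrec avoids :: "colour \<Rightarrow> colour list \<Rightarrow> bool" where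
  "avoids k [] = True"
| "avoids k (x # xs) \<longleftrightarrow> k \<noteq> x \<and> x \<noteq> k \<and> avoids k xs"

lemma avoids_iff: "avoids k xs \<longleftrightarrow> k \<notin> set xs"
  by (induction xs) auto

lemma fresh_colour:
  assumes "length xs \<le> 6"
  obtains k where "avoids k xs"
proof -
  have "card (set xs) < card (UNIV :: colour set)"
    using card_length[of xs] assms by (simp add: card_UNIV_colour)
  then have "set xs \<noteq> UNIV" by auto
  then show ?thesis using that by (auto simp: avoids_iff)
qed

text \<open>Pads a collection of colours with possible coincidences to exactly \<open>n\<close>
  colours outside \<open>F\<close>. Where colours seen at far ends may repeat or hit
  \<open>F\<close>, this replaces a case distinction by a set of known size.\<close>

lemma superset_colours:
  assumes "length S \<le> n" "n + length F \<le> 7"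
  obtains K :: "colour set" where "set S - set F \<subseteq> K" "K \<inter> set F = {}" "card K = n"
proof -
  have "card (- set F) \<ge> 7 - length F"
    using card_length[of F] by (simp add: Compl_eq_Diff_UNIV card_Diff_subset card_UNIV_colour)
  then have "n \<le> card (- set F)" using assms by simp
  moreover have "card (set S - set F) \<le> n"
    using card_mono[of "set S" "set S - set F"] card_length[of S] assms(1) by simp
  ultimately obtain K where "set S - set F \<subseteq> K" "K \<subseteq> - set F" "card K = n"
    using exists_subset_between[of "set S - set F" n "- set F"] by auto
  then show ?thesis using that by blast
qed

lemma card_eq_2: "card S = 2 \<Longrightarrow> \<exists>a b. S = {a, b} \<and> distinct [a, b]"
  by (auto simp: card_2_iff)

lemma card_eq_3: "card S = 3 \<Longrightarrow> \<exists>a b c. S = {a, b, c} \<and> distinct [a, b, c]"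
  by (auto simp: card_3_iff)

lemma card_eq_4:
  assumes "card S = 4"
  shows "\<exists>a b c d. S = {a, b, c, d} \<and> distinct [a, b, c, d]"
proof -
  from assms obtain a T where "S = insert a T" "a \<notin> T" "card T = 3"
    using card_Suc_eq[of S 3] by auto
  then show ?thesis using card_eq_3[of T] by auto
qed

section \<open>Colours for single triangles, diamonds and double links\<close>

text \<open>For a triangle \<open>abc\<close> whose corner \<open>c\<close> has no outer edge:
  \<open>x\<close>, \<open>y\<close> are the outer colours at \<open>a\<close>, \<open>b\<close>,
  and \<open>tv\<close> is the colour opposite \<open>v\<close>. The edge opposite \<open>c\<close>
  sees both far pairs, hence is the most constrained one and is chosen first.\<close>

lemma two_port_triangle_colours:
  fixes x y :: colour
  assumes "x \<noteq> y"
  shows "\<exists>ta tb tc. distinct [x, y, ta, tb, tc] \<and> tb \<notin> {A1, A2} \<and> ta \<notin> {B1, B2}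
           \<and> tc \<notin> {A1, A2, B1, B2}"
proof -
  obtain tc where "avoids tc [x, y, A1, A2, B1, B2]" by (erule fresh_colour[rotated]) simp
  moreover obtain tb where "avoids tb [x, y, A1, A2, tc]" by (erule fresh_colour[rotated]) simp
  moreover obtain ta where "avoids ta [x, y, B1, B2, tc, tb]" by (erule fresh_colour[rotated]) simp
  ultimately show ?thesis using assms by - (rule exI[of _ ta], rule exI[of _ tb], rule exI[of _ tc], auto)
qed

text \<open>A triangle \<open>abc\<close> gets colour \<open>t\<^sub>v\<close> on the edge opposite \<open>v\<close>, and its outer edge at \<open>a\<close> gets colour \<open>y\<close>. The outer
  edges at \<open>b\<close>, \<open>c\<close> have colours \<open>x\<^sub>b\<close>, \<open>x\<^sub>c\<close>, and their far ends see the colours \<open>B1, B2\<close> and \<open>C1, C2\<close>.\<close>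

definition port_colours ::
  "colour \<Rightarrow> colour \<Rightarrow> colour \<Rightarrow> colour \<Rightarrow> colour \<Rightarrow> colour \<Rightarrow> colour \<Rightarrow> colour \<Rightarrow> colour \<Rightarrow> colour \<Rightarrow> bool" where
  "port_colours xb B1 B2 xc C1 C2 y ta tb tc \<longleftrightarrow>
     distinct [xb, xc, y, ta, tb, tc] \<and> ta \<notin> {B1, B2, C1, C2} \<and> tb \<notin> {C1, C2} \<and> tc \<notin> {B1, B2}"

text \<open>The pair to be avoided is the one that would block a neighbouring diamond. Two greedy
  orders are tried, keeping \<open>V1\<close> off \<open>tb\<close> or off \<open>tc\<close>. If
  both fail, then \<open>V1\<close> and \<open>V2\<close> have swapped places between them, so
  \<open>V1\<close> fits both edges at \<open>a\<close> and may be moved to the edge opposite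
  \<open>a\<close>.\<close>

lemma port_colours_avoid:
  assumes "xb \<noteq> xc"
  shows "\<exists>y ta tb tc. port_colours xb B1 B2 xc C1 C2 y ta tb tc \<and> {tb, tc} \<noteq> {V1, V2}"
proof -
  obtain ta where ta: "avoids ta [xb, xc, B1, B2, C1, C2]" by (erule fresh_colour[rotated]) simp
  obtain tb where tb: "avoids tb [xb, xc, C1, C2, ta, V1]" by (erule fresh_colour[rotated]) simp
  obtain tc where tc: "avoids tc [xb, xc, B1, B2, ta, tb]" by (erule fresh_colour[rotated]) simp
  obtain tc' where tc': "avoids tc' [xb, xc, B1, B2, ta, V1]" by (erule fresh_colour[rotated]) simp
  obtain tb' where tb': "avoids tb' [xb, xc, C1, C2, ta, tc']" by (erule fresh_colour[rotated]) simp
  obtain y where y: "avoids y [xb, xc, ta, tb, tc]" by (erule fresh_colour[rotated]) simp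
  obtain y' where y': "avoids y' [xb, xc, ta, tb', tc']" by (erule fresh_colour[rotated]) simp
  consider "{tb, tc} \<noteq> {V1, V2}" | "{tb', tc'} \<noteq> {V1, V2}"
    | "tb = V2" "tc = V1" "tb' = V1" "tc' = V2"
    using tb tc' by (auto simp: doubleton_eq_iff)
  then show ?thesis
  proof cases
    case 1
    then show ?thesis using assms ta tb tc y
      by - (rule exI[of _ y], rule exI[of _ ta], rule exI[of _ tb], rule exI[of _ tc], simp add: port_colours_def)
  next
    case 2
    then show ?thesis using assms ta tb' tc' y'
      by - (rule exI[of _ y'], rule exI[of _ ta], rule exI[of _ tb'], rule exI[of _ tc'], simp add: port_colours_def)
  next
    case 3
    then have "port_colours xb B1 B2 xc C1 C2 y V1 ta V2"
      using assms ta tb tc tb' tc' y unfolding port_colours_def by simp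
    moreover have "{ta, V2} \<noteq> {V1, V2}" using ta tc 3 by (simp add: doubleton_eq_iff)
    ultimately show ?thesis by blast
  qed
qed

text \<open>Two triangles \<open>u p q\<close> and \<open>v p q\<close> share the edge coloured
  \<open>k\<close>. The edges at \<open>v\<close> get \<open>g1, g2\<close>, those at
  \<open>u\<close> get \<open>h1, h2\<close>; the outer colours at \<open>u\<close> and
  \<open>v\<close> are \<open>y\<close> and \<open>y'\<close>, with far colours \<open>P\<close> and
  \<open>V\<close>. The outer edges may have equal colours.\<close>

definition diamond_sol :: "colour \<Rightarrow> colour \<Rightarrow> colour set \<Rightarrow> colour set \<Rightarrow> bool" where
  "diamond_sol y y' P V \<longleftrightarrow> (\<exists>g1 g2 h1 h2 k. distinct [g1, g2, h1, h2, k, y] \<and> y' \<notin> {g1, g2, h1, h2, k}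
     \<and> g1 \<notin> V \<and> g2 \<notin> V \<and> h1 \<notin> P \<and> h2 \<notin> P)"

lemma diamond_sol_swap: "diamond_sol y y' P V \<Longrightarrow> diamond_sol y y' V P"
  unfolding diamond_sol_def
  apply (elim exE)
  subgoal for g1 g2 h1 h2 k
    by (rule exI[of _ h1], rule exI[of _ h2], rule exI[of _ g1], rule exI[of _ g2], rule exI[of _ k]) auto
  done

text \<open>The outer colours are forbidden inside anyway, so \<open>P\<close> effectively forbids
  only \<open>q\<close>. Colouring the edges at \<open>v\<close> first then never meets more than
  six forbidden colours.\<close>

lemma diamond_sol_greedy:
  assumes "P \<subseteq> {y, y', q}"
  shows "diamond_sol y y' P {W1, W2}"
proof -
  obtain g1 where "avoids g1 [y, y', W1, W2]" by (erule fresh_colour[rotated]) simp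
  moreover obtain g2 where "avoids g2 [y, y', W1, W2, g1]" by (erule fresh_colour[rotated]) simp
  moreover obtain h1 where "avoids h1 [y, y', q, g1, g2]" by (erule fresh_colour[rotated]) simp
  moreover obtain h2 where "avoids h2 [y, y', q, g1, g2, h1]" by (erule fresh_colour[rotated]) simp
  moreover obtain k where "avoids k [y, y', g1, g2, h1, h2]" by (erule fresh_colour[rotated]) simp
  moreover have "h1 \<notin> P" using calculation(3) assms by auto
  moreover have "h2 \<notin> P" using calculation(4) assms by auto
  ultimately show ?thesis unfolding diamond_sol_def
    by - (rule exI[of _ g1], rule exI[of _ g2], rule exI[of _ h1], rule exI[of _ h2], rule exI[of _ k], simp)
qed

text \<open>The excluded case is a real obstruction: if \<open>P\<close> and \<open>V\<close> are
  the same two colours and differ from two distinct outer colours, only three colours remain for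
  four edges. Otherwise a colour in just one far pair can be placed on the opposite side of the
  diamond, once in each direction; degenerate pairs are greedy.\<close>

lemma diamond_colours:
  assumes "{P1, P2} \<noteq> {V1, V2} \<or> P1 = P2"
  shows "diamond_sol y y' {P1, P2} {V1, V2}"
proof (cases "P1 = P2 \<or> P1 \<in> {y, y'} \<or> P2 \<in> {y, y'}")
  case True
  then have "{P1, P2} \<subseteq> {y, y', P1} \<or> {P1, P2} \<subseteq> {y, y', P2}" by auto
  then show ?thesis using diamond_sol_greedy[of "{P1, P2}" y y' P1 V1 V2] diamond_sol_greedy[of "{P1, P2}" y y' P2 V1 V2]
    by argo
next
  case P: False
  show ?thesis
  proof (cases "V1 = V2 \<or> V1 \<in> {y, y'} \<or> V2 \<in> {y, y'}")
    case True
    then have "{V1, V2} \<subseteq> {y, y', V1} \<or> {V1, V2} \<subseteq> {y, y', V2}" by auto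
    then have "diamond_sol y y' {V1, V2} {P1, P2}"
      using diamond_sol_greedy[of "{V1, V2}" y y' V1 P1 P2] diamond_sol_greedy[of "{V1, V2}" y y' V2 P1 P2]
      by argo
    then show ?thesis by (rule diamond_sol_swap)
  next
    case V: False
    have "\<not> {P1, P2} \<subseteq> {V1, V2}" using assms P V by blast
    then obtain p where p: "p \<in> {P1, P2}" "p \<notin> {V1, V2}" by blast
    have "\<not> {V1, V2} \<subseteq> {P1, P2}" using assms P V by blast
    then obtain v where v: "v \<in> {V1, V2}" "v \<notin> {P1, P2}" by blast
    obtain g2 where g2: "avoids g2 [y, y', V1, V2, p]" by (erule fresh_colour[rotated]) simp
    obtain h2 where h2: "avoids h2 [y, y', P1, P2, v, g2]" by (erule fresh_colour[rotated]) simp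
    obtain k where k: "avoids k [y, y', p, g2, v, h2]" by (erule fresh_colour[rotated]) simp
    have p': "p \<notin> {y, y'}" "h2 \<noteq> p" "p \<noteq> v" using P p v h2 by auto
    have v': "v \<notin> {y, y'}" "g2 \<noteq> v" using V v g2 by auto
    have "distinct [p, g2, v, h2, k, y]" "y' \<notin> {p, g2, v, h2, k}" using p' v' g2 h2 k by auto
    moreover have "g2 \<notin> {V1, V2}" "h2 \<notin> {P1, P2}" using g2 h2 by auto
    ultimately show ?thesis using p(2) v(2) unfolding diamond_sol_def by blast
  qed
qed

text \<open>Two triangles \<open>v b c\<close> and \<open>w q r\<close> with the link
  \<open>b q\<close> coloured \<open>x\<close> and a common outer neighbour of \<open>v\<close> and
  \<open>w\<close>. The edges from \<open>v\<close> and \<open>w\<close> to it, coloured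
  \<open>y\<close> and \<open>y'\<close>, are too far from \<open>q r\<close> and \<open>b c\<close>
  respectively to conflict with them.\<close>

lemma subdivided_double_link_colours:
  fixes xc xc' :: colour
  shows "\<exists>x y y' ta tb tc ta' tb' tc'. distinct [x, xc, y, ta, tb, tc] \<and> distinct [x, xc', y', ta', tb', tc']
     \<and> ta \<notin> {D1, D2} \<and> tb \<notin> {D1, D2} \<and> ta' \<notin> {D1', D2'} \<and> tb' \<notin> {D1', D2'} \<and> ta \<notin> {ta', tc'} \<and> tc \<notin> {ta', tc'}
     \<and> y \<noteq> y' \<and> y \<notin> {tb', tc'} \<and> y' \<notin> {tb, tc}"
proof -
  obtain ta where ta: "avoids ta [xc, D1, D2, xc']" by (erule fresh_colour[rotated]) simp
  obtain ta' where ta': "avoids ta' [xc', D1', D2', xc, ta]" by (erule fresh_colour[rotated]) simp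
  obtain tb where tb: "avoids tb [xc, D1, D2, ta, ta']" by (erule fresh_colour[rotated]) simp
  obtain tb' where tb': "avoids tb' [xc', D1', D2', ta, ta']" by (erule fresh_colour[rotated]) simp
  obtain x where x: "avoids x [xc, xc', tb, tb', ta, ta']" by (erule fresh_colour[rotated]) simp
  obtain tc' where tc': "avoids tc' [tb', ta', ta, x, xc']" by (erule fresh_colour[rotated]) simp
  obtain tc where tc: "avoids tc [tb, ta, ta', x, xc, tc']" by (erule fresh_colour[rotated]) simp
  then show ?thesis using ta ta' tb tb' x tc'
    \<comment> \<open>The outer edge at each of \<open>v\<close>, \<open>w\<close> reuses the colour
      that the other triangle has on its edge opposite that vertex: \<open>y = ta'\<close> and
      \<open>y' = ta\<close>.\<close>
    by - (rule exI[of _ x], rule exI[of _ ta'], rule exI[of _ ta], rule exI[of _ ta], rule exI[of _ tb], rule exI[of _ tc], rule exI[of _ ta'], rule exI[of _ tb'], rule exI[of _ tc'], simp)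
qed


text \<open>Triangle \<open>i\<close> has outer colour \<open>xi\<close> at \<open>ai\<close>, edge
  \<open>mi\<close> opposite \<open>ai\<close>, edges \<open>si\<close>, \<open>ri\<close> at
  \<open>ai\<close>; \<open>y1\<close>, \<open>y2\<close> are the two links. The far colours are
  absorbed by the links and the \<open>mi\<close>, which leaves colours for all \<open>si\<close>,
  \<open>ri\<close>. An outer colour may be used in the other triangle: on \<open>s\<close> or
  \<open>r\<close> if the far pair there allows it, and on \<open>m\<close> if it belongs to that
  far pair, which then has only one colour left to absorb.\<close>

lemma double_link_colours:
  fixes x1 x2 A1 A1' A2 A2' :: colour
  shows "\<exists>y1 y2 m1 m2 s1 r1 s2 r2. distinct [x1, y1, y2, m1, s1, r1] \<and> distinct [x2, y1, y2, m2, s2, r2]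
     \<and> m1 \<notin> {m2, s2, r2} \<and> m2 \<notin> {s1, r1} \<and> s1 \<noteq> s2 \<and> r1 \<noteq> r2
     \<and> s1 \<notin> {A1, A1'} \<and> r1 \<notin> {A1, A1'} \<and> s2 \<notin> {A2, A2'} \<and> r2 \<notin> {A2, A2'}"
    (is "\<exists>y1 y2 m1 m2 s1 r1 s2 r2. ?P x1 A1 A1' x2 A2 A2' y1 y2 m1 m2 s1 r1 s2 r2")
proof -
  let ?S = "\<lambda>x1 A1 A1' x2 A2 A2'. \<exists>y1 y2 m1 m2 s1 r1 s2 r2. ?P x1 A1 A1' x2 A2 A2' y1 y2 m1 m2 s1 r1 s2 r2"
  have swap: "?S x1 A1 A1' x2 A2 A2'" if "?S x2 A2 A2' x1 A1 A1'"
    for x1 A1 A1' x2 A2 A2' :: colour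
  proof -
    from that obtain y1 y2 m1 m2 s1 r1 s2 r2 where "?P x2 A2 A2' x1 A1 A1' y1 y2 m1 m2 s1 r1 s2 r2"
      by blast
    then have "?P x1 A1 A1' x2 A2 A2' y1 y2 m2 m1 s2 r2 s1 r1" by auto
    then show ?thesis by blast
  qed
  have one_sided: "?S x1 A1 A1' x2 A2 A2'" if x: "x1 \<noteq> x2" "x2 \<in> {A1, A1'}" "x1 \<notin> {A2, A2'}"
    for x1 A1 A1' x2 A2 A2' :: colour
  proof -
    obtain a where a: "{A1, A1'} \<subseteq> {x2, a}" using x(2) by blast
    obtain Y where "set [a, A2, A2'] - set [x1, x2] \<subseteq> Y" "Y \<inter> set [x1, x2] = {}" "card Y = 3"
      by (rule superset_colours[of "[a, A2, A2']" 3 "[x1, x2]"]) simp_all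
    then have Y: "{a, A2, A2'} - {x1, x2} \<subseteq> Y" "Y \<inter> {x1, x2} = {}" "card Y = 3" by simp_all
    then obtain y1 y2 m2 where y: "Y = {y1, y2, m2}" "distinct [y1, y2, m2]" using card_eq_3 by metis
    obtain k where k: "avoids k [y1, y2, m2, x1, x2]" by (erule fresh_colour[rotated]) simp
    obtain l where l: "avoids l [y1, y2, m2, x1, x2, k]" by (erule fresh_colour[rotated]) simp
    have "k \<notin> {A1, A1', A2, A2'}" "l \<notin> {A1, A1', A2, A2'}" using Y(1) k l a y(1) by auto
    then have "?P x1 A1 A1' x2 A2 A2' y1 y2 x2 m2 k l l k" using Y(2) y k l x(1) by auto
    then show ?thesis by blast
  qed
  consider (none) "x1 = x2 \<or> x2 \<notin> {A1, A1'} \<and> x1 \<notin> {A2, A2'}"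
    | (both) "x1 \<noteq> x2" "x2 \<in> {A1, A1'}" "x1 \<in> {A2, A2'}"
    | (first) "x1 \<noteq> x2" "x2 \<in> {A1, A1'}" "x1 \<notin> {A2, A2'}"
    | (second) "x1 \<noteq> x2" "x1 \<in> {A2, A2'}" "x2 \<notin> {A1, A1'}"
    by blast
  then show ?thesis
  proof cases
    case none
    obtain K where "set [A1, A1', A2, A2'] - set [x1, x2] \<subseteq> K" "K \<inter> set [x1, x2] = {}" "card K = 4"
      by (rule superset_colours[of "[A1, A1', A2, A2']" 4 "[x1, x2]"]) simp_all
    then have K: "{A1, A1', A2, A2'} - {x1, x2} \<subseteq> K" "K \<inter> {x1, x2} = {}" "card K = 4" by simp_all
    then obtain y1 y2 m1 m2 where yK: "K = {y1, y2, m1, m2}" "distinct [y1, y2, m1, m2]"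
      using card_eq_4 by metis
    obtain k where k: "avoids k [y1, y2, m1, m2, x1, x2]" by (erule fresh_colour[rotated]) simp
    show ?thesis
    proof (cases "x1 = x2")
      case True
      obtain l where l: "avoids l [y1, y2, m1, m2, x1, k]" by (erule fresh_colour[rotated]) simp
      have "k \<notin> {A1, A1', A2, A2'}" "l \<notin> {A1, A1', A2, A2'}" using K(1) k l yK(1) True by auto
      then have "?P x1 A1 A1' x2 A2 A2' y1 y2 m1 m2 k l l k" using K(2) yK k l True by auto
      then show ?thesis by blast
    next
      case False
      have "k \<notin> {A1, A1', A2, A2'}" using K(1) k yK(1) by auto
      then have "?P x1 A1 A1' x2 A2 A2' y1 y2 m1 m2 x2 k k x1" using none False K(2) yK k by auto
      then show ?thesis by blast
    qed
  next
    case both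
    obtain a b where ab: "{A1, A1'} \<subseteq> {x2, a}" "{A2, A2'} \<subseteq> {x1, b}" using both by blast
    obtain Y where "set [a, b] - set [x1, x2] \<subseteq> Y" "Y \<inter> set [x1, x2] = {}" "card Y = 2"
      by (rule superset_colours[of "[a, b]" 2 "[x1, x2]"]) simp_all
    then have Y: "{a, b} - {x1, x2} \<subseteq> Y" "Y \<inter> {x1, x2} = {}" "card Y = 2" by simp_all
    then obtain y1 y2 where y: "Y = {y1, y2}" "distinct [y1, y2]" using card_eq_2 by metis
    obtain k where k: "avoids k [y1, y2, x1, x2]" by (erule fresh_colour[rotated]) simp
    obtain l where l: "avoids l [y1, y2, x1, x2, k]" by (erule fresh_colour[rotated]) simp
    have "k \<notin> {A1, A1', A2, A2'}" "l \<notin> {A1, A1', A2, A2'}" using Y(1) k l ab y(1) by auto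
    then have "?P x1 A1 A1' x2 A2 A2' y1 y2 x2 x1 k l l k" using Y(2) y k l both(1) by auto
    then show ?thesis by blast
  next
    case first
    then show ?thesis by (rule one_sided)
  next
    case second
    have "?S x2 A2 A2' x1 A1 A1'" using one_sided[of x2 x1 A2 A2' A1 A1'] second by auto
    then show ?thesis by (rule swap)
  qed
qed

section \<open>Triangles on both sides of a vertex of degree 2\<close>

text \<open>Corner \<open>a\<close> is joined to a vertex of degree 2 by an edge coloured
  \<open>y\<close>; the other edge at that vertex, coloured \<open>z\<close>, sees the two triangle
  edges at \<open>a\<close>, which are \<open>tb\<close> and \<open>tc\<close>.\<close>

definition offers :: "colour \<Rightarrow> colour \<Rightarrow> colour \<Rightarrow> colour \<Rightarrow> colour \<Rightarrow> colour \<Rightarrow> colour \<Rightarrow> colour \<Rightarrow> bool" where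
  "offers xb B1 B2 xc C1 C2 y z \<longleftrightarrow>
     (\<exists>ta tb tc. port_colours xb B1 B2 xc C1 C2 y ta tb tc \<and> z \<notin> {tb, tc})"

text \<open>For the outer colours that a triangle offers, the first alternative occurs if the colour pairs seen at the far ends of
  the other two outer edges coincide. Otherwise \<open>p\<close>, \<open>q\<close>, \<open>r\<close> can be taken from these pairs.\<close>

definition rich :: "(colour \<Rightarrow> colour \<Rightarrow> bool) \<Rightarrow> bool" where
  "rich R \<longleftrightarrow>
     (\<exists>p q. p \<noteq> q \<and> (\<forall>z. z \<noteq> p \<longrightarrow> R p z) \<and> (\<forall>z. z \<noteq> q \<longrightarrow> R q z)) \<or>
     (\<exists>p q r s. distinct [p, q, r, s] \<and> (\<forall>z. z \<notin> {p, q} \<longrightarrow> R p z) \<and> (\<forall>z. z \<notin> {p, q} \<longrightarrow> R q z)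
        \<and> (\<forall>z. z \<notin> {r, s} \<longrightarrow> R r z))"

lemma exact_pair:
  fixes xb xc B1 B2 :: colour
  assumes "xb \<noteq> xc"
  obtains b1 b2 where "distinct [xb, xc, b1, b2]" "{B1, B2} \<subseteq> {xb, xc, b1, b2}"
proof -
  obtain K where "set [B1, B2] - set [xb, xc] \<subseteq> K" "K \<inter> set [xb, xc] = {}" "card K = 2"
    by (rule superset_colours[of "[B1, B2]" 2 "[xb, xc]"]) simp_all
  moreover from this obtain b1 b2 where "K = {b1, b2}" "distinct [b1, b2]" using card_eq_2 by metis
  ultimately show ?thesis using that[of b1 b2] assms by auto
qed

lemma offersI:
  assumes "{B1, B2} \<subseteq> {xb, xc, b1, b2}" "{C1, C2} \<subseteq> {xb, xc, c1, c2}"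
    and "distinct [xb, xc, y, ta, tb, tc]" "ta \<notin> {b1, b2, c1, c2}" "tb \<notin> {c1, c2}" "tc \<notin> {b1, b2}"
    and "z \<notin> {tb, tc}"
  shows "offers xb B1 B2 xc C1 C2 y z"
proof -
  have "ta \<notin> {B1, B2, C1, C2}" "tb \<notin> {C1, C2}" "tc \<notin> {B1, B2}" using assms by auto
  then have "port_colours xb B1 B2 xc C1 C2 y ta tb tc"
    using assms(3) unfolding port_colours_def by blast
  then show ?thesis using assms(7) unfolding offers_def by blast
qed

text \<open>Outer colours at \<open>a\<close> are taken from the far pairs, since these colours are
  the least useful inside the triangle. If the pairs agree, the three remaining colours can be
  permuted to put \<open>z\<close> opposite \<open>a\<close>. If they are disjoint, a colour of one
  pair goes on \<open>a\<close>'s outer edge, its partner on one edge at \<open>a\<close>, and the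
  other edge at \<open>a\<close> has a choice of two. Pairs with one common colour are
  similar.\<close>

lemma rich_offers:
  assumes "xb \<noteq> xc"
  shows "rich (offers xb B1 B2 xc C1 C2)"
proof -
  obtain b1 b2 where b: "distinct [xb, xc, b1, b2]" "{B1, B2} \<subseteq> {xb, xc, b1, b2}"
    using exact_pair[OF assms] .
  obtain c1 c2 where c: "distinct [xb, xc, c1, c2]" "{C1, C2} \<subseteq> {xb, xc, c1, c2}"
    using exact_pair[OF assms] .
  note I = offersI[OF b(2) c(2)]
  have overlap: "rich (offers xb B1 B2 xc C1 C2)"
    if d: "distinct [xb, xc, u, v, w]" and b: "{b1, b2} = {u, v}" and c: "{c1, c2} = {u, w}" for u v w
  proof -
    have I': "offers xb B1 B2 xc C1 C2 y z"
      if "distinct [xb, xc, y, ta, tb, tc]" "ta \<notin> {u, v, w}" "tb \<notin> {u, w}" "tc \<notin> {u, v}" "z \<notin> {tb, tc}"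
      for y ta tb tc z
    proof (rule I[OF that(1)])
      show "ta \<notin> {b1, b2, c1, c2}" using that(2) b c by blast
    qed (use that b c in blast)+
    obtain e where e: "avoids e [xb, xc, u, v, w]" by (erule fresh_colour[rotated]) simp
    obtain f where f: "avoids f [xb, xc, u, v, w, e]" by (erule fresh_colour[rotated]) simp
    have "offers xb B1 B2 xc C1 C2 v z" if "z \<notin> {v, w}" for z
    proof (cases "z = e")
      case True then show ?thesis using d e f that by (intro I'[of v e f w]) auto
    next
      case False then show ?thesis using d e f that by (intro I'[of v f e w]) auto
    qed
    moreover have "offers xb B1 B2 xc C1 C2 w z" if "z \<notin> {v, w}" for z
    proof (cases "z = e")
      case True then show ?thesis using d e f that by (intro I'[of w e v f]) auto
    next
      case False then show ?thesis using d e f that by (intro I'[of w f v e]) auto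
    qed
    moreover have "offers xb B1 B2 xc C1 C2 u z" if "z \<notin> {u, e}" for z
    proof (cases "z = v")
      case True then show ?thesis using d e f that by (intro I'[of u f e w]) auto
    next
      case zv: False
      show ?thesis
      proof (cases "z = w")
        case True then show ?thesis using d e f that zv by (intro I'[of u f v e]) auto
      next
        case False then show ?thesis using d e f that zv by (intro I'[of u f v w]) auto
      qed
    qed
    moreover have "distinct [v, w, u, e]" using d e by auto
    ultimately show ?thesis unfolding rich_def by blast
  qed
  consider (eq) "{b1, b2} = {c1, c2}" | (disj) "{b1, b2} \<inter> {c1, c2} = {}"
    | (one) u v w where "distinct [xb, xc, u, v, w]" "{b1, b2} = {u, v}" "{c1, c2} = {u, w}"
  proof -
    have "{b1, b2} = {c1, c2} \<or> {b1, b2} \<inter> {c1, c2} = {} \<or> b1 = c1 \<and> b2 \<noteq> c2 \<or> b1 = c2 \<and> b2 \<noteq> c1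
      \<or> b2 = c1 \<and> b1 \<noteq> c2 \<or> b2 = c2 \<and> b1 \<noteq> c1"
      by blast
    then show ?thesis
    proof (elim disjE conjE)
      assume "b1 = c1" "b2 \<noteq> c2"
      then show ?thesis using b(1) c(1) by (intro that(3)[of b1 b2 c2]) auto
    next
      assume "b1 = c2" "b2 \<noteq> c1"
      then show ?thesis using b(1) c(1) by (intro that(3)[of b1 b2 c1]) auto
    next
      assume "b2 = c1" "b1 \<noteq> c2"
      then show ?thesis using b(1) c(1) by (intro that(3)[of b2 b1 c2]) auto
    next
      assume "b2 = c2" "b1 \<noteq> c1"
      then show ?thesis using b(1) c(1) by (intro that(3)[of b2 b1 c1]) auto
    qed (fact that(1), fact that(2))
  qed
  then show ?thesis
  proof cases
    case eq
    obtain e where e: "avoids e [xb, xc, b1, b2]" by (erule fresh_colour[rotated]) simp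
    obtain f where f: "avoids f [xb, xc, b1, b2, e]" by (erule fresh_colour[rotated]) simp
    obtain g where g: "avoids g [xb, xc, b1, b2, e, f]" by (erule fresh_colour[rotated]) simp
    have J: "offers xb B1 B2 xc C1 C2 y z" if "distinct [xb, xc, y, ta, tb, tc]" "ta \<notin> {b1, b2}" "tb \<notin> {b1, b2}"
      "tc \<notin> {b1, b2}" "z \<notin> {tb, tc}" for y ta tb tc z
    proof (rule I[OF that(1)])
      show "ta \<notin> {b1, b2, c1, c2}" using that(2) eq by blast
    qed (use that eq in blast)+
    have "offers xb B1 B2 xc C1 C2 y z" if "y \<in> {b1, b2}" for y z
    proof -
      have y: "avoids y [xb, xc, e, f, g]" using that b(1) e f g by auto
      consider "z \<notin> {e, f}" | "z \<notin> {e, g}" | "z \<notin> {f, g}" using e f g by auto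
      then show ?thesis
      proof cases
        case 1 then show ?thesis using b(1) e f g y by (intro J[of y g e f]) auto
      next
        case 2 then show ?thesis using b(1) e f g y by (intro J[of y f e g]) auto
      next
        case 3 then show ?thesis using b(1) e f g y by (intro J[of y e f g]) auto
      qed
    qed
    then have "b1 \<noteq> b2 \<and> (\<forall>z. z \<noteq> b1 \<longrightarrow> offers xb B1 B2 xc C1 C2 b1 z) \<and> (\<forall>z. z \<noteq> b2 \<longrightarrow> offers xb B1 B2 xc C1 C2 b2 z)"
      using b(1) by simp
    then show ?thesis unfolding rich_def by blast
  next
    case disj
    obtain e where e: "avoids e [xb, xc, b1, b2, c1, c2]" by (erule fresh_colour[rotated]) simp
    have d: "distinct [xb, xc, b1, b2, c1, c2, e]" using b(1) c(1) disj e by auto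
    have "offers xb B1 B2 xc C1 C2 b1 z" if "z \<notin> {b1, b2}" for z
    proof (cases "z = c1")
      case True then show ?thesis using d that by (intro I[of b1 e b2 c2]) auto
    next
      case False then show ?thesis using d that by (intro I[of b1 e b2 c1]) auto
    qed
    moreover have "offers xb B1 B2 xc C1 C2 b2 z" if "z \<notin> {b1, b2}" for z
    proof (cases "z = c1")
      case True then show ?thesis using d that by (intro I[of b2 e b1 c2]) auto
    next
      case False then show ?thesis using d that by (intro I[of b2 e b1 c1]) auto
    qed
    moreover have "offers xb B1 B2 xc C1 C2 c1 z" if "z \<notin> {c1, c2}" for z
    proof (cases "z = b1")
      case True then show ?thesis using d that by (intro I[of c1 e b2 c2]) auto
    next
      case False then show ?thesis using d that by (intro I[of c1 e b1 c2]) auto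
    qed
    moreover have "distinct [b1, b2, c1, c2]" using d by auto
    ultimately show ?thesis unfolding rich_def by blast
  next
    case one
    then show ?thesis by (rule overlap)
  qed
qed

text \<open>Suppose both sides satisfy the second alternative. If \<open>{p, q}\<close> and
  \<open>{p', q'}\<close> differ, an element of each outside the other works. If they agree,
  \<open>r\<close> and \<open>p'\<close> work, because \<open>{r, s}\<close> is disjoint from
  \<open>{p, q}\<close>. The first alternative excludes less.\<close>

lemma rich_pair:
  assumes "rich R" "rich R'"
  shows "\<exists>y y'. y \<noteq> y' \<and> R y y' \<and> R' y' y"
  using assms unfolding rich_def
proof (elim disjE exE conjE)
  fix p q r s p' q' r' s'
  assume "distinct [p, q, r, s]" "distinct [p', q', r', s']"
    "\<forall>z. z \<notin> {p, q} \<longrightarrow> R p z" "\<forall>z. z \<notin> {p, q} \<longrightarrow> R q z" "\<forall>z. z \<notin> {r, s} \<longrightarrow> R r z"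
    "\<forall>z. z \<notin> {p', q'} \<longrightarrow> R' p' z" "\<forall>z. z \<notin> {p', q'} \<longrightarrow> R' q' z" "\<forall>z. z \<notin> {r', s'} \<longrightarrow> R' r' z"
  then show ?thesis by (smt (verit) distinct_length_2_or_more insert_iff empty_iff)
next
  fix p q p' q' r' s'
  assume "p \<noteq> q" "distinct [p', q', r', s']"
    "\<forall>z. z \<noteq> p \<longrightarrow> R p z" "\<forall>z. z \<noteq> q \<longrightarrow> R q z"
    "\<forall>z. z \<notin> {p', q'} \<longrightarrow> R' p' z" "\<forall>z. z \<notin> {p', q'} \<longrightarrow> R' q' z" "\<forall>z. z \<notin> {r', s'} \<longrightarrow> R' r' z"
  then show ?thesis by (smt (verit) distinct_length_2_or_more insert_iff empty_iff)
next
  fix p q r s p' q'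
  assume "distinct [p, q, r, s]" "p' \<noteq> q'"
    "\<forall>z. z \<notin> {p, q} \<longrightarrow> R p z" "\<forall>z. z \<notin> {p, q} \<longrightarrow> R q z" "\<forall>z. z \<notin> {r, s} \<longrightarrow> R r z"
    "\<forall>z. z \<noteq> p' \<longrightarrow> R' p' z" "\<forall>z. z \<noteq> q' \<longrightarrow> R' q' z"
  then show ?thesis by (smt (verit) distinct_length_2_or_more insert_iff empty_iff)
next
  fix p q p' q'
  assume "p \<noteq> q" "p' \<noteq> q'" "\<forall>z. z \<noteq> p \<longrightarrow> R p z" "\<forall>z. z \<noteq> q \<longrightarrow> R q z"
    "\<forall>z. z \<noteq> p' \<longrightarrow> R' p' z" "\<forall>z. z \<noteq> q' \<longrightarrow> R' q' z"
  then show ?thesis by metis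
qed


section \<open>Evaluated checks; three triangles in a cycle\<close>

definition colours :: "colour list" where
  "colours = [Col0, Col1, Col2, Col3, Col4, Col5, Col6]"

text \<open>Unlike \<open>avoids\<close>, each disequation is tested once, because this version is
  executed in a search.\<close>

primrec misses :: "colour \<Rightarrow> colour list \<Rightarrow> bool" where
  "misses k [] = True"
| "misses k (x # xs) \<longleftrightarrow> k \<noteq> x \<and> misses k xs"

lemma misses_iff: "misses k xs \<longleftrightarrow> k \<notin> set xs"
  by (induction xs) auto

primrec colour_index :: "colour \<Rightarrow> nat" where
  "colour_index Col0 = 0" | "colour_index Col1 = 1" | "colour_index Col2 = 2" | "colour_index Col3 = 3"
| "colour_index Col4 = 4" | "colour_index Col5 = 5" | "colour_index Col6 = 6"

lemma colour_index_inject: "colour_index a = colour_index b \<longleftrightarrow> a = b"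
  by (cases a; cases b) simp_all

text \<open>Ordering by index lists each of the 21 unordered pairs once.\<close>

definition colour_pairs :: "(colour \<times> colour) list" where
  "colour_pairs = concat (map (\<lambda>a. map (Pair a) (filter (\<lambda>b. colour_index a < colour_index b) colours)) colours)"

lemma set_colours: "set colours = UNIV"
  by (simp add: colours_def UNIV_colour)

lemma in_colour_pairs: "(a, b) \<in> set colour_pairs \<longleftrightarrow> colour_index a < colour_index b"
  by (auto simp: colour_pairs_def set_colours)

lemma colour_pairs_cases:
  assumes "a \<noteq> b"
  shows "(a, b) \<in> set colour_pairs \<or> (b, a) \<in> set colour_pairs"
  using assms by (metis colour_index_inject in_colour_pairs linorder_neqE_nat)

lemma colour_relabelling:
  assumes "distinct [k0, k1, k2, k3, k4, k5, k6 :: colour]"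
  obtains f where "bij f" "f Col0 = k0" "f Col1 = k1" "f Col2 = k2" "f Col3 = k3" "f Col4 = k4"
    "f Col5 = k5" "f Col6 = k6"
proof -
  let ?f = "case_colour k0 k1 k2 k3 k4 k5 k6"
  have "inj ?f" unfolding inj_def using assms by (auto split: colour.splits)
  then have "bij ?f" using finite_UNIV_inj_surj[of ?f] by (simp add: bij_def)
  then show ?thesis using that[of ?f] by simp
qed

text \<open>Three triangles in a cyclic arrangement. Triangle \<open>i\<close> has outer colour \<open>x\<^sub>i\<close> with \<open>A\<^sub>i, A\<^sub>i'\<close> at the far end,
  the edge \<open>m\<^sub>i\<close> opposite the outer corner, and the edges \<open>s\<^sub>i\<close>, \<open>r\<^sub>i\<close> towards the previous and the next triangle.\<close>

definition cycle_sol where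
  "cycle_sol x1 A1 A1' x2 A2 A2' x3 A3 A3' y12 y23 y31 m1 m2 m3 s1 r1 s2 r2 s3 r3 \<longleftrightarrow>
     distinct [x1, y31, y12, m1, s1, r1 :: colour] \<and> distinct [x2, y12, y23, m2, s2, r2] \<and>
     distinct [x3, y23, y31, m3, s3, r3] \<and>
     distinct [m1, r1, m2, s2] \<and> distinct [m2, r2, m3, s3] \<and> distinct [m3, r3, m1, s1] \<and>
     s1 \<notin> {A1, A1'} \<and> r1 \<notin> {A1, A1'} \<and> s2 \<notin> {A2, A2'} \<and> r2 \<notin> {A2, A2'} \<and> s3 \<notin> {A3, A3'} \<and> r3 \<notin> {A3, A3'}"

definition cycle_solvable where
  "cycle_solvable x1 A1 A1' x2 A2 A2' x3 A3 A3' \<longleftrightarrow>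
     (\<exists>y12 y23 y31 m1 m2 m3 s1 r1 s2 r2 s3 r3.
        cycle_sol x1 A1 A1' x2 A2 A2' x3 A3 A3' y12 y23 y31 m1 m2 m3 s1 r1 s2 r2 s3 r3)"

lemma cycle_solvableI:
  "cycle_sol x1 A1 A1' x2 A2 A2' x3 A3 A3' y12 y23 y31 m1 m2 m3 s1 r1 s2 r2 s3 r3
    \<Longrightarrow> cycle_solvable x1 A1 A1' x2 A2 A2' x3 A3 A3'"
  unfolding cycle_solvable_def by blast

lemma cycle_solvable_rotate:
  assumes "cycle_solvable x2 A2 A2' x3 A3 A3' x1 A1 A1'"
  shows "cycle_solvable x1 A1 A1' x2 A2 A2' x3 A3 A3'"
proof -
  from assms obtain y23 y31 y12 m2 m3 m1 s2 r2 s3 r3 s1 r1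
    where "cycle_sol x2 A2 A2' x3 A3 A3' x1 A1 A1' y23 y31 y12 m2 m3 m1 s2 r2 s3 r3 s1 r1"
    unfolding cycle_solvable_def by blast
  then have "cycle_sol x1 A1 A1' x2 A2 A2' x3 A3 A3' y12 y23 y31 m1 m2 m3 s1 r1 s2 r2 s3 r3"
    unfolding cycle_sol_def by auto
  then show ?thesis by (rule cycle_solvableI)
qed

text \<open>A restricted search for the case that the far pair of triangle 1 consists of the other
  two outer colours. The links at triangle 1 take these colours crosswise (\<open>y12\<close> the
  outer colour of triangle 3, \<open>y31\<close> that of triangle 2), and \<open>m1\<close> shares
  the colour \<open>w\<close> with the opposite link \<open>y23\<close>. Only eight edges are left
  to search.\<close>

definition cycle_test :: "colour \<times> colour \<Rightarrow> colour \<times> colour \<Rightarrow> bool" where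
  "cycle_test = (\<lambda>(a, a') (b, b').
     list_ex (\<lambda>w. list_ex (\<lambda>m2. misses m2 [Col1, Col2, w] \<and> list_ex (\<lambda>m3. misses m3 [Col1, Col2, w, m2] \<and>
     list_ex (\<lambda>s2. misses s2 [Col1, Col2, w, m2, a, a'] \<and>
     list_ex (\<lambda>r2. misses r2 [Col1, Col2, w, m2, m3, a, a', s2] \<and>
     list_ex (\<lambda>s3. misses s3 [Col1, Col2, w, m3, m2, b, b', r2] \<and>
     list_ex (\<lambda>r3. misses r3 [Col1, Col2, w, m3, b, b', s3] \<and>
     list_ex (\<lambda>r1. misses r1 [Col0, Col1, Col2, w, m2, s2] \<and>
     list_ex (\<lambda>s1. misses s1 [Col0, Col1, Col2, w, m3, r3, r1])
       colours) colours) colours) colours) colours) colours) colours) colours) [Col3, Col4, Col5, Col6])"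

lemma cycle_test_sound:
  assumes "cycle_test (a, a') (b, b')"
  shows "cycle_solvable Col0 Col1 Col2 Col1 a a' Col2 b b'"
proof -
  from assms obtain w m2 m3 s2 r2 s3 r3 r1 s1 where
    "w \<in> {Col3, Col4, Col5, Col6}" "misses m2 [Col1, Col2, w]" "misses m3 [Col1, Col2, w, m2]"
    "misses s2 [Col1, Col2, w, m2, a, a']" "misses r2 [Col1, Col2, w, m2, m3, a, a', s2]"
    "misses s3 [Col1, Col2, w, m3, m2, b, b', r2]" "misses r3 [Col1, Col2, w, m3, b, b', s3]"
    "misses r1 [Col0, Col1, Col2, w, m2, s2]" "misses s1 [Col0, Col1, Col2, w, m3, r3, r1]"
    unfolding cycle_test_def list_ex_iff prod.case by (elim bexE conjE) (simp only: list.set)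
  then have "cycle_sol Col0 Col1 Col2 Col1 a a' Col2 b b' Col2 w Col1 w m2 m3 s1 r1 s2 r2 s3 r3"
    unfolding cycle_sol_def misses_iff by auto
  then show ?thesis by (rule cycle_solvableI)
qed

text \<open>Pairs containing \<open>Col1\<close>, respectively \<open>Col2\<close>, are skipped:
  that is the outer colour of the triangle concerned, which does not occur at its far end.\<close>

lemma cycle_test_all:
  "list_all (\<lambda>a. fst a = Col1 \<or> snd a = Col1 \<or> list_all (\<lambda>b. fst b = Col2 \<or> snd b = Col2 \<or> cycle_test a b) colour_pairs) colour_pairs"
  by code_simp


text \<open>Here triangle 1 has no far colour outside the three outer colours, so the general
  construction has nothing to absorb for it. Renaming fixes the outer colours as
  \<open>Col0\<close>, \<open>Col1\<close>, \<open>Col2\<close>, and the only freedom left is two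
  unordered pairs.\<close>

lemma cycle_solvable_special:
  assumes x: "distinct [x1, x2, x3]" and A1: "{A1, A1'} = {x2, x3}"
    and A2: "A2 \<noteq> A2'" "x2 \<notin> {A2, A2'}" and A3: "A3 \<noteq> A3'" "x3 \<notin> {A3, A3'}"
  shows "cycle_solvable x1 A1 A1' x2 A2 A2' x3 A3 A3'"
proof -
  obtain k3 where k3: "avoids k3 [x1, x2, x3]" by (erule fresh_colour[rotated]) simp
  obtain k4 where k4: "avoids k4 [x1, x2, x3, k3]" by (erule fresh_colour[rotated]) simp
  obtain k5 where k5: "avoids k5 [x1, x2, x3, k3, k4]" by (erule fresh_colour[rotated]) simp
  obtain k6 where k6: "avoids k6 [x1, x2, x3, k3, k4, k5]" by (erule fresh_colour[rotated]) simp
  have "distinct [x1, x2, x3, k3, k4, k5, k6]" using x k3 k4 k5 k6 by auto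
  then obtain f where f: "bij f" "f Col0 = x1" "f Col1 = x2" "f Col2 = x3"
    by (rule colour_relabelling)
  obtain a a' where a: "{A2, A2'} = {f a, f a'}" "(a, a') \<in> set colour_pairs"
  proof -
    obtain u v where uv: "A2 = f u" "A2' = f v" using f(1) by (metis bij_pointE)
    then have "u \<noteq> v" using A2(1) by auto
    then show ?thesis using colour_pairs_cases[of u v] that[of u v] that[of v u] uv by (auto simp: insert_commute)
  qed
  obtain b b' where b: "{A3, A3'} = {f b, f b'}" "(b, b') \<in> set colour_pairs"
  proof -
    obtain u v where uv: "A3 = f u" "A3' = f v" using f(1) by (metis bij_pointE)
    then have "u \<noteq> v" using A3(1) by auto
    then show ?thesis using colour_pairs_cases[of u v] that[of u v] that[of v u] uv by (auto simp: insert_commute)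
  qed
  have "a \<noteq> Col1" "a' \<noteq> Col1" using A2(2) f(3) unfolding a(1) by auto
  moreover have "b \<noteq> Col2" "b' \<noteq> Col2" using A3(2) f(4) unfolding b(1) by auto
  ultimately have "cycle_test (a, a') (b, b')"
    using cycle_test_all a(2) b(2) unfolding list_all_iff by fastforce
  then have "cycle_solvable Col0 Col1 Col2 Col1 a a' Col2 b b'" by (rule cycle_test_sound)
  then obtain y12 y23 y31 m1 m2 m3 s1 r1 s2 r2 s3 r3 where
    "cycle_sol Col0 Col1 Col2 Col1 a a' Col2 b b' y12 y23 y31 m1 m2 m3 s1 r1 s2 r2 s3 r3"
    unfolding cycle_solvable_def by blast
  then have "cycle_sol x1 A1 A1' x2 A2 A2' x3 A3 A3' (f y12) (f y23) (f y31) (f m1) (f m2) (f m3)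
    (f s1) (f r1) (f s2) (f r2) (f s3) (f r3)"
    unfolding cycle_sol_def A1 a(1) b(1) f(2-4)[symmetric]
    using bij_is_inj[OF f(1)] by (simp add: inj_eq)
  then show ?thesis by (rule cycle_solvableI)
qed

text \<open>Outside the special case the hexagon formed by the links and the edges \<open>m\<^sub>i\<close> can be coloured with three
  colours \<open>p, q, r\<close>, opposite edges alike, each \<open>A\<^sub>i\<close> being hit; this leaves two colours for both remaining
  edges of each triangle.\<close>

lemma cycle_colours:
  assumes A1: "A1 \<noteq> A1'" "x1 \<notin> {A1, A1'}" and A2: "A2 \<noteq> A2'" "x2 \<notin> {A2, A2'}"
    and A3: "A3 \<noteq> A3'" "x3 \<notin> {A3, A3'}"
  shows "cycle_solvable x1 A1 A1' x2 A2 A2' x3 A3 A3'"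
proof -
  consider (1) "{A1, A1'} \<subseteq> {x1, x2, x3}" | (2) "{A2, A2'} \<subseteq> {x1, x2, x3}"
    | (3) "{A3, A3'} \<subseteq> {x1, x2, x3}"
    | (4) a1 a2 a3 where "a1 \<in> {A1, A1'} - {x1, x2, x3}" "a2 \<in> {A2, A2'} - {x1, x2, x3}"
      "a3 \<in> {A3, A3'} - {x1, x2, x3}"
    by blast
  then show ?thesis
  proof cases
    case 1
    then have "distinct [x1, x2, x3]" "{A1, A1'} = {x2, x3}" using A1 by auto
    then show ?thesis using A2 A3 by (rule cycle_solvable_special)
  next
    case 2
    then have "distinct [x2, x3, x1]" "{A2, A2'} = {x3, x1}" using A2 by auto
    then have "cycle_solvable x2 A2 A2' x3 A3 A3' x1 A1 A1'" using A3 A1 by (rule cycle_solvable_special)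
    then show ?thesis by (rule cycle_solvable_rotate)
  next
    case 3
    then have "distinct [x3, x1, x2]" "{A3, A3'} = {x1, x2}" using A3 by auto
    then have "cycle_solvable x3 A3 A3' x1 A1 A1' x2 A2 A2'" using A1 A2 by (rule cycle_solvable_special)
    then show ?thesis by (rule cycle_solvable_rotate[OF cycle_solvable_rotate])
  next
    case 4
    obtain K where "set [a1, a2, a3] - set [x1, x2, x3] \<subseteq> K" "K \<inter> set [x1, x2, x3] = {}" "card K = 3"
      by (rule superset_colours[of "[a1, a2, a3]" 3 "[x1, x2, x3]"]) simp_all
    then have K: "a1 \<in> K" "a2 \<in> K" "a3 \<in> K" "x1 \<notin> K" "x2 \<notin> K" "x3 \<notin> K" "card K = 3" using 4 by auto
    then obtain p q r where pqr: "K = {p, q, r}" "distinct [p, q, r]" using card_eq_3 by metis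
    \<comment> \<open>\<open>K\<close> contains a colour of the far pair, so besides
      \<open>p\<close>, \<open>q\<close>, \<open>r\<close> at most one more far colour
      \<open>B\<close> has to be avoided.\<close>
    have two: "\<exists>u v. u \<noteq> v \<and> u \<notin> {x, p, q, r, A, A'} \<and> v \<notin> {x, p, q, r, A, A'}"
      if "a \<in> {A, A'}" "a \<in> K" for x a A A'
    proof -
      have "{A, A'} \<subseteq> {p, q, r, A} \<or> {A, A'} \<subseteq> {p, q, r, A'}" using that pqr(1) by auto
      then obtain B where B: "A \<in> {p, q, r, B}" "A' \<in> {p, q, r, B}" by (metis insert_subset)
      obtain u where u: "avoids u [x, p, q, r, B]" by (erule fresh_colour[rotated]) simp
      obtain v where v: "avoids v [x, p, q, r, B, u]" by (erule fresh_colour[rotated]) simp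
      have "u \<notin> {x, p, q, r, A, A'}" using B u by auto
      moreover have "v \<notin> {x, p, q, r, A, A'}" using B v by auto
      moreover have "u \<noteq> v" using v by simp
      ultimately show ?thesis by blast
    qed
    obtain u1 v1 where 1: "u1 \<noteq> v1" "u1 \<notin> {x1, p, q, r, A1, A1'}" "v1 \<notin> {x1, p, q, r, A1, A1'}"
      using two[of a1 A1 A1' x1] 4 K by blast
    obtain u2 v2 where 2: "u2 \<noteq> v2" "u2 \<notin> {x2, p, q, r, A2, A2'}" "v2 \<notin> {x2, p, q, r, A2, A2'}"
      using two[of a2 A2 A2' x2] 4 K by blast
    obtain u3 v3 where 3: "u3 \<noteq> v3" "u3 \<notin> {x3, p, q, r, A3, A3'}" "v3 \<notin> {x3, p, q, r, A3, A3'}"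
      using two[of a3 A3 A3' x3] 4 K by blast
    have I: "cycle_solvable x1 A1 A1' x2 A2 A2' x3 A3 A3'"
      if "s1 \<noteq> r1" "s2 \<noteq> r2" "s3 \<noteq> r3" "r1 \<noteq> s2" "r2 \<noteq> s3" "r3 \<noteq> s1"
        "s1 \<in> {u1, v1}" "r1 \<in> {u1, v1}" "s2 \<in> {u2, v2}" "r2 \<in> {u2, v2}" "s3 \<in> {u3, v3}" "r3 \<in> {u3, v3}"
      for s1 r1 s2 r2 s3 r3
    proof -
      have 1: "s1 \<notin> {x1, p, q, r, A1, A1'}" "r1 \<notin> {x1, p, q, r, A1, A1'}" using 1 that(7,8) by blast+
      have 2: "s2 \<notin> {x2, p, q, r, A2, A2'}" "r2 \<notin> {x2, p, q, r, A2, A2'}" using 2 that(9,10) by blast+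
      have 3: "s3 \<notin> {x3, p, q, r, A3, A3'}" "r3 \<notin> {x3, p, q, r, A3, A3'}" using 3 that(11,12) by blast+
      have "cycle_sol x1 A1 A1' x2 A2 A2' x3 A3 A3' p q r q r p s1 r1 s2 r2 s3 r3"
        using that(1-6) 1 2 3 K(4-6) pqr unfolding cycle_sol_def by auto
      then show ?thesis by (rule cycle_solvableI)
    qed
    \<comment> \<open>The six edges form an even cycle of constraints with two available colours
      each, and even cycles are 2-choosable.\<close>
    have "\<exists>s1 r1 s2 r2 s3 r3. s1 \<noteq> r1 \<and> s2 \<noteq> r2 \<and> s3 \<noteq> r3 \<and> r1 \<noteq> s2 \<and> r2 \<noteq> s3 \<and> r3 \<noteq> s1 \<and>
        s1 \<in> {u1, v1} \<and> r1 \<in> {u1, v1} \<and> s2 \<in> {u2, v2} \<and> r2 \<in> {u2, v2} \<and> s3 \<in> {u3, v3} \<and> r3 \<in> {u3, v3}"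
      using 1(1) 2(1) 3(1) by (smt (verit) insertCI)
    then show ?thesis using I by blast
  qed
qed

text \<open>A path of three triangles. The outer triangles have two outer edges each, whose far ends see the disjoint
  colour pairs \<open>B, C\<close> and \<open>D, E\<close>; the middle one has outer colour \<open>x\<close> with \<open>A\<close> at the far end. The links are
  coloured \<open>y, z\<close>, and \<open>p, q\<close> and \<open>p', q'\<close> are the edges of the outer triangles at their links.\<close>

definition path_sol where
  "path_sol x A B C D E y p q z p' q' m s r \<longleftrightarrow>
     p \<in> B \<and> q \<in> C \<and> y \<in> B \<union> C \<and> y \<noteq> p \<and> y \<noteq> q \<and>
     p' \<in> D \<and> q' \<in> E \<and> z \<in> D \<union> E \<and> z \<noteq> p' \<and> z \<noteq> q' \<and>
     distinct [x, y, z, m, s, r :: colour] \<and> m \<notin> {p, q, p', q'} \<and>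
     s \<notin> A \<and> s \<notin> {p, q} \<and> r \<notin> A \<and> r \<notin> {p', q'}"

definition path_solvable where
  "path_solvable x A B C D E \<longleftrightarrow> (\<exists>y p q z p' q' m s r. path_sol x A B C D E y p q z p' q' m s r)"

lemma path_solvableI: "path_sol x A B C D E y p q z p' q' m s r \<Longrightarrow> path_solvable x A B C D E"
  unfolding path_solvable_def by blast

lemma path_solvable_swap1:
  assumes "path_solvable x A C B D E"
  shows "path_solvable x A B C D E"
proof -
  obtain y p q z p' q' m s r where "path_sol x A C B D E y p q z p' q' m s r"
    using assms unfolding path_solvable_def by blast
  then have "path_sol x A B C D E y q p z p' q' m s r" unfolding path_sol_def by (simp add: Un_commute)
  then show ?thesis by (rule path_solvableI)
qed

lemma path_solvable_swap2:
  assumes "path_solvable x A B C E D"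
  shows "path_solvable x A B C D E"
proof -
  obtain y p q z p' q' m s r where "path_sol x A B C E D y p q z p' q' m s r"
    using assms unfolding path_solvable_def by blast
  then have "path_sol x A B C D E y p q z q' p' m s r" unfolding path_sol_def by (simp add: Un_commute)
  then show ?thesis by (rule path_solvableI)
qed

lemma path_solvable_relabel:
  assumes f: "bij f" and "path_solvable x A B C D E"
  shows "path_solvable (f x) (f ` A) (f ` B) (f ` C) (f ` D) (f ` E)"
proof -
  obtain y p q z p' q' m s r where "path_sol x A B C D E y p q z p' q' m s r"
    using assms(2) unfolding path_solvable_def by blast
  then have "path_sol (f x) (f ` A) (f ` B) (f ` C) (f ` D) (f ` E) (f y) (f p) (f q) (f z) (f p') (f q') (f m) (f s) (f r)"
    unfolding path_sol_def image_Un[symmetric] using bij_is_inj[OF f]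
    by (simp add: inj_eq inj_image_mem_iff)
  then show ?thesis by (rule path_solvableI)
qed

text \<open>The triples are \<open>(y, p, q)\<close>. For disjoint pairs these are all eight choices
  that \<open>path_sol\<close> permits at one end.\<close>

definition port_choices :: "colour \<times> colour \<Rightarrow> colour \<times> colour \<Rightarrow> (colour \<times> colour \<times> colour) list" where
  "port_choices = (\<lambda>(b1, b2) (c1, c2). [(b1, b2, c1), (b1, b2, c2), (b2, b1, c1), (b2, b1, c2),
     (c1, b1, c2), (c1, b2, c2), (c2, b1, c1), (c2, b2, c1)])"

definition path_test :: "colour \<Rightarrow> colour \<times> colour \<Rightarrow> colour \<times> colour \<Rightarrow> colour \<times> colour \<Rightarrow> bool" where
  "path_test x a d e \<longleftrightarrow>
     list_ex (\<lambda>(y, p, q). y \<noteq> x \<and> list_ex (\<lambda>(z, p', q'). misses z [x, y] \<and>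
       list_ex (\<lambda>m. misses m [x, y, z, p, q, p', q'] \<and>
       list_ex (\<lambda>s. misses s [x, y, z, m, fst a, snd a, p, q] \<and>
       list_ex (\<lambda>r. misses r [x, y, z, m, s, fst a, snd a, p', q']) colours) colours) colours)
     (port_choices d e)) (port_choices (Col0, Col1) (Col2, Col3))"

text \<open>Renaming makes the pairs at the first end \<open>{Col0, Col1}\<close> and
  \<open>{Col2, Col3}\<close>. The middle outer colour then either lies in one of them, and may be
  taken to be \<open>Col0\<close>, or is \<open>Col4\<close>. Exchanging the pairs at the second end
  allows an order between them.\<close>

lemma path_test_all:
  "list_all (\<lambda>a. list_all (\<lambda>d. list_all (\<lambda>e.
     \<not> (misses (fst d) [fst e, snd e] \<and> misses (snd d) [fst e, snd e]) \<or> \<not> colour_index (fst d) < colour_index (fst e) \<or>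
     ((\<not> misses Col0 [fst a, snd a] \<or> path_test Col0 a d e) \<and> (\<not> misses Col4 [fst a, snd a] \<or> path_test Col4 a d e)))
     colour_pairs) colour_pairs) colour_pairs"
  by code_simp

lemma path_test_sound:
  assumes "path_test x (a, a') (d1, d2) (e1, e2)" "distinct [d1, d2, e1, e2]"
  shows "path_solvable x {a, a'} {Col0, Col1} {Col2, Col3} {d1, d2} {e1, e2}"
proof -
  have choices: "p \<in> {b1, b2} \<and> q \<in> {c1, c2} \<and> y \<in> {b1, b2} \<union> {c1, c2} \<and> y \<noteq> p \<and> y \<noteq> q"
    if "(y, p, q) \<in> set (port_choices (b1, b2) (c1, c2))" "distinct [b1, b2, c1, c2]" for b1 b2 c1 c2 y p q
    using that unfolding port_choices_def by auto
  obtain y p q z p' q' m s r where *: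
    "(y, p, q) \<in> set (port_choices (Col0, Col1) (Col2, Col3))" "y \<noteq> x"
    "(z, p', q') \<in> set (port_choices (d1, d2) (e1, e2))" "misses z [x, y]"
    "misses m [x, y, z, p, q, p', q']" "misses s [x, y, z, m, a, a', p, q]" "misses r [x, y, z, m, s, a, a', p', q']"
    using assms(1) unfolding path_test_def list_ex_iff by auto
  have "path_sol x {a, a'} {Col0, Col1} {Col2, Col3} {d1, d2} {e1, e2} y p q z p' q' m s r"
    unfolding path_sol_def using choices[OF *(1)] choices[OF *(3) assms(2)] *(2,4-)
    by (auto simp: misses_iff)
  then show ?thesis by (rule path_solvableI)
qed

lemma path_solvable_canonical:
  assumes "x \<in> {Col0, Col4}" "distinct [a, a']" "x \<notin> {a, a'}" "distinct [d1, d2, e1, e2]"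
  shows "path_solvable x {a, a'} {Col0, Col1} {Col2, Col3} {d1, d2} {e1, e2}"
proof -
  obtain u u' where u: "{a, a'} = {u, u'}" "(u, u') \<in> set colour_pairs"
    using colour_pairs_cases[of a a'] assms(2) by (auto simp: insert_commute)
  obtain v v' where v: "{d1, d2} = {v, v'}" "(v, v') \<in> set colour_pairs"
    using colour_pairs_cases[of d1 d2] assms(4) by (auto simp: insert_commute)
  obtain w w' where w: "{e1, e2} = {w, w'}" "(w, w') \<in> set colour_pairs"
    using colour_pairs_cases[of e1 e2] assms(4) by (auto simp: insert_commute)
  have "{v, v'} \<inter> {w, w'} = {}" unfolding v(1)[symmetric] w(1)[symmetric] using assms(4) by auto
  moreover have "v \<noteq> v'" "w \<noteq> w'" using v(2) w(2) by (auto simp: in_colour_pairs)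
  ultimately have d: "distinct [v, v', w, w']" "distinct [w, w', v, v']" by auto
  have x: "x \<notin> {u, u'}" using assms(3) unfolding u(1) .
  have test: "path_test x (u, u') (g, g') (h, h')"
    if "(g, g') \<in> set colour_pairs" "(h, h') \<in> set colour_pairs" "distinct [g, g', h, h']"
      "colour_index g < colour_index h" for g g' h h'
  proof -
    have "misses g [h, h'] \<and> misses g' [h, h']" using that(3) by simp
    moreover have "misses x [u, u']" using x by simp
    ultimately show ?thesis
      using path_test_all u(2) that assms(1) unfolding list_all_iff by fastforce
  qed
  have "path_solvable x {u, u'} {Col0, Col1} {Col2, Col3} {v, v'} {w, w'}"
  proof (cases "colour_index v < colour_index w")
    case True
    then show ?thesis using path_test_sound[OF test] v(2) w(2) d by blast
  next
    case False
    then have "colour_index w < colour_index v" using colour_index_inject d(1)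
      by (metis distinct_length_2_or_more linorder_neqE_nat)
    then have "path_solvable x {u, u'} {Col0, Col1} {Col2, Col3} {w, w'} {v, v'}"
      using path_test_sound[OF test] v(2) w(2) d by blast
    then show ?thesis by (rule path_solvable_swap2)
  qed
  then show ?thesis unfolding u(1) v(1) w(1) .
qed

lemma path_colours:
  assumes "distinct [x, a, a']" and b: "distinct [b1, b2, c1, c2]" and "distinct [d1, d2, e1, e2]"
  shows "path_solvable x {a, a'} {b1, b2} {c1, c2} {d1, d2} {e1, e2}"
proof -
  have main: "path_solvable x {a, a'} {b1, b2} {c1, c2} {d1, d2} {e1, e2}"
    if b: "distinct [b1, b2, c1, c2]" and x: "x \<notin> {b2, c1, c2}" for b1 b2 c1 c2
  proof -
    \<comment> \<open>When \<open>x\<close> lies outside both pairs it becomes the fifth colour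
      itself, so its preimage under the renaming is \<open>Col0\<close> or
      \<open>Col4\<close>.\<close>
    obtain k4 where k4: "avoids k4 [b1, b2, c1, c2]" "x = b1 \<or> x = k4"
    proof (cases "x = b1")
      case True
      obtain k where "avoids k [b1, b2, c1, c2]" by (erule fresh_colour[rotated]) simp
      then show ?thesis using that True by blast
    next
      case False
      then show ?thesis using that[of x] x by auto
    qed
    obtain k5 where k5: "avoids k5 [b1, b2, c1, c2, k4]" by (erule fresh_colour[rotated]) simp
    obtain k6 where k6: "avoids k6 [b1, b2, c1, c2, k4, k5]" by (erule fresh_colour[rotated]) simp
    have "distinct [b1, b2, c1, c2, k4, k5, k6]" using b k4 k5 k6 by auto
    then obtain f where f: "bij f" "f Col0 = b1" "f Col1 = b2" "f Col2 = c1" "f Col3 = c2" "f Col4 = k4"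
      by (rule colour_relabelling)
    obtain x0 where x0: "x = f x0" "x0 \<in> {Col0, Col4}" using k4(2) f by auto
    obtain u u' v v' w w' where uvw: "a = f u" "a' = f u'" "d1 = f v" "d2 = f v'" "e1 = f w" "e2 = f w'"
      using f(1) by (metis bij_pointE)
    have "path_solvable x0 {u, u'} {Col0, Col1} {Col2, Col3} {v, v'} {w, w'}"
      using x0 assms(1,3) uvw by (intro path_solvable_canonical) auto
    from path_solvable_relabel[OF f(1) this] show ?thesis
      using f x0 uvw by simp
  qed
  consider "x \<notin> {b2, c1, c2}" | "x \<notin> {b1, c1, c2}" | "x \<notin> {c2, b1, b2}" | "x \<notin> {c1, b1, b2}"
    using b by auto
  then show ?thesis
  proof cases
    case 1 then show ?thesis using main[of b1 b2 c1 c2] b by simp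
  next
    case 2 then show ?thesis using main[of b2 b1 c1 c2] b by (auto simp: insert_commute)
  next
    case 3 then show ?thesis using main[of c1 c2 b1 b2] b by (intro path_solvable_swap1[of x _ "{c1, c2}"]) auto
  next
    case 4 then show ?thesis using main[of c2 c1 b1 b2] b
      by (intro path_solvable_swap1[of x _ "{c1, c2}"]) (auto simp: insert_commute)
  qed
qed


section \<open>Strong colourings of edge sets\<close>

definition nbrs :: "'a set set \<Rightarrow> 'a \<Rightarrow> 'a set" where
  "nbrs E v = {w. {v, w} \<in> E}"

lemma nbrs_iff [simp]: "w \<in> nbrs E v \<longleftrightarrow> {v, w} \<in> E"
  by (simp add: nbrs_def)

lemma nbrs_mem: "nbrs E v \<subseteq> S \<Longrightarrow> {v, w} \<in> E \<Longrightarrow> w \<in> S"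
  by auto

text \<open>In a subcubic graph a prism subgraph is a component. Forbidding subgraphs instead of components makes the class
  hereditary.\<close>

definition admissible :: "'a set set \<Rightarrow> bool" where
  "admissible E \<longleftrightarrow> finite E \<and> (\<forall>e\<in>E. card e = 2) \<and> (\<forall>v. card (nbrs E v) \<le> 3) \<and>
     (\<forall>v x y z. {v, x} \<in> E \<longrightarrow> {v, y} \<in> E \<longrightarrow> {v, z} \<in> E \<longrightarrow> distinct [x, y, z] \<longrightarrow>
        {x, y} \<in> E \<or> {y, z} \<in> E \<or> {x, z} \<in> E) \<and>
     (\<forall>a b c a' b' c'. distinct [a, b, c, a', b', c'] \<longrightarrow>
        \<not> {{a, b}, {b, c}, {a, c}, {a', b'}, {b', c'}, {a', c'}, {a, a'}, {b, b'}, {c, c'}} \<subseteq> E)"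

text \<open>A conflict is attached to the end vertices of the edge that carries it, instead of to a
  pair of edges. After a local recolouring only the vertices of the changed region then have to be
  examined.\<close>

definition proper_at :: "'a set set \<Rightarrow> ('a set \<Rightarrow> 'c) \<Rightarrow> 'a \<Rightarrow> bool" where
  "proper_at E \<phi> u \<longleftrightarrow>
     (\<forall>v w. {u, v} \<in> E \<longrightarrow> {u, w} \<in> E \<longrightarrow> v \<noteq> w \<longrightarrow> \<phi> {u, v} \<noteq> \<phi> {u, w}) \<and>
     (\<forall>v w z. {u, v} \<in> E \<longrightarrow> {u, w} \<in> E \<longrightarrow> {v, z} \<in> E \<longrightarrow> w \<noteq> v \<longrightarrow> z \<noteq> u \<longrightarrow> \<phi> {u, w} \<noteq> \<phi> {v, z})"

definition strong :: "'a set set \<Rightarrow> ('a set \<Rightarrow> 'c) \<Rightarrow> bool" where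
  "strong E \<phi> \<longleftrightarrow> (\<forall>u. proper_at E \<phi> u)"

lemma strong_adjacent: "strong E \<phi> \<Longrightarrow> {u, v} \<in> E \<Longrightarrow> {u, w} \<in> E \<Longrightarrow> v \<noteq> w \<Longrightarrow> \<phi> {u, v} \<noteq> \<phi> {u, w}"
  unfolding strong_def proper_at_def by blast

lemma strong_distance2:
  "strong E \<phi> \<Longrightarrow> {u, v} \<in> E \<Longrightarrow> {u, w} \<in> E \<Longrightarrow> {v, z} \<in> E \<Longrightarrow> w \<noteq> v \<Longrightarrow> z \<noteq> u \<Longrightarrow> \<phi> {u, w} \<noteq> \<phi> {v, z}"
  unfolding strong_def proper_at_def by blast

lemma strong_mono: "strong E \<phi> \<Longrightarrow> F \<subseteq> E \<Longrightarrow> strong F \<phi>"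
  unfolding strong_def proper_at_def by (meson subsetD)

lemma strong_cong: "strong E \<phi> \<Longrightarrow> (\<And>e. e \<in> E \<Longrightarrow> \<psi> e = \<phi> e) \<Longrightarrow> strong E \<psi>"
  unfolding strong_def proper_at_def by simp

lemma fun_upd_outside: "\<not> e \<subseteq> V \<Longrightarrow> k \<subseteq> V \<Longrightarrow> (f(k := x)) e = f e"
  by auto

text \<open>A conflict between edges at \<open>u\<close> and at \<open>v\<close> across
  \<open>{u, v}\<close> is visible from both ends. If one end is in \<open>V\<close>, properness
  there excludes it; if neither is, all edges at both ends stick out of \<open>V\<close> and so
  belong to \<open>F\<close>.\<close>

lemma strong_extend:
  assumes "strong F \<psi>" "\<And>e. e \<in> E \<Longrightarrow> e \<in> F \<or> e \<subseteq> V" "\<And>u. u \<in> V \<Longrightarrow> proper_at E \<psi> u"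
  shows "strong E \<psi>"
  unfolding strong_def
proof
  fix u
  show "proper_at E \<psi> u"
  proof (cases "u \<in> V")
    case False
    have u: "{u, w} \<in> F" if "{u, w} \<in> E" for w using assms(2)[OF that] False by auto
    show ?thesis
      unfolding proper_at_def
    proof (intro conjI allI impI)
      fix v w assume "{u, v} \<in> E" "{u, w} \<in> E" "v \<noteq> w"
      then show "\<psi> {u, v} \<noteq> \<psi> {u, w}" using strong_adjacent[OF assms(1)] u by blast
    next
      fix v w z assume h: "{u, v} \<in> E" "{u, w} \<in> E" "{v, z} \<in> E" "w \<noteq> v" "z \<noteq> u"
      show "\<psi> {u, w} \<noteq> \<psi> {v, z}"
      proof (cases "v \<in> V")
        case True
        then have "proper_at E \<psi> v" by (rule assms(3))
        moreover have "{v, u} \<in> E" using h(1) by (simp add: insert_commute)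
        ultimately have "\<psi> {v, z} \<noteq> \<psi> {u, w}" using h unfolding proper_at_def by blast
        then show ?thesis by simp
      next
        case False
        then have "{v, z} \<in> F" using assms(2)[OF h(3)] by auto
        then show ?thesis using strong_distance2[OF assms(1)] u h by blast
      qed
    qed
  qed (rule assms(3))
qed

section \<open>Pendant edges, neighbourhoods and vertex deletion\<close>

lemma strong_pendant:
  assumes F: "strong F \<phi>" and u: "\<And>w. {u, w} \<notin> F" and "u \<noteq> v" "{v, v} \<notin> F"
    and v: "\<And>w. {v, w} \<in> F \<Longrightarrow> \<phi> {v, w} \<noteq> k"
    and vw: "\<And>w z. {v, w} \<in> F \<Longrightarrow> {w, z} \<in> F \<Longrightarrow> \<phi> {w, z} \<noteq> k"
  shows "strong (insert {u, v} F) (\<phi>({u, v} := k))"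
proof -
  let ?E = "insert {u, v} F" and ?\<psi> = "\<phi>({u, v} := k)"
  have old: "{x, y} \<noteq> {u, v}" if "{x, y} \<in> F" for x y
    using that u by (metis doubleton_eq_iff)
  have nu: "x \<noteq> u" "y \<noteq> u" if "{x, y} \<in> F" for x y
    using that u by (metis insert_commute)+
  have E: "{x, y} \<in> ?E \<longleftrightarrow> {x, y} \<in> F \<or> x = u \<and> y = v \<or> x = v \<and> y = u" for x y
    by (auto simp: doubleton_eq_iff)
  have \<psi>: "?\<psi> {x, y} = \<phi> {x, y}" if "{x, y} \<in> F" for x y using old[OF that] by simp
  have k: "?\<psi> {u, v} = k" "?\<psi> {v, u} = k" by (simp_all add: insert_commute)
  show ?thesis
    unfolding strong_def proper_at_def
  proof (intro conjI allI impI)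
    fix x y w assume h: "{x, y} \<in> ?E" "{x, w} \<in> ?E" "y \<noteq> w"
    show "?\<psi> {x, y} \<noteq> ?\<psi> {x, w}"
    proof (cases "{x, y} \<in> F")
      case True
      show ?thesis
      proof (cases "{x, w} \<in> F")
        case False
        then have "x = v \<and> w = u" using h(2) nu[OF True] unfolding E by blast
        then show ?thesis using \<psi>[OF True] v True k by simp
      qed (use strong_adjacent[OF F True] h(3) \<psi>[OF True] \<psi> in simp)
    next
      case False
      then have "x = u \<and> y = v \<or> x = v \<and> y = u" using h(1) unfolding E by blast
      moreover from this have xw: "{x, w} \<in> F" "x = v \<and> y = u" using h(2,3) u unfolding E by auto
      ultimately show ?thesis using \<psi>[OF xw(1)] v[of w] xw k by simp
    qed
  next
    fix x y w z assume h: "{x, y} \<in> ?E" "{x, w} \<in> ?E" "{y, z} \<in> ?E" "w \<noteq> y" "z \<noteq> x"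
    show "?\<psi> {x, w} \<noteq> ?\<psi> {y, z}"
    proof (cases "{x, y} \<in> F")
      case xy: True
      then have yx: "{y, x} \<in> F" by (simp add: insert_commute)
      show ?thesis
      proof (cases "{x, w} \<in> F")
        case xw: True
        show ?thesis
        proof (cases "{y, z} \<in> F")
          case True
          then show ?thesis using strong_distance2[OF F xy xw True h(4,5)] \<psi>[OF xw] \<psi>[OF True] by simp
        next
          case False
          then have "y = v \<and> z = u" using h(3) nu[OF xy] unfolding E by blast
          then show ?thesis using vw[of x w] yx xw \<psi>[OF xw] k by simp
        qed
      next
        case False
        then have xw: "x = v \<and> w = u" using h(2) nu[OF xy] unfolding E by blast
        then have "{y, z} \<in> F" using h(3,5) nu[OF xy] xy assms(4) unfolding E by auto
        then show ?thesis using vw[of y z] xy xw \<psi> k by simp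
      qed
    next
      case False
      then have "x = u \<and> y = v \<or> x = v \<and> y = u" using h(1) unfolding E by blast
      then show ?thesis using h(2-5) u unfolding E by auto
    qed
  qed
qed

lemma admissible_card: "admissible E \<Longrightarrow> e \<in> E \<Longrightarrow> card e = 2"
  by (simp add: admissible_def)

lemma admissible_no_loop: "admissible E \<Longrightarrow> {v, w} \<in> E \<Longrightarrow> v \<noteq> w"
  using admissible_card[of E "{v, w}"] by auto

lemma admissible_edgeE:
  assumes "admissible E" "e \<in> E"
  obtains v w where "e = {v, w}" "v \<noteq> w"
  using admissible_card[OF assms] by (auto simp: card_2_iff)

lemma finite_nbrs: "admissible E \<Longrightarrow> finite (nbrs E v)"
proof -
  assume "admissible E"
  then have "finite E" by (simp add: admissible_def)
  moreover have "(\<lambda>w. {v, w}) ` nbrs E v \<subseteq> E" by auto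
  moreover have "inj_on (\<lambda>w. {v, w}) (nbrs E v)" by (auto simp: inj_on_def doubleton_eq_iff)
  ultimately show ?thesis by (meson finite_imageD finite_subset)
qed

lemma admissible_claw:
  "admissible E \<Longrightarrow> {v, x} \<in> E \<Longrightarrow> {v, y} \<in> E \<Longrightarrow> {v, z} \<in> E \<Longrightarrow> distinct [x, y, z] \<Longrightarrow>
    {x, y} \<in> E \<or> {y, z} \<in> E \<or> {x, z} \<in> E"
  unfolding admissible_def by blast

text \<open>The three names may coincide or denote non-neighbours. This gives lists of seen colours
  of fixed length without distinguishing degrees.\<close>

lemma admissible_nbrs_subset:
  assumes "admissible E"
  obtains p q r where "nbrs E v \<subseteq> {p, q, r}"
proof -
  have "card (nbrs E v) \<le> 3" using assms by (simp add: admissible_def)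
  then obtain K where K: "nbrs E v \<subseteq> K" "finite K" "card K \<le> 3" using finite_nbrs[OF assms] by blast
  have "\<exists>p q r. K \<subseteq> {p, q, r}"
  proof -
    obtain xs where xs: "set xs = K" "length xs = card K"
      using finite_distinct_list[OF K(2)] distinct_card by metis
    then consider "xs = []" | x where "xs = [x]" | x y where "xs = [x, y]" | x y z where "xs = [x, y, z]"
    proof -
      have "length xs \<le> 3" using xs(2) K(3) by simp
      then show ?thesis
        using that by (cases xs; cases "tl xs"; cases "tl (tl xs)"; cases "tl (tl (tl xs))") auto
    qed
    then show ?thesis using xs(1) by cases auto
  qed
  then show ?thesis using K(1) that by blast
qed

lemma admissible_nbrs_subset1:
  assumes "admissible E" "{v, p} \<in> E"
  obtains q r where "nbrs E v \<subseteq> {p, q, r}"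
proof -
  obtain x y z where "nbrs E v \<subseteq> {x, y, z}" using admissible_nbrs_subset[OF assms(1)] .
  moreover have "p \<in> nbrs E v" using assms(2) by simp
  ultimately show ?thesis using that by (metis (no_types, lifting) insert_commute insert_iff singletonD subsetD)
qed

lemma admissible_nbrs_subset2:
  assumes "admissible E" "{v, p} \<in> E" "{v, q} \<in> E" "p \<noteq> q"
  obtains r where "nbrs E v \<subseteq> {p, q, r}"
proof -
  obtain x y where s: "nbrs E v \<subseteq> {p, x, y}" using admissible_nbrs_subset1[OF assms(1,2)] .
  moreover have "q \<in> nbrs E v" using assms(3) by simp
  ultimately have "q = x \<or> q = y" using assms(4) by auto
  then show ?thesis using that[of x] that[of y] s by (auto simp: insert_commute)
qed

lemma admissible_nbrs_eq:
  assumes "admissible E" "{v, p} \<in> E" "{v, q} \<in> E" "{v, r} \<in> E" "distinct [p, q, r]"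
  shows "nbrs E v = {p, q, r}"
proof -
  obtain x where s: "nbrs E v \<subseteq> {p, q, x}" using admissible_nbrs_subset2[OF assms(1-3)] assms(5) by auto
  moreover have "r \<in> nbrs E v" using assms(4) by simp
  ultimately have "x = r" using assms(5) by auto
  then show ?thesis using s assms by auto
qed

definition delete :: "'a set set \<Rightarrow> 'a set \<Rightarrow> 'a set set" where
  "delete E S = {e \<in> E. e \<inter> S = {}}"

lemma delete_iff: "{u, v} \<in> delete E S \<longleftrightarrow> {u, v} \<in> E \<and> u \<notin> S \<and> v \<notin> S"
  by (auto simp: delete_def)

lemma delete_subset: "delete E S \<subseteq> E"
  by (auto simp: delete_def)

text \<open>Vertices are deleted instead of edges, since removing one edge of a triangle can create
  a claw.\<close>

lemma admissible_delete:
  assumes "admissible E"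
  shows "admissible (delete E S)"
proof -
  have "finite (delete E S)" using assms delete_subset finite_subset unfolding admissible_def by metis
  moreover have "card (nbrs (delete E S) v) \<le> 3" for v
  proof -
    have "nbrs (delete E S) v \<subseteq> nbrs E v" using delete_subset[of E S] by auto
    then have "card (nbrs (delete E S) v) \<le> card (nbrs E v)" using finite_nbrs[OF assms] card_mono by blast
    then show ?thesis using assms unfolding admissible_def by (meson le_trans)
  qed
  moreover have "\<forall>e\<in>delete E S. card e = 2" using assms delete_subset unfolding admissible_def by blast
  moreover have "{x, y} \<in> delete E S \<or> {y, z} \<in> delete E S \<or> {x, z} \<in> delete E S"
    if "{v, x} \<in> delete E S" "{v, y} \<in> delete E S" "{v, z} \<in> delete E S" "distinct [x, y, z]" for v x y z
    using admissible_claw[OF assms, of v x y z] that unfolding delete_iff by blast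
  moreover have "\<not> {{a, b}, {b, c}, {a, c}, {a', b'}, {b', c'}, {a', c'}, {a, a'}, {b, b'}, {c, c'}} \<subseteq> delete E S"
    if "distinct [a, b, c, a', b', c']" for a b c a' b' c'
    using assms that delete_subset[of E S] unfolding admissible_def by (meson subset_trans)
  ultimately show ?thesis unfolding admissible_def by blast
qed


text \<open>If \<open>v\<close> has two further neighbours, they are adjacent, because the three
  neighbours of \<open>v\<close> are no claw and \<open>u\<close> is adjacent to neither. Five edges
  are then seen from \<open>{u, v}\<close> at \<open>v\<close>: the triangle and one outer edge at
  each of its other corners. With one further neighbour there are at most three.\<close>

lemma pendant_colours:
  fixes \<phi> :: "'a set \<Rightarrow> colour"
  assumes adm: "admissible E" and uv: "{u, v} \<in> E" and no_tri: "\<And>w. {u, w} \<in> E \<Longrightarrow> {v, w} \<notin> E"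
  obtains L where "length L \<le> 5"
    "\<And>w. {v, w} \<in> E \<Longrightarrow> w \<noteq> u \<Longrightarrow> \<phi> {v, w} \<in> set L"
    "\<And>w z. {v, w} \<in> E \<Longrightarrow> w \<noteq> u \<Longrightarrow> {w, z} \<in> E \<Longrightarrow> \<phi> {w, z} \<in> set L"
proof -
  have vu: "{v, u} \<in> E" using uv by (simp add: insert_commute)
  consider (0) "nbrs E v \<subseteq> {u}" | (1) p where "nbrs E v \<subseteq> {u, p}" "{v, p} \<in> E" "p \<noteq> u"
    | (2) p q where "{v, p} \<in> E" "{v, q} \<in> E" "distinct [u, p, q]"
  proof (cases "nbrs E v \<subseteq> {u}")
    case False
    then obtain p where p: "{v, p} \<in> E" "p \<noteq> u" by (metis nbrs_iff singletonI subsetI)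
    show ?thesis
    proof (cases "nbrs E v \<subseteq> {u, p}")
      case False
      then obtain q where "{v, q} \<in> E" "q \<noteq> u" "q \<noteq> p" by (metis insertCI nbrs_iff subsetI)
      then show ?thesis using that(3)[of p q] p by auto
    qed (use that(2) p in blast)
  qed (rule that(1))
  then show ?thesis
  proof cases
    case 0
    show ?thesis by (rule that[of "[]"]) (use 0 in auto)
  next
    case 1
    obtain x y where p: "nbrs E p \<subseteq> {v, x, y}"
      using admissible_nbrs_subset1[OF adm, of p v] 1(2) by (auto simp: insert_commute)
    show ?thesis
    proof (rule that[of "[\<phi> {v, p}, \<phi> {p, x}, \<phi> {p, y}]"])
      fix w assume w: "{v, w} \<in> E" "w \<noteq> u"
      then have "w = p" using 1 by auto
      then show "\<phi> {v, w} \<in> set [\<phi> {v, p}, \<phi> {p, x}, \<phi> {p, y}]" by simp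
      fix z assume "{w, z} \<in> E"
      then have "z \<in> {v, x, y}" using p \<open>w = p\<close> by auto
      then show "\<phi> {w, z} \<in> set [\<phi> {v, p}, \<phi> {p, x}, \<phi> {p, y}]" using \<open>w = p\<close> by (auto simp: insert_commute)
    qed simp
  next
    case 2
    have N: "nbrs E v = {u, p, q}" by (rule admissible_nbrs_eq[OF adm vu 2])
    have pq: "{p, q} \<in> E" using admissible_claw[OF adm vu 2] no_tri 2 by blast
    obtain x where p: "nbrs E p \<subseteq> {v, q, x}"
      using admissible_nbrs_subset2[OF adm, of p v q] 2 pq admissible_no_loop[OF adm 2(2)] by (auto simp: insert_commute)
    obtain y where q: "nbrs E q \<subseteq> {v, p, y}"
      using admissible_nbrs_subset2[OF adm, of q v p] 2 pq admissible_no_loop[OF adm 2(1)] by (auto simp: insert_commute)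
    let ?L = "[\<phi> {v, p}, \<phi> {v, q}, \<phi> {p, q}, \<phi> {p, x}, \<phi> {q, y}]"
    show ?thesis
    proof (rule that[of ?L])
      fix w assume w: "{v, w} \<in> E" "w \<noteq> u"
      then have wpq: "w = p \<or> w = q" using nbrs_mem[of E v "{u, p, q}" w] N by auto
      then show "\<phi> {v, w} \<in> set ?L" by auto
      fix z assume "{w, z} \<in> E"
      then consider "w = p" "z \<in> {v, q, x}" | "w = q" "z \<in> {v, p, y}"
        using nbrs_mem[OF p] nbrs_mem[OF q] wpq by metis
      then show "\<phi> {w, z} \<in> set ?L"
      proof cases
        case 1
        have "{p, v} = {v, p}" by (rule insert_commute)
        then show ?thesis using 1 by auto
      next
        case 2
        have "{q, v} = {v, q}" "{q, p} = {p, q}" by (rule insert_commute)+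
        then show ?thesis using 2 by auto
      qed
    qed simp
  qed
qed

section \<open>Triangles with three outer edges\<close>

text \<open>Outer neighbours lie off the triangle but may coincide. The diamond and the complete
  graph on four vertices are handled as two such triangles with coinciding outer neighbours.\<close>

definition cubic_triangle :: "'a set set \<Rightarrow> 'a \<Rightarrow> 'a \<Rightarrow> 'a \<Rightarrow> 'a \<Rightarrow> 'a \<Rightarrow> 'a \<Rightarrow> bool" where
  "cubic_triangle E a b c a' b' c' \<longleftrightarrow> nbrs E a = {b, c, a'} \<and> nbrs E b = {a, c, b'} \<and> nbrs E c = {a, b, c'} \<and>
     distinct [a, b, c] \<and> {a', b', c'} \<inter> {a, b, c} = {}"

lemma cubic_triangle_rotate: "cubic_triangle E a b c a' b' c' \<Longrightarrow> cubic_triangle E b c a b' c' a'"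
  unfolding cubic_triangle_def by (auto simp: insert_commute)

lemma cubic_triangle_swap: "cubic_triangle E a b c a' b' c' \<Longrightarrow> cubic_triangle E a c b a' c' b'"
  unfolding cubic_triangle_def by (auto simp: insert_commute)

text \<open>The three edges of a triangle and its three outer edges are pairwise within distance 2,
  so they need distinct colours; any other conflict at \<open>a\<close> passes through
  \<open>a'\<close>. Inclusions in the hypotheses admit corners without an outer edge.\<close>

lemma proper_at_corner:
  assumes "nbrs E a \<subseteq> {b, c, a'}" "nbrs E b \<subseteq> {a, c, b'}" "nbrs E c \<subseteq> {a, b, c'}"
    and "distinct [a, b, c]" "a' \<notin> {b, c}"
    and col: "distinct [\<psi> {a, b}, \<psi> {b, c}, \<psi> {a, c}, \<psi> {a, a'}, \<psi> {b, b'}, \<psi> {c, c'}]"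
    and far: "\<And>z. {a, a'} \<in> E \<Longrightarrow> {a', z} \<in> E \<Longrightarrow> z \<noteq> a \<Longrightarrow> \<psi> {a', z} \<notin> {\<psi> {a, b}, \<psi> {a, c}}"
  shows "proper_at E \<psi> a"
  unfolding proper_at_def
proof (intro conjI allI impI)
  have comm: "\<psi> {b, a} = \<psi> {a, b}" "\<psi> {c, a} = \<psi> {a, c}" "\<psi> {c, b} = \<psi> {b, c}" by (simp_all add: insert_commute)
  fix v w assume h: "{a, v} \<in> E" "{a, w} \<in> E"
  have v: "v = b \<or> v = c \<or> v = a'" and w: "w = b \<or> w = c \<or> w = a'" using h assms(1) by auto
  show "\<psi> {a, v} \<noteq> \<psi> {a, w}" if "v \<noteq> w" using that v w col by auto
  fix z assume z: "{v, z} \<in> E" "w \<noteq> v" "z \<noteq> a"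
  consider "v = b" "z = c \<or> z = b'" | "v = c" "z = b \<or> z = c'" | "v = a'" using v z assms(2,3) by auto
  then show "\<psi> {a, w} \<noteq> \<psi> {v, z}"
  proof cases
    case 1 then show ?thesis using w z(2) col comm by auto
  next
    case 2 then show ?thesis using w z(2) col comm by auto
  next
    case 3 then show ?thesis using far[of z] h z w by auto
  qed
qed

lemma proper_at_triangle:
  assumes T: "cubic_triangle E a b c a' b' c'"
    and col: "distinct [\<psi> {a, b}, \<psi> {b, c}, \<psi> {a, c}, \<psi> {a, a'}, \<psi> {b, b'}, \<psi> {c, c'}]"
    and "\<And>z. {a', z} \<in> E \<Longrightarrow> z \<noteq> a \<Longrightarrow> \<psi> {a', z} \<notin> {\<psi> {a, b}, \<psi> {a, c}}"
    and "\<And>z. {b', z} \<in> E \<Longrightarrow> z \<noteq> b \<Longrightarrow> \<psi> {b', z} \<notin> {\<psi> {a, b}, \<psi> {b, c}}"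
    and "\<And>z. {c', z} \<in> E \<Longrightarrow> z \<noteq> c \<Longrightarrow> \<psi> {c', z} \<notin> {\<psi> {a, c}, \<psi> {b, c}}"
  shows "u \<in> {a, b, c} \<Longrightarrow> proper_at E \<psi> u"
proof -
  have comm: "\<psi> {b, a} = \<psi> {a, b}" "\<psi> {c, a} = \<psi> {a, c}" "\<psi> {c, b} = \<psi> {b, c}" by (simp_all add: insert_commute)
  have "proper_at E \<psi> a"
    using T col assms(3) unfolding cubic_triangle_def by (intro proper_at_corner[of E a b c a' b' c']) auto
  moreover have "proper_at E \<psi> b"
    using T col assms(4) unfolding cubic_triangle_def by (intro proper_at_corner[of E b a c b' a' c']) (auto simp: comm)
  moreover have "proper_at E \<psi> c"
    using T col assms(5) unfolding cubic_triangle_def by (intro proper_at_corner[of E c a b c' a' b']) (auto simp: comm)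
  ultimately show "u \<in> {a, b, c} \<Longrightarrow> proper_at E \<psi> u" by auto
qed

section \<open>Minimal counterexamples\<close>

text \<open>Minimality concerns all admissible edge sets with fewer edges, not just subsets of
  \<open>E\<close>, because the last reduction also adds edges.\<close>

locale critical =
  fixes E :: "'a set set"
  assumes adm: "admissible E"
    and smaller: "\<And>F. admissible F \<Longrightarrow> card F < card E \<Longrightarrow> \<exists>\<phi> :: 'a set \<Rightarrow> colour. strong F \<phi>"
    and uncolourable: "\<not> strong E (\<phi> :: 'a set \<Rightarrow> colour)"
begin

lemmas no_loop = admissible_no_loop[OF adm]
lemmas nbrs_eq = admissible_nbrs_eq[OF adm]
lemmas claw = admissible_claw[OF adm]

lemma adj_sym: "{u, v} \<in> E \<Longrightarrow> {v, u} \<in> E"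
  by (simp add: insert_commute)

lemma smaller_delete:
  assumes "{u, w} \<in> E" "u \<in> S"
  obtains \<phi> :: "'a set \<Rightarrow> colour" where "strong (delete E S) \<phi>"
proof -
  have "finite E" using adm by (simp add: admissible_def)
  moreover have "{u, w} \<notin> delete E S" using assms(2) by (simp add: delete_iff)
  then have "delete E S \<subset> E" using assms(1) delete_subset[of E S] by blast
  ultimately have "card (delete E S) < card E" by (rule psubset_card_mono)
  then show ?thesis using smaller[OF admissible_delete[OF adm]] that by blast
qed

text \<open>\<open>V\<close> contains the deleted set and its neighbours, so every edge that leaves
  \<open>V\<close> survives the deletion and keeps its colour. The colours inside \<open>V\<close>
  are free, and only properness at \<open>V\<close> remains to be shown.\<close>

lemma reducible:
  assumes s: "{s, t} \<in> E" "s \<in> S" and SV: "S \<subseteq> V" "\<And>u w. u \<in> S \<Longrightarrow> {u, w} \<in> E \<Longrightarrow> w \<in> V"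
    and ext: "\<And>\<phi> :: 'a set \<Rightarrow> colour. strong (delete E S) \<phi> \<Longrightarrow>
      \<exists>\<psi>. (\<forall>e\<in>E. \<not> e \<subseteq> V \<longrightarrow> \<psi> e = \<phi> e) \<and> (\<forall>u\<in>V. proper_at E \<psi> u)"
  shows False
proof -
  obtain \<phi> :: "'a set \<Rightarrow> colour" where \<phi>: "strong (delete E S) \<phi>" using smaller_delete[OF s] .
  then obtain \<psi> where \<psi>: "\<forall>e\<in>E. \<not> e \<subseteq> V \<longrightarrow> \<psi> e = \<phi> e" "\<forall>u\<in>V. proper_at E \<psi> u" using ext by blast
  let ?F = "{e \<in> E. \<not> e \<subseteq> V}"
  have "?F \<subseteq> delete E S"
  proof
    fix e assume e: "e \<in> ?F"
    then obtain v w where vw: "e = {v, w}" using admissible_edgeE[OF adm] by blast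
    have "v \<notin> S" "w \<notin> S" using e SV(1) SV(2)[of v w] SV(2)[of w v] adj_sym unfolding vw by auto
    then show "e \<in> delete E S" using e vw by (auto simp: delete_def)
  qed
  then have "strong ?F \<psi>" using strong_cong[OF strong_mono[OF \<phi>]] \<psi>(1) by (metis (no_types, lifting) mem_Collect_eq)
  then have "strong E \<psi>" by (rule strong_extend[of _ _ _ V]) (use \<psi>(2) in auto)
  then show False using uncolourable by blast
qed

section \<open>Pendant edges and adjacent vertices of degree 2\<close>

lemma no_pendant:
  assumes "{u, v} \<in> E"
  shows "\<exists>w. w \<noteq> v \<and> {u, w} \<in> E"
proof (rule ccontr)
  assume "\<nexists>w. w \<noteq> v \<and> {u, w} \<in> E"
  then have u: "w = v" if "{u, w} \<in> E" for w using that by blast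
  obtain \<phi> :: "'a set \<Rightarrow> colour" where \<phi>: "strong (delete E {u}) \<phi>" using smaller_delete[OF assms, of "{u}"] by auto
  have "{v, w} \<notin> E" if "{u, w} \<in> E" for w using u[OF that] no_loop[of v w] by auto
  then obtain L where L: "length L \<le> 5" "\<And>w. {v, w} \<in> E \<Longrightarrow> w \<noteq> u \<Longrightarrow> \<phi> {v, w} \<in> set L"
    "\<And>w z. {v, w} \<in> E \<Longrightarrow> w \<noteq> u \<Longrightarrow> {w, z} \<in> E \<Longrightarrow> \<phi> {w, z} \<in> set L"
    using pendant_colours[OF adm assms, of \<phi>] by blast
  obtain k where k: "avoids k L" by (erule fresh_colour[rotated]) (use L(1) in simp)
  have "strong (insert {u, v} (delete E {u})) (\<phi>({u, v} := k))"
    using L(2,3) k no_loop[OF assms] no_loop[of v v]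
    by (intro strong_pendant[OF \<phi>]) (auto simp: delete_iff avoids_iff dest: delete_subset[THEN subsetD])
  moreover have "insert {u, v} (delete E {u}) = E"
  proof -
    have "e \<in> insert {u, v} (delete E {u})" if e: "e \<in> E" for e
    proof -
      obtain x y where "e = {x, y}" using admissible_edgeE[OF adm e] by blast
      then show ?thesis using e u[of x] u[of y] adj_sym by (auto simp: delete_def insert_commute)
    qed
    then show ?thesis using assms delete_subset[of E "{u}"] by blast
  qed
  ultimately show False using uncolourable by auto
qed

text \<open>After deleting \<open>v\<close>, the edge \<open>{v, v'}\<close> is coloured as a
  pendant edge that also avoids the colour of \<open>{u, u'}\<close>: five plus one forbidden
  colours. The edge \<open>{u, v}\<close> then sees these two edges and two more at each of
  \<open>u'\<close> and \<open>v'\<close>, again six.\<close>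

lemma no_adjacent_degree_2:
  assumes u: "nbrs E u = {v, u'}" and v: "nbrs E v = {u, v'}" and "u' \<noteq> v'" "u' \<noteq> v" "v' \<noteq> u"
  shows False
proof -
  have e: "{u, v} \<in> E" "{u, u'} \<in> E" "{v, v'} \<in> E" using u v by (auto simp flip: nbrs_iff)
  have ne: "u \<noteq> v" "u \<noteq> u'" "v \<noteq> v'" using e no_loop by blast+
  obtain \<phi> :: "'a set \<Rightarrow> colour" where \<phi>: "strong (delete E {v}) \<phi>"
    using smaller_delete[OF adj_sym[OF e(1)], of "{v}"] by auto
  have nt: "{v', w} \<notin> E" if "{v, w} \<in> E" for w
  proof -
    have "w = u \<or> w = v'" using that v by (auto simp flip: nbrs_iff)
    moreover have "{v', u} \<notin> E"
    proof
      assume "{v', u} \<in> E"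
      then have "v' \<in> nbrs E u" by (simp add: insert_commute)
      then show False using u assms(3) ne(3) by auto
    qed
    ultimately show ?thesis using no_loop[of v' v'] by auto
  qed
  obtain L where L: "length L \<le> 5" "\<And>w. {v', w} \<in> E \<Longrightarrow> w \<noteq> v \<Longrightarrow> \<phi> {v', w} \<in> set L"
    "\<And>w z. {v', w} \<in> E \<Longrightarrow> w \<noteq> v \<Longrightarrow> {w, z} \<in> E \<Longrightarrow> \<phi> {w, z} \<in> set L"
    using pendant_colours[OF adm e(3) nt, of \<phi>] by blast
  obtain k where k: "avoids k (\<phi> {u, u'} # L)" by (erule fresh_colour[rotated]) (use L(1) in simp)
  define \<chi> where "\<chi> = \<phi>({v, v'} := k)"
  have \<chi>: "strong (insert {v, v'} (delete E {v})) \<chi>"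
    unfolding \<chi>_def using L(2,3) k ne(3) no_loop[of v' v']
    by (intro strong_pendant[OF \<phi>]) (auto simp: delete_iff avoids_iff dest: delete_subset[THEN subsetD])
  have k': "\<chi> {v, v'} = k" "\<chi> {u, u'} = \<phi> {u, u'}" using ne assms(3-5) by (auto simp: \<chi>_def doubleton_eq_iff)
  obtain p q where p: "nbrs E u' \<subseteq> {u, p, q}" using admissible_nbrs_subset1[OF adm adj_sym[OF e(2)]] .
  obtain r s where r: "nbrs E v' \<subseteq> {v, r, s}" using admissible_nbrs_subset1[OF adm adj_sym[OF e(3)]] .
  obtain l where l: "avoids l [\<chi> {u, u'}, \<chi> {v, v'}, \<chi> {u', p}, \<chi> {u', q}, \<chi> {v', r}, \<chi> {v', s}]"
    by (erule fresh_colour[rotated]) simp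
  define \<psi> where "\<psi> = \<chi>({u, v} := l)"
  have \<psi>: "\<psi> {u, v} = l" "\<psi> {v, u} = l" "\<And>e. e \<noteq> {u, v} \<Longrightarrow> \<psi> e = \<chi> e" by (auto simp: \<psi>_def insert_commute)
  have \<psi>': "\<psi> {u, u'} = \<chi> {u, u'}" "\<psi> {v, v'} = \<chi> {v, v'}"
    using \<psi>(3)[of "{u, u'}"] \<psi>(3)[of "{v, v'}"] ne assms(3-5) by (simp_all add: doubleton_eq_iff)
  have far: "l \<noteq> \<psi> {u', z}" if "{u', z} \<in> E" "z \<noteq> u" for z
  proof -
    have "{u', z} \<noteq> {u, v}" using that ne assms(3-5) by (auto simp: doubleton_eq_iff)
    moreover have "z \<in> {p, q}" using that p by (auto simp flip: nbrs_iff)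
    ultimately show ?thesis using l \<psi>(3) by auto
  qed
  have far': "l \<noteq> \<psi> {v', z}" if "{v', z} \<in> E" "z \<noteq> v" for z
  proof -
    have "{v', z} \<noteq> {u, v}" using that ne assms(3-5) by (auto simp: doubleton_eq_iff)
    moreover have "z \<in> {r, s}" using that r by (auto simp flip: nbrs_iff)
    ultimately show ?thesis using l \<psi>(3) by auto
  qed
  have nu: "w = v \<or> w = u'" if "{u, w} \<in> E" for w using that u by (auto simp flip: nbrs_iff)
  have nv: "w = u \<or> w = v'" if "{v, w} \<in> E" for w using that v by (auto simp flip: nbrs_iff)
  have lk: "l \<noteq> \<chi> {u, u'}" "l \<noteq> \<chi> {v, v'}" "\<chi> {u, u'} \<noteq> \<chi> {v, v'}" using l k k' by auto
  have "proper_at E \<psi> u"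
    unfolding proper_at_def
  proof (intro conjI allI impI)
    fix x y assume h: "{u, x} \<in> E" "{u, y} \<in> E" "x \<noteq> y"
    then show "\<psi> {u, x} \<noteq> \<psi> {u, y}" using nu[OF h(1)] nu[OF h(2)] \<psi> \<psi>' lk by auto
  next
    fix x y z assume h: "{u, x} \<in> E" "{u, y} \<in> E" "{x, z} \<in> E" "y \<noteq> x" "z \<noteq> u"
    consider "x = v" "y = u'" "z = v'" | "x = u'" "y = v" using h nu nv by blast
    then show "\<psi> {u, y} \<noteq> \<psi> {x, z}"
      by cases (use \<psi> \<psi>' lk far h in auto)
  qed
  moreover have "proper_at E \<psi> v"
    unfolding proper_at_def
  proof (intro conjI allI impI)
    fix x y assume h: "{v, x} \<in> E" "{v, y} \<in> E" "x \<noteq> y"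
    then show "\<psi> {v, x} \<noteq> \<psi> {v, y}" using nv[OF h(1)] nv[OF h(2)] \<psi> \<psi>' lk by auto
  next
    fix x y z assume h: "{v, x} \<in> E" "{v, y} \<in> E" "{x, z} \<in> E" "y \<noteq> x" "z \<noteq> v"
    consider "x = u" "y = v'" "z = u'" | "x = v'" "y = u" using h nu nv by blast
    then show "\<psi> {v, y} \<noteq> \<psi> {x, z}"
      by cases (use \<psi> \<psi>' lk far' h in auto)
  qed
  moreover have "strong (insert {v, v'} (delete E {v}) - {{u, v}}) \<psi>"
    by (rule strong_cong[OF strong_mono[OF \<chi>]]) (auto intro!: \<psi>(3))
  moreover have "e \<in> insert {v, v'} (delete E {v}) - {{u, v}} \<or> e \<subseteq> {u, v}" if e: "e \<in> E" for e
  proof -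
    obtain x y where xy: "e = {x, y}" using admissible_edgeE[OF adm e] by blast
    show ?thesis
    proof (cases "v \<in> e")
      case True
      then have "\<exists>w. e = {v, w}" using xy by auto
      then obtain w where w: "e = {v, w}" by blast
      then show ?thesis using nv[of w] e ne assms(3-5) by (auto simp: doubleton_eq_iff)
    next
      case False
      then show ?thesis using e by (auto simp: delete_def)
    qed
  qed
  ultimately have "strong E \<psi>" by (intro strong_extend[of _ \<psi> E "{u, v}"]) auto
  then show False using uncolourable by blast
qed


section \<open>Corners of degree 2 and double links\<close>

lemma far_colours:
  fixes \<phi> :: "'a set \<Rightarrow> colour"
  obtains A A' where "\<And>z. {a, a'} \<in> E \<Longrightarrow> {a', z} \<in> E \<Longrightarrow> z \<noteq> a \<Longrightarrow> \<phi> {a', z} \<in> {A, A'}"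
proof (cases "{a, a'} \<in> E")
  case True
  obtain p q where pq: "nbrs E a' \<subseteq> {a, p, q}" using admissible_nbrs_subset1[OF adm adj_sym[OF True]] .
  show ?thesis
  proof (rule that[of "\<phi> {a', p}" "\<phi> {a', q}"])
    fix z assume "{a', z} \<in> E" "z \<noteq> a"
    then have "z \<in> {p, q}" using nbrs_mem[OF pq] by blast
    then show "\<phi> {a', z} \<in> {\<phi> {a', p}, \<phi> {a', q}}" by auto
  qed
qed (rule that, blast)

lemma triangle_corner:
  assumes ab: "{a, b} \<in> E" and bc: "{b, c} \<in> E" and ac: "{a, c} \<in> E"
  obtains c' where "nbrs E c = {a, b, c'}" "c' \<notin> {a, b, c}"
proof -
  note e = ab bc ac adj_sym[OF ab] adj_sym[OF bc] adj_sym[OF ac]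
  have d: "a \<noteq> b" "b \<noteq> c" "a \<noteq> c" "b \<noteq> a" "c \<noteq> b" "c \<noteq> a" using e no_loop by blast+
  have "\<exists>c'. {c, c'} \<in> E \<and> c' \<notin> {a, b}"
  proof (rule ccontr)
    assume "\<nexists>c'. {c, c'} \<in> E \<and> c' \<notin> {a, b}"
    \<comment> \<open>A corner without outer neighbour is used as its own outer neighbour, here and
      in \<open>port\<close>. The resulting singleton is not an edge, so its colour is free.\<close>
    then have c: "nbrs E c \<subseteq> {a, b, c}" by auto
    have port: "\<exists>v'. nbrs E v \<subseteq> {w, c, v'} \<and> v' \<notin> {w, c}" if vw: "{v, w} \<in> E" "{v, c} \<in> E" "w \<noteq> c" for v w
    proof -
      obtain r where r: "nbrs E v \<subseteq> {w, c, r}" using admissible_nbrs_subset2[OF adm vw] .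
      show ?thesis
      proof (cases "r \<in> {w, c}")
        case True
        then have "nbrs E v \<subseteq> {w, c, v}" using r by auto
        then show ?thesis using no_loop[OF vw(1)] no_loop[OF vw(2)] by (intro exI[of _ v]) auto
      qed (use r in blast)
    qed
    obtain a' where a': "nbrs E a \<subseteq> {b, c, a'}" "a' \<notin> {b, c}" using port[of a b] e d by blast
    obtain b' where b': "nbrs E b \<subseteq> {a, c, b'}" "b' \<notin> {a, c}" using port[of b a] e d by blast
    show False
    proof (rule reducible[of c a "{c}" "{a, b, c}"])
      show "w \<in> {a, b, c}" if "u \<in> {c}" "{u, w} \<in> E" for u w using that nbrs_mem[OF c] by blast
    next
      fix \<phi> :: "'a set \<Rightarrow> colour" assume \<phi>: "strong (delete E {c}) \<phi>"
      have ne: "{a, a'} \<noteq> {b, b'}" using a'(2) b'(2) d by (auto simp: doubleton_eq_iff)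
      \<comment> \<open>The colours on the outer slots must differ. If both are edges, they are
        joined by \<open>{a, b}\<close>, which survives the deletion of \<open>c\<close>; otherwise
        the value on the missing one can be changed at will.\<close>
      have "\<exists>\<chi>. (\<forall>e\<in>E. \<chi> e = \<phi> e) \<and> \<chi> {a, a'} \<noteq> \<chi> {b, b'}"
      proof -
        consider "{a, a'} \<notin> E" | "{b, b'} \<notin> E" | "{a, a'} \<in> E" "{b, b'} \<in> E" by blast
        then show ?thesis
        proof cases
          case 1
          obtain k where "avoids k [\<phi> {b, b'}]" by (erule fresh_colour[rotated]) simp
          then show ?thesis using 1 ne by (intro exI[of _ "\<phi>({a, a'} := k)"]) auto
        next
          case 2
          obtain k where "avoids k [\<phi> {a, a'}]" by (erule fresh_colour[rotated]) simp
          then show ?thesis using 2 ne by (intro exI[of _ "\<phi>({b, b'} := k)"]) auto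
        next
          case 3
          have "\<phi> {a, a'} \<noteq> \<phi> {b, b'}"
            using strong_distance2[OF \<phi>, of a b a' b'] 3 e d a'(2) b'(2) by (simp add: delete_iff)
          then show ?thesis by blast
        qed
      qed
      then obtain \<chi> where \<chi>: "\<And>e. e \<in> E \<Longrightarrow> \<chi> e = \<phi> e" "\<chi> {a, a'} \<noteq> \<chi> {b, b'}" by blast
      obtain A1 A2 where A: "\<And>z. {a, a'} \<in> E \<Longrightarrow> {a', z} \<in> E \<Longrightarrow> z \<noteq> a \<Longrightarrow> \<chi> {a', z} \<in> {A1, A2}"
        using far_colours[of a a' \<chi>] by blast
      obtain B1 B2 where B: "\<And>z. {b, b'} \<in> E \<Longrightarrow> {b', z} \<in> E \<Longrightarrow> z \<noteq> b \<Longrightarrow> \<chi> {b', z} \<in> {B1, B2}"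
        using far_colours[of b b' \<chi>] by blast
      obtain ta tb tc where t: "distinct [\<chi> {a, a'}, \<chi> {b, b'}, ta, tb, tc]" "tb \<notin> {A1, A2}" "ta \<notin> {B1, B2}"
        "tc \<notin> {A1, A2, B1, B2}"
        using two_port_triangle_colours[OF \<chi>(2)] by blast
      obtain k where k: "avoids k [\<chi> {a, a'}, \<chi> {b, b'}, ta, tb, tc]" by (erule fresh_colour[rotated]) simp
      \<comment> \<open>The value on \<open>{c, c}\<close> only serves to make the six values of
        \<open>proper_at_corner\<close> distinct.\<close>
      define \<psi> where "\<psi> = \<chi>({a, b} := tc, {b, c} := ta, {a, c} := tb, {c, c} := k)"
      have v: "\<psi> {a, b} = tc" "\<psi> {b, c} = ta" "\<psi> {a, c} = tb" "\<psi> {c, c} = k"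
        "\<psi> {b, a} = tc" "\<psi> {c, b} = ta" "\<psi> {c, a} = tb"
        using d by (auto simp: \<psi>_def doubleton_eq_iff)
      have v': "\<psi> {a, a'} = \<chi> {a, a'}" "\<psi> {b, b'} = \<chi> {b, b'}"
        using d a'(2) b'(2) by (auto simp: \<psi>_def doubleton_eq_iff)
      have old: "\<psi> e = \<chi> e" if "\<not> e \<subseteq> {a, b, c}" for e using that by (auto simp: \<psi>_def)
      have fa: "\<psi> {a', z} \<in> {A1, A2}" if "{a, a'} \<in> E" "{a', z} \<in> E" "z \<noteq> a" for z
      proof -
        have "\<not> {a', z} \<subseteq> {a, b, c}" using that a'(2) no_loop by auto
        then show ?thesis using old A[OF that] by simp
      qed
      have fb: "\<psi> {b', z} \<in> {B1, B2}" if "{b, b'} \<in> E" "{b', z} \<in> E" "z \<noteq> b" for z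
      proof -
        have "\<not> {b', z} \<subseteq> {a, b, c}" using that b'(2) no_loop by auto
        then show ?thesis using old B[OF that] by simp
      qed
      have "proper_at E \<psi> a"
      proof (rule proper_at_corner[OF a'(1) b'(1) c])
        show "distinct [\<psi> {a, b}, \<psi> {b, c}, \<psi> {a, c}, \<psi> {a, a'}, \<psi> {b, b'}, \<psi> {c, c}]"
          using t(1) k unfolding v v' by auto
        show "\<psi> {a', z} \<notin> {\<psi> {a, b}, \<psi> {a, c}}" if "{a, a'} \<in> E" "{a', z} \<in> E" "z \<noteq> a" for z
          using fa[OF that] t unfolding v by auto
      qed (use d a' in auto)
      moreover have "proper_at E \<psi> b"
      proof (rule proper_at_corner[OF b'(1) a'(1)])
        show "nbrs E c \<subseteq> {b, a, c}" using c by auto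
        show "distinct [\<psi> {b, a}, \<psi> {a, c}, \<psi> {b, c}, \<psi> {b, b'}, \<psi> {a, a'}, \<psi> {c, c}]"
          using t(1) k unfolding v v' by auto
        show "\<psi> {b', z} \<notin> {\<psi> {b, a}, \<psi> {b, c}}" if "{b, b'} \<in> E" "{b', z} \<in> E" "z \<noteq> b" for z
          using fb[OF that] t unfolding v by auto
      qed (use d b' in auto)
      moreover have "proper_at E \<psi> c"
      proof (rule proper_at_corner[OF c])
        show "nbrs E a \<subseteq> {c, b, a'}" "nbrs E b \<subseteq> {c, a, b'}" using a' b' by auto
        show "distinct [\<psi> {c, a}, \<psi> {a, b}, \<psi> {c, b}, \<psi> {c, c}, \<psi> {a, a'}, \<psi> {b, b'}]"
          using t(1) k unfolding v v' by auto
        show "\<psi> {c, z} \<notin> {\<psi> {c, a}, \<psi> {c, b}}" if "{c, c} \<in> E" "{c, z} \<in> E" "z \<noteq> c" for z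
          using no_loop[OF that(1)] by simp
      qed (use d in auto)
      ultimately show "\<exists>\<psi>. (\<forall>e\<in>E. \<not> e \<subseteq> {a, b, c} \<longrightarrow> \<psi> e = \<phi> e) \<and> (\<forall>u\<in>{a, b, c}. proper_at E \<psi> u)"
        using old \<chi>(1) by (intro exI[of _ \<psi>]) auto
    qed (use e in auto)
  qed
  then obtain c' where c': "{c, c'} \<in> E" "c' \<notin> {a, b}" by blast
  then have "c' \<noteq> c" using no_loop by blast
  moreover have "nbrs E c = {a, b, c'}" using e c' d by (intro nbrs_eq) auto
  ultimately show ?thesis using that c' by blast
qed

lemma cubic_triangleI:
  assumes "nbrs E a = {b, c, a'}" "nbrs E b = {a, c, b'}" "nbrs E c = {a, b, c'}" "distinct [a, b, c]"
    "a' \<notin> {b, c}" "b' \<notin> {a, c}" "c' \<notin> {a, b}"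
  shows "cubic_triangle E a b c a' b' c'"
proof -
  have "{a, a'} \<in> E" "{b, b'} \<in> E" "{c, c'} \<in> E" using assms(1-3) by (auto simp flip: nbrs_iff)
  then show ?thesis using assms no_loop unfolding cubic_triangle_def by auto
qed

lemma obtain_cubic_triangle:
  assumes "{a, b} \<in> E" "{b, c} \<in> E" "{a, c} \<in> E"
  obtains a' b' c' where "cubic_triangle E a b c a' b' c'"
proof -
  note e = assms adj_sym[OF assms(1)] adj_sym[OF assms(2)] adj_sym[OF assms(3)]
  obtain a' where "nbrs E a = {b, c, a'}" "a' \<notin> {b, c, a}" by (rule triangle_corner[of b c a]) (use e in auto)
  moreover obtain b' where "nbrs E b = {a, c, b'}" "b' \<notin> {a, c, b}" by (rule triangle_corner[of a c b]) (use e in auto)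
  moreover obtain c' where "nbrs E c = {a, b, c'}" "c' \<notin> {a, b, c}" by (rule triangle_corner[of a b c]) (use e in auto)
  moreover have "distinct [a, b, c]" using e no_loop by auto
  ultimately show ?thesis using that cubic_triangleI by (metis insert_iff)
qed

lemma cubic_triangle_edges:
  assumes "cubic_triangle E a b c a' b' c'"
  shows "{a, b} \<in> E" "{b, c} \<in> E" "{a, c} \<in> E" "{a, a'} \<in> E" "{b, b'} \<in> E" "{c, c'} \<in> E"
  using assms unfolding cubic_triangle_def by (auto simp flip: nbrs_iff)

lemma cubic_triangle_unique:
  assumes "cubic_triangle E a b c a' b' c'"
  shows "{a, w} \<in> E \<Longrightarrow> w \<notin> {b, c} \<Longrightarrow> w = a'" "{b, w} \<in> E \<Longrightarrow> w \<notin> {a, c} \<Longrightarrow> w = b'"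
    "{c, w} \<in> E \<Longrightarrow> w \<notin> {a, b} \<Longrightarrow> w = c'"
  using assms unfolding cubic_triangle_def by (auto simp flip: nbrs_iff)

text \<open>An edge between \<open>a1\<close> and \<open>a2\<close> would complete a prism, so the
  outer edges at \<open>a1\<close> and \<open>a2\<close> leave the six vertices. Those edges and
  everything beyond keep their colours, and \<open>double_link_colours\<close> colours the
  rest.\<close>

lemma no_double_link:
  assumes d: "distinct [a1, b1, c1, a2, b2, c2]"
    and e: "{a1, b1} \<in> E" "{b1, c1} \<in> E" "{a1, c1} \<in> E" "{a2, b2} \<in> E" "{b2, c2} \<in> E" "{a2, c2} \<in> E"
      "{b1, b2} \<in> E" "{c1, c2} \<in> E"
  shows False
proof -
  have d': "distinct [c2, b2, a2, c1, b1, a1]" using d by auto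
  obtain x1 x2 x3 where T: "cubic_triangle E a1 b1 c1 x1 x2 x3" using obtain_cubic_triangle[OF e(1-3)] .
  have "b2 = x2" by (rule cubic_triangle_unique(2)[OF T e(7)]) (use d d' in simp)
  moreover have "c2 = x3" by (rule cubic_triangle_unique(3)[OF T e(8)]) (use d d' in simp)
  ultimately have T1: "cubic_triangle E a1 b1 c1 x1 b2 c2" using T by simp
  obtain z1 z2 z3 where T: "cubic_triangle E a2 b2 c2 z1 z2 z3" using obtain_cubic_triangle[OF e(4-6)] .
  have "b1 = z2" by (rule cubic_triangle_unique(2)[OF T adj_sym[OF e(7)]]) (use d d' in simp)
  moreover have "c1 = z3" by (rule cubic_triangle_unique(3)[OF T adj_sym[OF e(8)]]) (use d d' in simp)
  ultimately have T2: "cubic_triangle E a2 b2 c2 z1 b1 c1" using T by simp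
  have "\<not> {{a1, b1}, {b1, c1}, {a1, c1}, {a2, b2}, {b2, c2}, {a2, c2}, {a1, a2}, {b1, b2}, {c1, c2}} \<subseteq> E"
    using adm d unfolding admissible_def by blast
  then have "{a1, a2} \<notin> E" using e by simp
  then have a: "x1 \<noteq> a2" "z1 \<noteq> a1" using cubic_triangle_edges(4)[OF T1] adj_sym[OF cubic_triangle_edges(4)[OF T2]] by auto
  let ?V = "{a1, b1, c1, a2, b2, c2}"
  have N: "nbrs E a1 = {b1, c1, x1}" "nbrs E b1 = {a1, c1, b2}" "nbrs E c1 = {a1, b1, c2}"
    "nbrs E a2 = {b2, c2, z1}" "nbrs E b2 = {a2, c2, b1}" "nbrs E c2 = {a2, b2, c1}"
    using T1 T2 unfolding cubic_triangle_def by auto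
  have x1: "x1 \<notin> ?V"
  proof -
    have "a1 \<in> nbrs E x1" using cubic_triangle_edges(4)[OF T1] by (simp add: insert_commute)
    moreover have "a1 \<notin> nbrs E b2" "a1 \<notin> nbrs E c2" unfolding N using d by simp_all
    ultimately have "x1 \<noteq> b2" "x1 \<noteq> c2" by metis+
    then show ?thesis using T1 a unfolding cubic_triangle_def by auto
  qed
  have z1: "z1 \<notin> ?V"
  proof -
    have "a2 \<in> nbrs E z1" using cubic_triangle_edges(4)[OF T2] by (simp add: insert_commute)
    moreover have "a2 \<notin> nbrs E b1" "a2 \<notin> nbrs E c1" unfolding N using d d' by simp_all
    ultimately have "z1 \<noteq> b1" "z1 \<noteq> c1" by metis+
    then show ?thesis using T2 a unfolding cubic_triangle_def by auto
  qed
  show False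
  proof (rule reducible[of b1 b2 "{b1, c1, b2, c2}" ?V])
    show "w \<in> ?V" if "u \<in> {b1, c1, b2, c2}" "{u, w} \<in> E" for u w
    proof -
      have "w \<in> nbrs E u" using that(2) by simp
      moreover from that(1) have "nbrs E u \<subseteq> ?V" by (elim insertE emptyE) (simp_all add: N)
      ultimately show ?thesis by blast
    qed
  next
    fix \<phi> :: "'a set \<Rightarrow> colour" assume "strong (delete E {b1, c1, b2, c2}) \<phi>"
    obtain A1 A1' where A1: "\<And>z. {a1, x1} \<in> E \<Longrightarrow> {x1, z} \<in> E \<Longrightarrow> z \<noteq> a1 \<Longrightarrow> \<phi> {x1, z} \<in> {A1, A1'}"
      using far_colours[of a1 x1 \<phi>] by blast
    obtain A2 A2' where A2: "\<And>z. {a2, z1} \<in> E \<Longrightarrow> {z1, z} \<in> E \<Longrightarrow> z \<noteq> a2 \<Longrightarrow> \<phi> {z1, z} \<in> {A2, A2'}"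
      using far_colours[of a2 z1 \<phi>] by blast
    obtain y1 y2 m1 m2 s1 r1 s2 r2 where
      t: "distinct [\<phi> {a1, x1}, y1, y2, m1, s1, r1]" "distinct [\<phi> {a2, z1}, y1, y2, m2, s2, r2]"
        "m1 \<notin> {m2, s2, r2}" "m2 \<notin> {s1, r1}" "s1 \<noteq> s2" "r1 \<noteq> r2"
        "s1 \<notin> {A1, A1'}" "r1 \<notin> {A1, A1'}" "s2 \<notin> {A2, A2'}" "r2 \<notin> {A2, A2'}"
      using double_link_colours[of "\<phi> {a1, x1}" "\<phi> {a2, z1}" A1 A1' A2 A2'] by blast
    define \<psi> where "\<psi> = \<phi>({a1, b1} := s1, {a1, c1} := r1, {b1, c1} := m1, {a2, b2} := s2, {a2, c2} := r2,
      {b2, c2} := m2, {b1, b2} := y1, {c1, c2} := y2)"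
    have v: "\<psi> {a1, b1} = s1" "\<psi> {a1, c1} = r1" "\<psi> {b1, c1} = m1" "\<psi> {a2, b2} = s2" "\<psi> {a2, c2} = r2"
      "\<psi> {b2, c2} = m2" "\<psi> {b1, b2} = y1" "\<psi> {c1, c2} = y2"
      using d d' by (simp_all add: \<psi>_def doubleton_eq_iff)
    have old: "\<psi> e = \<phi> e" if "\<not> e \<subseteq> ?V" for e using that by (auto simp: \<psi>_def)
    have x: "\<psi> {a1, x1} = \<phi> {a1, x1}" "\<psi> {a2, z1} = \<phi> {a2, z1}" "\<psi> {x1, z} = \<phi> {x1, z}" "\<psi> {z1, z} = \<phi> {z1, z}" for z
      using x1 z1 by (auto intro!: old)
    have c: "{b2, b1} = {b1, b2}" "{c2, c1} = {c1, c2}" "{b2, a2} = {a2, b2}" "{c2, a2} = {a2, c2}" "{c2, b2} = {b2, c2}"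
      "{b1, a1} = {a1, b1}" "{c1, a1} = {a1, c1}" "{c1, b1} = {b1, c1}"
      by (rule insert_commute)+
    have "proper_at E \<psi> u" if "u \<in> {a1, b1, c1}" for u
    proof (rule proper_at_triangle[OF T1 _ _ _ _ that])
      show "distinct [\<psi> {a1, b1}, \<psi> {b1, c1}, \<psi> {a1, c1}, \<psi> {a1, x1}, \<psi> {b1, b2}, \<psi> {c1, c2}]"
        using t(1) unfolding v x by auto
      show "\<psi> {x1, z} \<notin> {\<psi> {a1, b1}, \<psi> {a1, c1}}" if "{x1, z} \<in> E" "z \<noteq> a1" for z
        using A1[OF cubic_triangle_edges(4)[OF T1] that] t(7,8) unfolding v x by auto
      show "\<psi> {b2, z} \<notin> {\<psi> {a1, b1}, \<psi> {b1, c1}}" if "{b2, z} \<in> E" "z \<noteq> b1" for z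
      proof -
        have "z = a2 \<or> z = c2" using that N(5) by (auto simp flip: nbrs_iff)
        then show ?thesis using t(3-6) v c by auto
      qed
      show "\<psi> {c2, z} \<notin> {\<psi> {a1, c1}, \<psi> {b1, c1}}" if "{c2, z} \<in> E" "z \<noteq> c1" for z
      proof -
        have "z = a2 \<or> z = b2" using that N(6) by (auto simp flip: nbrs_iff)
        then show ?thesis using t(3-6) v c by auto
      qed
    qed
    moreover have "proper_at E \<psi> u" if "u \<in> {a2, b2, c2}" for u
    proof (rule proper_at_triangle[OF T2 _ _ _ _ that])
      show "distinct [\<psi> {a2, b2}, \<psi> {b2, c2}, \<psi> {a2, c2}, \<psi> {a2, z1}, \<psi> {b2, b1}, \<psi> {c2, c1}]"
        using t(2) unfolding c v x by auto
      show "\<psi> {z1, z} \<notin> {\<psi> {a2, b2}, \<psi> {a2, c2}}" if "{z1, z} \<in> E" "z \<noteq> a2" for z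
        using A2[OF cubic_triangle_edges(4)[OF T2] that] t(9,10) unfolding v x by auto
      show "\<psi> {b1, z} \<notin> {\<psi> {a2, b2}, \<psi> {b2, c2}}" if "{b1, z} \<in> E" "z \<noteq> b2" for z
      proof -
        have "z = a1 \<or> z = c1" using that N(2) by (auto simp flip: nbrs_iff)
        then show ?thesis using t(3-6) v c by auto
      qed
      show "\<psi> {c1, z} \<notin> {\<psi> {a2, c2}, \<psi> {b2, c2}}" if "{c1, z} \<in> E" "z \<noteq> c2" for z
      proof -
        have "z = a1 \<or> z = b1" using that N(3) by (auto simp flip: nbrs_iff)
        then show ?thesis using t(3-6) v c by auto
      qed
    qed
    ultimately show "\<exists>\<psi>. (\<forall>e\<in>E. \<not> e \<subseteq> ?V \<longrightarrow> \<psi> e = \<phi> e) \<and> (\<forall>u\<in>?V. proper_at E \<psi> u)"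
      using old by (intro exI[of _ \<psi>]) blast
  qed (use e in auto)
qed


section \<open>Diamonds\<close>

lemma far_colours_edge:
  fixes \<phi> :: "'a set \<Rightarrow> colour"
  assumes "{a, a'} \<in> E"
  obtains A A' where "\<And>z. {a', z} \<in> E \<Longrightarrow> z \<noteq> a \<Longrightarrow> \<phi> {a', z} \<in> {A, A'}"
proof -
  obtain A A' where "\<And>z. {a, a'} \<in> E \<Longrightarrow> {a', z} \<in> E \<Longrightarrow> z \<noteq> a \<Longrightarrow> \<phi> {a', z} \<in> {A, A'}"
    using far_colours[of a a' \<phi>] by blast
  then show ?thesis using that assms by blast
qed

text \<open>The last two conjuncts restate what \<open>u'\<close> requires of the edges at
  \<open>u\<close>; they are for a caller that has recoloured a triangle at \<open>u'\<close> at the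
  same time.\<close>

lemma diamond_recolour:
  fixes \<chi> :: "'a set \<Rightarrow> colour"
  assumes N: "nbrs E u = {p, q, u'}" "nbrs E v = {p, q, v'}" "nbrs E p = {u, q, v}" "nbrs E q = {u, p, v}"
    and d: "distinct [u, p, q, v]" and u': "u' \<notin> {u, p, q, v}" and v': "v' \<notin> {u, p, q, v}"
    and P: "\<And>z. {u', z} \<in> E \<Longrightarrow> z \<noteq> u \<Longrightarrow> \<chi> {u', z} \<in> {P1, P2}"
    and V: "\<And>z. {v', z} \<in> E \<Longrightarrow> z \<noteq> v \<Longrightarrow> \<chi> {v', z} \<in> {V1, V2}"
    and PV: "{P1, P2} \<noteq> {V1, V2} \<or> P1 = P2"
  shows "\<exists>\<psi>. (\<forall>e. \<not> e \<subseteq> {u, p, q, v} \<longrightarrow> \<psi> e = \<chi> e) \<and> (\<forall>x\<in>{u, p, q, v}. proper_at E \<psi> x) \<and>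
    \<psi> {u, p} \<notin> {P1, P2} \<and> \<psi> {u, q} \<notin> {P1, P2}"
proof -
  have d': "distinct [v, q, p, u]" using d by auto
  obtain g1 g2 h1 h2 k where t: "distinct [g1, g2, h1, h2, k, \<chi> {u, u'}]" "\<chi> {v, v'} \<notin> {g1, g2, h1, h2, k}"
    "g1 \<notin> {V1, V2}" "g2 \<notin> {V1, V2}" "h1 \<notin> {P1, P2}" "h2 \<notin> {P1, P2}"
    using diamond_colours[OF PV, of "\<chi> {u, u'}" "\<chi> {v, v'}"] unfolding diamond_sol_def by blast
  define \<psi> where "\<psi> = \<chi>({v, p} := g1, {v, q} := g2, {u, p} := h1, {u, q} := h2, {p, q} := k)"
  have c: "{p, v} = {v, p}" "{q, v} = {v, q}" "{p, u} = {u, p}" "{q, u} = {u, q}" "{q, p} = {p, q}"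
    by (rule insert_commute)+
  have v: "\<psi> {v, p} = g1" "\<psi> {v, q} = g2" "\<psi> {u, p} = h1" "\<psi> {u, q} = h2" "\<psi> {p, q} = k"
    using d d' by (simp_all add: \<psi>_def doubleton_eq_iff)
  have old: "\<psi> e = \<chi> e" if "\<not> e \<subseteq> {u, p, q, v}" for e using that by (auto simp: \<psi>_def)
  have x: "\<psi> {u, u'} = \<chi> {u, u'}" "\<psi> {v, v'} = \<chi> {v, v'}" "\<psi> {u', z} = \<chi> {u', z}" "\<psi> {v', z} = \<chi> {v', z}" for z
    using u' v' by (auto intro!: old)
  have T1: "cubic_triangle E u p q u' v v" using N d u' by (intro cubic_triangleI) auto
  have T2: "cubic_triangle E v p q v' u u" using N d v' by (intro cubic_triangleI) auto
  have nu: "z = p \<or> z = q \<or> z = u'" if "{u, z} \<in> E" for z using that N(1) by (auto simp flip: nbrs_iff)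
  have nv: "z = p \<or> z = q \<or> z = v'" if "{v, z} \<in> E" for z using that N(2) by (auto simp flip: nbrs_iff)
  have "proper_at E \<psi> w" if "w \<in> {u, p, q}" for w
  proof (rule proper_at_triangle[OF T1 _ _ _ _ that])
    show "distinct [\<psi> {u, p}, \<psi> {p, q}, \<psi> {u, q}, \<psi> {u, u'}, \<psi> {p, v}, \<psi> {q, v}]"
      using t(1) unfolding c v x by auto
    show "\<psi> {u', z} \<notin> {\<psi> {u, p}, \<psi> {u, q}}" if "{u', z} \<in> E" "z \<noteq> u" for z
      using P[OF that] t(5,6) unfolding v x by auto
    show "\<psi> {v, z} \<notin> {\<psi> {u, p}, \<psi> {p, q}}" if "{v, z} \<in> E" "z \<noteq> p" for z
      using nv[OF that(1)] that(2) t(1,2) v x by auto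
    show "\<psi> {v, z} \<notin> {\<psi> {u, q}, \<psi> {p, q}}" if "{v, z} \<in> E" "z \<noteq> q" for z
      using nv[OF that(1)] that(2) t(1,2) v x by auto
  qed
  moreover have "proper_at E \<psi> w" if "w \<in> {v, p, q}" for w
  proof (rule proper_at_triangle[OF T2 _ _ _ _ that])
    show "distinct [\<psi> {v, p}, \<psi> {p, q}, \<psi> {v, q}, \<psi> {v, v'}, \<psi> {p, u}, \<psi> {q, u}]"
      using t(1,2) unfolding c v x by auto
    show "\<psi> {v', z} \<notin> {\<psi> {v, p}, \<psi> {v, q}}" if "{v', z} \<in> E" "z \<noteq> v" for z
      using V[OF that] t(3,4) unfolding v x by auto
    show "\<psi> {u, z} \<notin> {\<psi> {v, p}, \<psi> {p, q}}" if "{u, z} \<in> E" "z \<noteq> p" for z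
      using nu[OF that(1)] that(2) t(1,2) v x by auto
    show "\<psi> {u, z} \<notin> {\<psi> {v, q}, \<psi> {p, q}}" if "{u, z} \<in> E" "z \<noteq> q" for z
      using nu[OF that(1)] that(2) t(1,2) v x by auto
  qed
  ultimately show ?thesis using old t(5,6) v by (intro exI[of _ \<psi>]) simp
qed

lemma no_K4:
  assumes "distinct [u, p, q, v]" and N: "nbrs E u = {p, q, v}" "nbrs E v = {p, q, u}" "nbrs E p = {u, q, v}" "nbrs E q = {u, p, v}"
  shows False
proof (rule reducible[of u p "{u, p, q, v}" "{u, p, q, v}"])
  have d': "distinct [v, q, p, u]" using assms(1) by auto
  show "{u, p} \<in> E" using N(1) by (auto simp flip: nbrs_iff)
  show "w \<in> {u, p, q, v}" if "x \<in> {u, p, q, v}" "{x, w} \<in> E" for x w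
  proof -
    have "w \<in> nbrs E x" using that(2) by simp
    moreover from that(1) have "nbrs E x \<subseteq> {u, p, q, v}" by (elim insertE emptyE) (simp_all add: N)
    ultimately show ?thesis by blast
  qed
  fix \<phi> :: "'a set \<Rightarrow> colour"
  define \<psi> where "\<psi> = \<phi>({v, p} := Col0, {v, q} := Col1, {u, p} := Col2, {u, q} := Col3, {p, q} := Col4, {u, v} := Col5)"
  have c: "{p, v} = {v, p}" "{q, v} = {v, q}" "{p, u} = {u, p}" "{q, u} = {u, q}" "{q, p} = {p, q}" "{v, u} = {u, v}"
    by (rule insert_commute)+
  have v: "\<psi> {v, p} = Col0" "\<psi> {v, q} = Col1" "\<psi> {u, p} = Col2" "\<psi> {u, q} = Col3" "\<psi> {p, q} = Col4" "\<psi> {u, v} = Col5"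
    using assms(1) d' by (simp_all add: \<psi>_def doubleton_eq_iff)
  have T1: "cubic_triangle E u p q v v v" using N assms(1) by (intro cubic_triangleI) auto
  have T2: "cubic_triangle E v p q u u u" using N assms(1) by (intro cubic_triangleI) auto
  have nu: "z = p \<or> z = q \<or> z = v" if "{u, z} \<in> E" for z using that N(1) by (auto simp flip: nbrs_iff)
  have nv: "z = p \<or> z = q \<or> z = u" if "{v, z} \<in> E" for z using that N(2) by (auto simp flip: nbrs_iff)
  have "proper_at E \<psi> w" if "w \<in> {u, p, q}" for w
    by (rule proper_at_triangle[OF T1 _ _ _ _ that]) (use nv c v in fastforce)+
  moreover have "proper_at E \<psi> w" if "w \<in> {v, p, q}" for w
    by (rule proper_at_triangle[OF T2 _ _ _ _ that]) (use nu c v in fastforce)+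
  ultimately show "\<exists>\<psi>. (\<forall>e\<in>E. \<not> e \<subseteq> {u, p, q, v} \<longrightarrow> \<psi> e = \<phi> e) \<and> (\<forall>x\<in>{u, p, q, v}. proper_at E \<psi> x)"
    by (intro exI[of _ \<psi>]) (auto simp: \<psi>_def)
qed auto

text \<open>The obstacle is equal far pairs of two colours. If \<open>u'\<close> or
  \<open>v'\<close> has degree at most 2, one pair degenerates. Otherwise \<open>u'\<close> lies in
  a triangle \<open>u' b c\<close>. If \<open>v'\<close> is one of \<open>b\<close>,
  \<open>c\<close>, the far pairs share the colour of \<open>{u', v'}\<close> and differ in the
  other one, as the edges from \<open>u'\<close> and \<open>v'\<close> to the third corner are
  adjacent. If not, the triangle is recoloured along with the diamond so that the pairs
  differ.\<close>

lemma no_diamond: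
  assumes e: "{u, p} \<in> E" "{u, q} \<in> E" "{p, q} \<in> E" "{v, p} \<in> E" "{v, q} \<in> E" and uv: "u \<noteq> v"
  shows False
proof -
  have d: "distinct [u, p, q, v]" using e uv no_loop by auto
  have d': "distinct [v, q, p, u]" using d by auto
  have N: "nbrs E p = {u, q, v}" "nbrs E q = {u, p, v}"
    by (rule nbrs_eq; use e adj_sym d in auto)+
  obtain u' where u': "nbrs E u = {p, q, u'}" "u' \<notin> {p, q, u}"
    by (rule triangle_corner[of p q u]) (use e adj_sym in auto)
  obtain v' where v': "nbrs E v = {p, q, v'}" "v' \<notin> {p, q, v}"
    by (rule triangle_corner[of p q v]) (use e adj_sym in auto)
  have eu: "{u, u'} \<in> E" "{v, v'} \<in> E" using u'(1) v'(1) by (auto simp flip: nbrs_iff)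
  have uv_edge: "{u, v} \<notin> E"
  proof
    assume h: "{u, v} \<in> E"
    then have "v \<in> nbrs E u" "u \<in> nbrs E v" by (auto simp: insert_commute)
    then have "u' = v" "v' = u" using u' v' d d' by auto
    then show False using no_K4[OF d] u'(1) v'(1) N by simp
  qed
  then have u'n: "u' \<notin> {u, p, q, v}" and v'n: "v' \<notin> {u, p, q, v}" using u'(2) v'(2) eu adj_sym by auto
  let ?D = "{u, p, q, v}"
  have inside: "w \<in> ?D" if "x \<in> {p, q}" "{x, w} \<in> E" for x w
    using that N by (auto simp flip: nbrs_iff)
  have simple: False if PV: "\<And>\<phi> :: 'a set \<Rightarrow> colour. strong (delete E {p, q}) \<phi> \<Longrightarrow>
      \<exists>P1 P2 V1 V2. (\<forall>z. {u', z} \<in> E \<longrightarrow> z \<noteq> u \<longrightarrow> \<phi> {u', z} \<in> {P1, P2}) \<and>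
        (\<forall>z. {v', z} \<in> E \<longrightarrow> z \<noteq> v \<longrightarrow> \<phi> {v', z} \<in> {V1, V2}) \<and> ({P1, P2} \<noteq> {V1, V2} \<or> P1 = P2)"
  proof (rule reducible[of p q "{p, q}" ?D])
    fix \<phi> :: "'a set \<Rightarrow> colour" assume "strong (delete E {p, q}) \<phi>"
    from PV[OF this] obtain P1 P2 V1 V2 where
      h: "\<And>z. {u', z} \<in> E \<Longrightarrow> z \<noteq> u \<Longrightarrow> \<phi> {u', z} \<in> {P1, P2}" "\<And>z. {v', z} \<in> E \<Longrightarrow> z \<noteq> v \<Longrightarrow> \<phi> {v', z} \<in> {V1, V2}"
      "{P1, P2} \<noteq> {V1, V2} \<or> P1 = P2" by blast
    show "\<exists>\<psi>. (\<forall>e\<in>E. \<not> e \<subseteq> ?D \<longrightarrow> \<psi> e = \<phi> e) \<and> (\<forall>x\<in>?D. proper_at E \<psi> x)"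
      using diamond_recolour[OF u'(1) v'(1) N d u'n v'n h] by blast
  qed (use e inside in auto)
  have degree2: False if "nbrs E w' \<subseteq> {w, r}" "(w, w') \<in> {(u, u'), (v, v')}" for w w' r
  proof (rule simple)
    fix \<phi> :: "'a set \<Rightarrow> colour"
    obtain A A' where A: "\<And>z. {u', z} \<in> E \<Longrightarrow> z \<noteq> u \<Longrightarrow> \<phi> {u', z} \<in> {A, A'}"
      using far_colours_edge[OF eu(1), of \<phi>] by blast
    obtain B B' where B: "\<And>z. {v', z} \<in> E \<Longrightarrow> z \<noteq> v \<Longrightarrow> \<phi> {v', z} \<in> {B, B'}"
      using far_colours_edge[OF eu(2), of \<phi>] by blast
    have r: "\<phi> {w', z} = \<phi> {w', r}" if "{w', z} \<in> E" "z \<noteq> w" for z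
      using nbrs_mem[OF \<open>nbrs E w' \<subseteq> {w, r}\<close> that(1)] that(2) by auto
    from that(2) consider "w = u" "w' = u'" | "w = v" "w' = v'" by blast
    then show "\<exists>P1 P2 V1 V2. (\<forall>z. {u', z} \<in> E \<longrightarrow> z \<noteq> u \<longrightarrow> \<phi> {u', z} \<in> {P1, P2}) \<and>
        (\<forall>z. {v', z} \<in> E \<longrightarrow> z \<noteq> v \<longrightarrow> \<phi> {v', z} \<in> {V1, V2}) \<and> ({P1, P2} \<noteq> {V1, V2} \<or> P1 = P2)"
    proof cases
      case 1
      then have "\<forall>z. {u', z} \<in> E \<longrightarrow> z \<noteq> u \<longrightarrow> \<phi> {u', z} \<in> {\<phi> {w', r}, \<phi> {w', r}}" using r by auto
      then show ?thesis using B by blast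
    next
      case 2
      have "{A, A'} \<noteq> {\<phi> {w', r}, \<phi> {w', r}} \<or> A = A'" by auto
      moreover have "\<forall>z. {v', z} \<in> E \<longrightarrow> z \<noteq> v \<longrightarrow> \<phi> {v', z} \<in> {\<phi> {w', r}, \<phi> {w', r}}" using r 2 by auto
      ultimately show ?thesis using A by blast
    qed
  qed
  have degree3: "\<exists>b c. nbrs E w' = {w, b, c} \<and> distinct [w, b, c]" if "(w, w') \<in> {(u, u'), (v, v')}" for w w'
  proof -
    have "{w', w} \<in> E" using that eu adj_sym by blast
    then obtain b c where bc: "nbrs E w' \<subseteq> {w, b, c}" using admissible_nbrs_subset1[OF adm] by blast
    have "\<not> nbrs E w' \<subseteq> {w, b}" "\<not> nbrs E w' \<subseteq> {w, c}" using degree2[OF _ that] by blast+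
    then have "c \<in> nbrs E w'" "b \<in> nbrs E w'" "distinct [w, b, c]" using bc by auto
    moreover have "w \<in> nbrs E w'" using \<open>{w', w} \<in> E\<close> by simp
    ultimately show ?thesis using bc by blast
  qed
  obtain b c where bc: "nbrs E u' = {u, b, c}" "distinct [u, b, c]" using degree3[of u u'] by blast
  have eb: "{u', b} \<in> E" "{u', c} \<in> E" "{u', u} \<in> E" using bc by (auto simp flip: nbrs_iff)
  have np: "{u', p} \<notin> E" "{u', q} \<notin> E"
  proof -
    have "u' \<notin> nbrs E p" "u' \<notin> nbrs E q" unfolding N using u'n by auto
    then show "{u', p} \<notin> E" "{u', q} \<notin> E" by (simp_all add: insert_commute)
  qed
  have ub: "{u, b} \<notin> E" "{u, c} \<notin> E"
  proof -
    have "b \<notin> {p, q}" "c \<notin> {p, q}" using np eb by auto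
    moreover have "b \<noteq> u'" "c \<noteq> u'" using eb no_loop by blast+
    ultimately have "b \<notin> nbrs E u" "c \<notin> nbrs E u" unfolding u'(1) by auto
    then show "{u, b} \<notin> E" "{u, c} \<notin> E" by simp_all
  qed
  have bcE: "{b, c} \<in> E" using claw[OF eb(3) eb(1,2)] bc(2) ub by auto
  have notin: "w \<notin> ?D" if wbc: "w \<in> {b, c}" for w
  proof -
    have "w \<noteq> u" "w \<noteq> p" "w \<noteq> q" using that bc(2) np eb by auto
    moreover have "w \<noteq> v"
    proof
      assume "w = v"
      then obtain w' where w': "{v, w'} \<in> E" "w' \<in> {b, c}" "{u', v} \<in> E"
        using wbc bcE adj_sym[OF bcE] eb by auto
      then have "w' \<in> nbrs E v" "u' \<in> nbrs E v" by (auto simp: insert_commute)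
      then have "w' = v'" "u' = v'" using v'(1) w'(2) np eb u'n by auto
      then show False using w'(2) eb no_loop by auto
    qed
    ultimately show ?thesis by auto
  qed
  show False
  proof (cases "v' \<in> {b, c}")
    case True
    then obtain w where w: "{v', w} = {b, c}" "v' \<noteq> w" "w \<in> {b, c}" using bc(2) by auto
    then have ew: "{v', w} \<in> E" "{u', w} \<in> E" "{u', v'} \<in> E" "nbrs E u' = {u, v', w}"
      using bcE eb True bc(1) by auto
    have wv: "w \<noteq> v" using notin[OF w(3)] by simp
    have "nbrs E v' = {v, u', w}"
      by (rule nbrs_eq) (use ew adj_sym eu wv u'n no_loop in auto)
    show False
    proof (rule simple)
      fix \<phi> :: "'a set \<Rightarrow> colour" assume \<phi>: "strong (delete E {p, q}) \<phi>"
      have wpq: "w \<notin> {p, q}" using notin[OF w(3)] by auto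
      have "\<phi> {u', w} \<noteq> \<phi> {u', v'}" using strong_adjacent[OF \<phi>, of u' w v'] ew w(2) wpq u'n v'n by (auto simp: delete_iff)
      moreover have "\<phi> {w, u'} \<noteq> \<phi> {w, v'}"
        using strong_adjacent[OF \<phi>, of w u' v'] adj_sym[OF ew(1)] adj_sym[OF ew(2)] no_loop[OF ew(3)] wpq u'n v'n by (auto simp: delete_iff)
      ultimately have "{\<phi> {u', v'}, \<phi> {u', w}} \<noteq> {\<phi> {u', v'}, \<phi> {v', w}}"
        by (auto simp: doubleton_eq_iff insert_commute)
      moreover have "\<phi> {u', z} \<in> {\<phi> {u', v'}, \<phi> {u', w}}" if "{u', z} \<in> E" "z \<noteq> u" for z
      proof -
        have "z \<in> nbrs E u'" using that(1) by simp
        then show ?thesis using that(2) unfolding ew(4) by auto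
      qed
      moreover have "\<phi> {v', z} \<in> {\<phi> {u', v'}, \<phi> {v', w}}" if "{v', z} \<in> E" "z \<noteq> v" for z
      proof -
        have "z \<in> nbrs E v'" using that(1) by simp
        then show ?thesis using that(2) unfolding \<open>nbrs E v' = {v, u', w}\<close> by (auto simp: insert_commute)
      qed
      ultimately show "\<exists>P1 P2 V1 V2. (\<forall>z. {u', z} \<in> E \<longrightarrow> z \<noteq> u \<longrightarrow> \<phi> {u', z} \<in> {P1, P2}) \<and>
        (\<forall>z. {v', z} \<in> E \<longrightarrow> z \<noteq> v \<longrightarrow> \<phi> {v', z} \<in> {V1, V2}) \<and> ({P1, P2} \<noteq> {V1, V2} \<or> P1 = P2)" by blast
    qed
  next
    case False
    obtain x b' c' where T: "cubic_triangle E u' b c x b' c'" using obtain_cubic_triangle[OF eb(1) bcE eb(2)] .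
    have "u = x" by (rule cubic_triangle_unique(1)[OF T eb(3)]) (use bc(2) in auto)
    then have T: "cubic_triangle E u' b c u b' c'" using T by simp
    note Te = cubic_triangle_edges[OF T]
    have v'u': "v' \<noteq> u'"
    proof
      assume "v' = u'"
      then have "v \<in> nbrs E u'" using adj_sym[OF eu(2)] by simp
      then show False using bc(1) notin uv by auto
    qed
    let ?V = "{u', b, c, u, p, q, v}"
    have far_notin: "w' \<notin> ?V" if "{w, w'} \<in> E" "w \<in> {b, c}" "w' \<notin> {u', b, c}" for w w'
    proof -
      have w: "w \<notin> ?D" using notin[OF that(2)] .
      have "w \<notin> nbrs E u" "w \<notin> nbrs E p" "w \<notin> nbrs E q" "w \<notin> nbrs E v"
        using w that(2) False u'n Te no_loop unfolding u'(1) v'(1) N by auto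
      moreover have "w \<in> nbrs E w'" using adj_sym[OF that(1)] by simp
      ultimately show ?thesis using that(3) by auto
    qed
    have b': "b' \<notin> ?V" by (rule far_notin[of b]) (use T Te in \<open>auto simp: cubic_triangle_def\<close>)
    have c': "c' \<notin> ?V" by (rule far_notin[of c]) (use T Te in \<open>auto simp: cubic_triangle_def\<close>)
    have v'V: "v' \<notin> ?V" using False v'u' v'n by auto
    have dT: "distinct [u', b, c]" using T by (simp add: cubic_triangle_def)
    have dV: "distinct [u', b, c, u, p, q, v]" "distinct [v, q, p, u, c, b, u']"
      using dT d u'n notin[of b] notin[of c] by auto
    \<comment> \<open>Keeping \<open>b\<close> and \<open>c\<close> preserves the edge
      \<open>{b, c}\<close>, which forces different colours on their outer edges, as
      \<open>port_colours_avoid\<close> requires.\<close>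
    let ?S = "{u', u, p, q}"
    show False
    proof (rule reducible[of u p ?S ?V])
      show "w \<in> ?V" if "x \<in> ?S" "{x, w} \<in> E" for x w
      proof -
        have "w \<in> nbrs E x" using that(2) by simp
        moreover from that(1) have "nbrs E x \<subseteq> ?V" by (elim insertE emptyE) (simp_all add: N u'(1) bc(1))
        ultimately show ?thesis by blast
      qed
    next
      fix \<phi> :: "'a set \<Rightarrow> colour" assume \<phi>: "strong (delete E ?S) \<phi>"
      have "\<phi> {b, b'} \<noteq> \<phi> {c, c'}"
        using strong_distance2[OF \<phi>, of b c b' c'] Te dV b' c' by (auto simp: delete_iff)
      obtain B1 B2 where B: "\<And>z. {b', z} \<in> E \<Longrightarrow> z \<noteq> b \<Longrightarrow> \<phi> {b', z} \<in> {B1, B2}"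
        using far_colours_edge[OF Te(5), of \<phi>] by blast
      obtain C1 C2 where C: "\<And>z. {c', z} \<in> E \<Longrightarrow> z \<noteq> c \<Longrightarrow> \<phi> {c', z} \<in> {C1, C2}"
        using far_colours_edge[OF Te(6), of \<phi>] by blast
      obtain V1 V2 where V: "\<And>z. {v', z} \<in> E \<Longrightarrow> z \<noteq> v \<Longrightarrow> \<phi> {v', z} \<in> {V1, V2}"
        using far_colours_edge[OF eu(2), of \<phi>] by blast
      obtain y ta tb tc where "port_colours (\<phi> {b, b'}) B1 B2 (\<phi> {c, c'}) C1 C2 y ta tb tc" "{tb, tc} \<noteq> {V1, V2}"
        using port_colours_avoid[OF \<open>\<phi> {b, b'} \<noteq> \<phi> {c, c'}\<close>] by blast
      then have t: "distinct [\<phi> {b, b'}, \<phi> {c, c'}, y, ta, tb, tc]" "ta \<notin> {B1, B2, C1, C2}" "tb \<notin> {C1, C2}" "tc \<notin> {B1, B2}"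
        "{tc, tb} \<noteq> {V1, V2} \<or> tc = tb"
        unfolding port_colours_def by (auto simp: insert_commute)
      \<comment> \<open>The triangle at \<open>u'\<close> is coloured first, with a pair at
        \<open>u'\<close> that suits the diamond; \<open>diamond_recolour\<close> then changes only
        edges inside the diamond.\<close>
      define \<chi> where "\<chi> = \<phi>({u', u} := y, {u', b} := tc, {u', c} := tb, {b, c} := ta)"
      have \<chi>: "\<chi> {u', u} = y" "\<chi> {u', b} = tc" "\<chi> {u', c} = tb" "\<chi> {b, c} = ta"
        using dV by (simp_all add: \<chi>_def doubleton_eq_iff)
      have \<chi>_old: "\<chi> e = \<phi> e" if "\<not> e \<subseteq> ?V" for e using that by (auto simp: \<chi>_def)
      have "\<exists>\<psi>. (\<forall>e. \<not> e \<subseteq> ?D \<longrightarrow> \<psi> e = \<chi> e) \<and> (\<forall>x\<in>?D. proper_at E \<psi> x) \<and>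
        \<psi> {u, p} \<notin> {tc, tb} \<and> \<psi> {u, q} \<notin> {tc, tb}"
      proof (rule diamond_recolour[OF u'(1) v'(1) N d u'n v'n _ _ t(5)])
        show "\<chi> {u', z} \<in> {tc, tb}" if "{u', z} \<in> E" "z \<noteq> u" for z
        proof -
          have "z \<in> nbrs E u'" using that(1) by simp
          then show ?thesis using that(2) \<chi> unfolding bc(1) by auto
        qed
        show "\<chi> {v', z} \<in> {V1, V2}" if "{v', z} \<in> E" "z \<noteq> v" for z
          using V[OF that] \<chi>_old[of "{v', z}"] v'V by auto
      qed
      then obtain \<psi> where \<psi>: "\<And>e. \<not> e \<subseteq> ?D \<Longrightarrow> \<psi> e = \<chi> e" "\<And>x. x \<in> ?D \<Longrightarrow> proper_at E \<psi> x"
        "\<psi> {u, p} \<notin> {tc, tb}" "\<psi> {u, q} \<notin> {tc, tb}" by blast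
      have old: "\<psi> e = \<phi> e" if "\<not> e \<subseteq> ?V" for e
      proof -
        have "\<not> e \<subseteq> ?D" using that by auto
        then show ?thesis using \<psi>(1) \<chi>_old[OF that] by simp
      qed
      have val: "\<psi> {u', u} = y" "\<psi> {u', b} = tc" "\<psi> {u', c} = tb" "\<psi> {b, c} = ta"
        using \<psi>(1) \<chi> u'n notin[of b] by auto
      have x: "\<psi> {b, b'} = \<phi> {b, b'}" "\<psi> {c, c'} = \<phi> {c, c'}" "\<psi> {b', z} = \<phi> {b', z}" "\<psi> {c', z} = \<phi> {c', z}" for z
        using b' c' by (auto intro!: old)
      have "proper_at E \<psi> w" if "w \<in> {u', b, c}" for w
      proof (rule proper_at_triangle[OF T _ _ _ _ that])
        show "distinct [\<psi> {u', b}, \<psi> {b, c}, \<psi> {u', c}, \<psi> {u', u}, \<psi> {b, b'}, \<psi> {c, c'}]"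
          using t(1) unfolding val x by auto
        show "\<psi> {u, z} \<notin> {\<psi> {u', b}, \<psi> {u', c}}" if "{u, z} \<in> E" "z \<noteq> u'" for z
        proof -
          have "z \<in> nbrs E u" using that(1) by simp
          then have "z = p \<or> z = q" using that(2) unfolding u'(1) by auto
          then show ?thesis using \<psi>(3,4) unfolding val by auto
        qed
        show "\<psi> {b', z} \<notin> {\<psi> {u', b}, \<psi> {b, c}}" if "{b', z} \<in> E" "z \<noteq> b" for z
          using B[OF that] t unfolding val x by auto
        show "\<psi> {c', z} \<notin> {\<psi> {u', c}, \<psi> {b, c}}" if "{c', z} \<in> E" "z \<noteq> c" for z
          using C[OF that] t unfolding val x by auto
      qed
      then show "\<exists>\<psi>. (\<forall>e\<in>E. \<not> e \<subseteq> ?V \<longrightarrow> \<psi> e = \<phi> e) \<and> (\<forall>x\<in>?V. proper_at E \<psi> x)"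
        using old \<psi>(2) by (intro exI[of _ \<psi>]) blast
    qed (use e in auto)
  qed
qed


section \<open>Disjointness of triangles; vertices of degree 2\<close>

lemma outer_not_adjacent:
  assumes T: "cubic_triangle E a b c a' b' c'"
  shows "{a', b} \<notin> E" "{a', c} \<notin> E"
proof -
  note e = cubic_triangle_edges[OF T]
  have ne: "c \<noteq> a'" "b \<noteq> a'" using T unfolding cubic_triangle_def by auto
  show "{a', b} \<notin> E" using no_diamond[of c a b a'] e adj_sym ne by blast
  show "{a', c} \<notin> E" using no_diamond[of b a c a'] e adj_sym ne by blast
qed

text \<open>Two different triangles at a vertex of degree 3 share an edge, and a diamond
  results.\<close>

lemma same_triangle:
  assumes T: "cubic_triangle E a b c a' b' c'" and e: "{a, p} \<in> E" "{a, q} \<in> E" "{p, q} \<in> E"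
  shows "{p, q} = {b, c}"
proof -
  have "p \<in> nbrs E a" "q \<in> nbrs E a" using e by auto
  then have "p \<in> {b, c, a'}" "q \<in> {b, c, a'}" using T unfolding cubic_triangle_def by auto
  moreover have "p \<noteq> q" using no_loop e by blast
  moreover have "{p, q} \<noteq> {a', b}" "{p, q} \<noteq> {a', c}" using outer_not_adjacent[OF T] e by auto
  ultimately show ?thesis by (auto simp: insert_commute)
qed

lemma triangles_disjoint:
  assumes T1: "cubic_triangle E a b c a' b' c'" and T2: "cubic_triangle E p q r p' q' r'"
    and ne: "{a, b, c} \<noteq> {p, q, r}"
  shows "{a, b, c} \<inter> {p, q, r} = {}"
proof -
  have corner: False if T1: "cubic_triangle E a b c a' b' c'" and T2: "cubic_triangle E a q r p' q' r'" and ne: "{b, c} \<noteq> {q, r}"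
    for a b c a' b' c' q r p' q' r'
  proof -
    have "{q, r} = {b, c}" by (rule same_triangle[OF T1]) (use cubic_triangle_edges[OF T2] in auto)
    then show False using ne by simp
  qed
  have rot: "\<exists>b0 c0 a0' b0' c0'. cubic_triangle E x b0 c0 a0' b0' c0' \<and> {a, b, c} = {x, b0, c0}"
    if "cubic_triangle E a b c a' b' c'" "x \<in> {a, b, c}" for a b c a' b' c' x
  proof -
    have r: "cubic_triangle E b c a b' c' a'" "cubic_triangle E c a b c' a' b'"
      using cubic_triangle_rotate[OF that(1)] cubic_triangle_rotate[OF cubic_triangle_rotate[OF that(1)]] by simp_all
    have s: "{a, b, c} = {b, c, a}" "{a, b, c} = {c, a, b}" by auto
    from that(2) consider "x = a" | "x = b" | "x = c" by blast
    then show ?thesis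
    proof cases
      case 1 then show ?thesis using that(1) by blast
    next
      case 2 then show ?thesis using r(1) s(1) by blast
    next
      case 3 then show ?thesis using r(2) s(2) by blast
    qed
  qed
  show ?thesis
  proof (rule ccontr)
    assume "{a, b, c} \<inter> {p, q, r} \<noteq> {}"
    then obtain x where x: "x \<in> {a, b, c}" "x \<in> {p, q, r}" by auto
    obtain b0 c0 a0' b0' c0' where 1: "cubic_triangle E x b0 c0 a0' b0' c0'" "{a, b, c} = {x, b0, c0}"
      using rot[OF T1 x(1)] by blast
    obtain q0 r0 p0' q0' r0' where 2: "cubic_triangle E x q0 r0 p0' q0' r0'" "{p, q, r} = {x, q0, r0}"
      using rot[OF T2 x(2)] by blast
    have "{b0, c0} \<noteq> {q0, r0}" using ne unfolding 1(2) 2(2) by auto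
    then show False using corner[OF 1(1) 2(1)] by blast
  qed
qed

lemma subdivision_proper:
  fixes \<psi> :: "'a set \<Rightarrow> colour"
  assumes T1: "cubic_triangle E v b c u b' c'" and T2: "cubic_triangle E w q r u q' r'" and u: "nbrs E u = {v, w}"
    and vw: "v \<noteq> w"
    and d1: "distinct [\<psi> {v, b}, \<psi> {b, c}, \<psi> {v, c}, \<psi> {v, u}, \<psi> {b, b'}, \<psi> {c, c'}]"
    and d2: "distinct [\<psi> {w, q}, \<psi> {q, r}, \<psi> {w, r}, \<psi> {w, u}, \<psi> {q, q'}, \<psi> {r, r'}]"
    and y: "\<psi> {v, u} \<noteq> \<psi> {w, u}" "\<psi> {w, u} \<notin> {\<psi> {v, b}, \<psi> {v, c}}" "\<psi> {v, u} \<notin> {\<psi> {w, q}, \<psi> {w, r}}"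
    and far: "\<And>z. {b', z} \<in> E \<Longrightarrow> z \<noteq> b \<Longrightarrow> \<psi> {b', z} \<notin> {\<psi> {v, b}, \<psi> {b, c}}"
      "\<And>z. {c', z} \<in> E \<Longrightarrow> z \<noteq> c \<Longrightarrow> \<psi> {c', z} \<notin> {\<psi> {v, c}, \<psi> {b, c}}"
      "\<And>z. {q', z} \<in> E \<Longrightarrow> z \<noteq> q \<Longrightarrow> \<psi> {q', z} \<notin> {\<psi> {w, q}, \<psi> {q, r}}"
      "\<And>z. {r', z} \<in> E \<Longrightarrow> z \<noteq> r \<Longrightarrow> \<psi> {r', z} \<notin> {\<psi> {w, r}, \<psi> {q, r}}"
    and x: "x \<in> {v, b, c, u, w, q, r}"
  shows "proper_at E \<psi> x"
proof -
  have c: "{u, v} = {v, u}" "{u, w} = {w, u}" by (rule insert_commute)+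
  have nu: "z = v \<or> z = w" if "{u, z} \<in> E" for z using that u by (auto simp flip: nbrs_iff)
  have nv: "z = b \<or> z = c \<or> z = u" if "{v, z} \<in> E" for z
    using that T1 unfolding cubic_triangle_def by (auto simp flip: nbrs_iff)
  have nw: "z = q \<or> z = r \<or> z = u" if "{w, z} \<in> E" for z
    using that T2 unfolding cubic_triangle_def by (auto simp flip: nbrs_iff)
  have "proper_at E \<psi> x" if "x \<in> {v, b, c}"
  proof (rule proper_at_triangle[OF T1 d1 _ far(1,2) that])
    show "\<psi> {u, z} \<notin> {\<psi> {v, b}, \<psi> {v, c}}" if "{u, z} \<in> E" "z \<noteq> v" for z
      using nu[OF that(1)] that(2) y(2) c by auto
  qed
  moreover have "proper_at E \<psi> x" if "x \<in> {w, q, r}"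
  proof (rule proper_at_triangle[OF T2 d2 _ far(3,4) that])
    show "\<psi> {u, z} \<notin> {\<psi> {w, q}, \<psi> {w, r}}" if "{u, z} \<in> E" "z \<noteq> w" for z
      using nu[OF that(1)] that(2) y(3) c by auto
  qed
  moreover have "proper_at E \<psi> u"
    unfolding proper_at_def
  proof (intro conjI allI impI)
    fix s t assume "{u, s} \<in> E" "{u, t} \<in> E" "s \<noteq> t"
    then show "\<psi> {u, s} \<noteq> \<psi> {u, t}" using nu[of s] nu[of t] y(1) c by auto
  next
    fix s t z assume h: "{u, s} \<in> E" "{u, t} \<in> E" "{s, z} \<in> E" "t \<noteq> s" "z \<noteq> u"
    consider "s = v" "t = w" | "s = w" "t = v" using nu[OF h(1)] nu[OF h(2)] h(4) by blast
    then show "\<psi> {u, t} \<noteq> \<psi> {s, z}"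
    proof cases
      case 1
      then have "z = b \<or> z = c" using nv h(3,5) by blast
      then show ?thesis using 1 y(2) c by auto
    next
      case 2
      then have "z = q \<or> z = r" using nw h(3,5) by blast
      then show ?thesis using 2 y(3) c by auto
    qed
  qed
  ultimately show ?thesis using x by blast
qed

text \<open>\<open>v\<close> has degree 3, since adjacent vertices of degree 2 are excluded. As
  \<open>u\<close> is adjacent to no other neighbour of \<open>v\<close>, claw-freeness makes the
  other two adjacent.\<close>

lemma degree_2_side:
  assumes u: "nbrs E u = {v, w}" "v \<noteq> w" and vw: "{v, w} \<notin> E"
  obtains b c b' c' where "cubic_triangle E v b c u b' c'"
proof -
  have uv: "{u, v} \<in> E" using u by (auto simp flip: nbrs_iff)
  have vu: "{v, u} \<in> E" by (rule adj_sym[OF uv])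
  obtain b where b: "b \<noteq> u" "{v, b} \<in> E" using no_pendant[OF vu] by blast
  have nb: "z \<noteq> w" if "{v, z} \<in> E" for z using that vw by auto
  have "\<not> nbrs E v \<subseteq> {u, b}"
  proof
    assume "nbrs E v \<subseteq> {u, b}"
    then have "nbrs E v = {u, b}" using vu b by auto
    then show False using no_adjacent_degree_2[of u v w b] u nb[OF b(2)] b by auto
  qed
  then obtain c where c: "{v, c} \<in> E" "c \<noteq> u" "c \<noteq> b" by (metis insertCI nbrs_iff subsetI)
  have nu: "{u, z} \<notin> E" if "{v, z} \<in> E" for z
  proof
    assume "{u, z} \<in> E"
    then have "z \<in> nbrs E u" by simp
    then show False using u nb[OF that] no_loop[OF that] by auto
  qed
  have "{b, c} \<in> E" using claw[OF vu b(2) c(1)] b c nu by auto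
  then obtain x b' c' where T: "cubic_triangle E v b c x b' c'" using obtain_cubic_triangle[OF b(2) _ c(1)] by blast
  have "u = x" by (rule cubic_triangle_unique(1)[OF T vu]) (use b c in auto)
  then show ?thesis using that T by blast
qed

text \<open>Both neighbours of \<open>u\<close> lie in triangles. If these are not linked, the far
  colours on each side are fixed and the sides interact only through the edges at \<open>u\<close>,
  the situation of \<open>rich_pair\<close>. If they are linked, the far colours of one side belong
  to the other triangle and change with it, so that case is treated separately.\<close>

lemma no_degree_2:
  assumes u: "nbrs E u = {v, w}" "v \<noteq> w"
  shows False
proof -
  have e: "{u, v} \<in> E" "{u, w} \<in> E" using u by (auto simp flip: nbrs_iff)
  have vw: "{v, w} \<notin> E"
  proof
    assume h: "{v, w} \<in> E"
    obtain u' where "nbrs E u = {v, w, u'}" "u' \<notin> {v, w, u}"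
      by (rule triangle_corner[of v w u]) (use h e adj_sym in auto)
    then show False using u by auto
  qed
  have u': "nbrs E u = {w, v}" "w \<noteq> v" "{w, v} \<notin> E" using u vw by (auto simp: insert_commute)
  obtain b c b' c' where T1: "cubic_triangle E v b c u b' c'" using degree_2_side[OF u vw] .
  obtain q r q' r' where T2: "cubic_triangle E w q r u q' r'" using degree_2_side[OF u'] .
  have ne: "{v, b, c} \<noteq> {w, q, r}"
  proof
    assume "{v, b, c} = {w, q, r}"
    then have "w \<in> {b, c}" using u by auto
    then show False using cubic_triangle_edges[OF T1] vw by auto
  qed
  have dis: "{v, b, c} \<inter> {w, q, r} = {}" by (rule triangles_disjoint[OF T1 T2 ne])
  have un: "u \<notin> {v, b, c}" "u \<notin> {w, q, r}" using T1 T2 unfolding cubic_triangle_def by auto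
  \<comment> \<open>Exchanging corners in either triangle later brings every possible link into the
    form \<open>b' = q\<close>.\<close>
  have dist: False if T1: "cubic_triangle E v b c u b' c'" and T2: "cubic_triangle E w q r u q' r'"
    and b'q: "b' = q" and dis: "{v, b, c} \<inter> {w, q, r} = {}" for b c b' c' q r q' r'
  proof -
    have un: "u \<notin> {v, b, c}" "u \<notin> {w, q, r}" using T1 T2 unfolding cubic_triangle_def by auto
    note e1 = cubic_triangle_edges[OF T1] and e2 = cubic_triangle_edges[OF T2]
    have dd: "distinct [v, b, c]" "distinct [w, q, r]" using T1 T2 by (simp_all add: cubic_triangle_def)
    have dV: "distinct [v, b, c, u, w, q, r]" "distinct [r, q, w, u, c, b, v]" using dd dis un by auto
    have bq: "{b, q} \<in> E" using e1(5) b'q by simp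
    have "b = q'" by (rule cubic_triangle_unique(2)[OF T2 adj_sym[OF bq]]) (use dV in simp)
    then have T1: "cubic_triangle E v b c u q c'" and T2: "cubic_triangle E w q r u b r'" using T1 T2 b'q by simp_all
    have N: "nbrs E v = {b, c, u}" "nbrs E b = {v, c, q}" "nbrs E c = {v, b, c'}"
      "nbrs E w = {q, r, u}" "nbrs E q = {w, r, b}" "nbrs E r = {w, q, r'}"
      using T1 T2 unfolding cubic_triangle_def by auto
    let ?V = "{v, b, c, u, w, q, r}" and ?S = "{v, u, w, b, q}"
    have cr: "{c, r} \<notin> E" using no_double_link[of v b c w q r] dV e1 e2 bq by auto
    have c': "c' \<notin> ?V"
    proof -
      have "c \<notin> nbrs E u" "c \<notin> nbrs E w" "c \<notin> nbrs E q" unfolding u N using dV by simp_all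
      moreover have "c \<in> nbrs E c'" using adj_sym[OF e1(6)] by simp
      moreover have "c' \<noteq> r" using cr e1(6) by auto
      ultimately show ?thesis using T1 unfolding cubic_triangle_def by auto
    qed
    have r': "r' \<notin> ?V"
    proof -
      have "r \<notin> nbrs E u" "r \<notin> nbrs E v" "r \<notin> nbrs E b" unfolding u N using dV by simp_all
      moreover have "r \<in> nbrs E r'" using adj_sym[OF e2(6)] by simp
      moreover have "r' \<noteq> c" using cr adj_sym[OF e2(6)] by auto
      ultimately show ?thesis using T2 unfolding cubic_triangle_def by auto
    qed
    show False
    proof (rule reducible[of u v ?S ?V])
      show "y \<in> ?V" if "x \<in> ?S" "{x, y} \<in> E" for x y
      proof -
        have "y \<in> nbrs E x" using that(2) by simp
        moreover from that(1) have "nbrs E x \<subseteq> ?V" by (elim insertE emptyE) (simp_all add: N u)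
        ultimately show ?thesis by blast
      qed
    next
      fix \<phi> :: "'a set \<Rightarrow> colour"
      obtain D1 D2 where D: "\<And>z. {c', z} \<in> E \<Longrightarrow> z \<noteq> c \<Longrightarrow> \<phi> {c', z} \<in> {D1, D2}"
        using far_colours_edge[OF e1(6), of \<phi>] by blast
      obtain D1' D2' where D': "\<And>z. {r', z} \<in> E \<Longrightarrow> z \<noteq> r \<Longrightarrow> \<phi> {r', z} \<in> {D1', D2'}"
        using far_colours_edge[OF e2(6), of \<phi>] by blast
      obtain x y y' ta tb tc ta' tb' tc' where
        t: "distinct [x, \<phi> {c, c'}, y, ta, tb, tc]" "distinct [x, \<phi> {r, r'}, y', ta', tb', tc']"
          "ta \<notin> {D1, D2}" "tb \<notin> {D1, D2}" "ta' \<notin> {D1', D2'}" "tb' \<notin> {D1', D2'}" "ta \<notin> {ta', tc'}" "tc \<notin> {ta', tc'}"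
          "y \<noteq> y'" "y \<notin> {tb', tc'}" "y' \<notin> {tb, tc}"
        using subdivided_double_link_colours[of "\<phi> {c, c'}" "\<phi> {r, r'}" D1 D2 D1' D2'] by blast
      define \<psi> where "\<psi> = \<phi>({v, b} := tc, {b, c} := ta, {v, c} := tb, {v, u} := y, {b, q} := x,
        {w, q} := tc', {q, r} := ta', {w, r} := tb', {w, u} := y')"
      have val: "\<psi> {v, b} = tc" "\<psi> {b, c} = ta" "\<psi> {v, c} = tb" "\<psi> {v, u} = y" "\<psi> {b, q} = x"
        "\<psi> {w, q} = tc'" "\<psi> {q, r} = ta'" "\<psi> {w, r} = tb'" "\<psi> {w, u} = y'"
        using dV by (simp_all add: \<psi>_def doubleton_eq_iff)
      have com: "{q, b} = {b, q}" "{b, v} = {v, b}" "{q, w} = {w, q}" by (rule insert_commute)+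
      have old: "\<psi> e = \<phi> e" if "\<not> e \<subseteq> ?V" for e using that by (auto simp: \<psi>_def)
      have o: "\<psi> {c, c'} = \<phi> {c, c'}" "\<psi> {r, r'} = \<phi> {r, r'}" "\<psi> {c', z} = \<phi> {c', z}" "\<psi> {r', z} = \<phi> {r', z}" for z
        using c' r' by (auto intro!: old)
      have "proper_at E \<psi> s" if "s \<in> ?V" for s
      proof (rule subdivision_proper[OF T1 T2 u _ _ _ _ _ _ _ _ _ that])
        show "distinct [\<psi> {v, b}, \<psi> {b, c}, \<psi> {v, c}, \<psi> {v, u}, \<psi> {b, q}, \<psi> {c, c'}]"
          using t(1) unfolding val o by auto
        show "distinct [\<psi> {w, q}, \<psi> {q, r}, \<psi> {w, r}, \<psi> {w, u}, \<psi> {q, b}, \<psi> {r, r'}]"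
          using t(2) unfolding com val o by auto
        show "\<psi> {v, u} \<noteq> \<psi> {w, u}" "\<psi> {w, u} \<notin> {\<psi> {v, b}, \<psi> {v, c}}" "\<psi> {v, u} \<notin> {\<psi> {w, q}, \<psi> {w, r}}"
          using t(9-11) unfolding val by auto
        show "\<psi> {q, z} \<notin> {\<psi> {v, b}, \<psi> {b, c}}" if "{q, z} \<in> E" "z \<noteq> b" for z
        proof -
          have "z \<in> nbrs E q" using that(1) by simp
          then have "z = w \<or> z = r" using that(2) unfolding N by auto
          then show ?thesis using t(7,8) val com by auto
        qed
        show "\<psi> {b, z} \<notin> {\<psi> {w, q}, \<psi> {q, r}}" if "{b, z} \<in> E" "z \<noteq> q" for z
        proof -
          have "z \<in> nbrs E b" using that(1) by simp
          then have "z = v \<or> z = c" using that(2) unfolding N by auto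
          then show ?thesis using t(7,8) val com by auto
        qed
        show "\<psi> {c', z} \<notin> {\<psi> {v, c}, \<psi> {b, c}}" if "{c', z} \<in> E" "z \<noteq> c" for z
          using D[OF that] t(3,4) unfolding val o by auto
        show "\<psi> {r', z} \<notin> {\<psi> {w, r}, \<psi> {q, r}}" if "{r', z} \<in> E" "z \<noteq> r" for z
          using D'[OF that] t(5,6) unfolding val o by auto
      qed
      then show "\<exists>\<psi>. (\<forall>e\<in>E. \<not> e \<subseteq> ?V \<longrightarrow> \<psi> e = \<phi> e) \<and> (\<forall>s\<in>?V. proper_at E \<psi> s)"
        using old by (intro exI[of _ \<psi>]) blast
    qed (use e in auto)
  qed
  note T1' = cubic_triangle_swap[OF T1] and T2' = cubic_triangle_swap[OF T2]
  have b'c': "b' \<notin> {q, r}" "c' \<notin> {q, r}"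
    using dist[OF T1 T2] dist[OF T1 T2'] dist[OF T1' T2] dist[OF T1' T2'] dis by (auto simp: insert_commute)
  note e1 = cubic_triangle_edges[OF T1] and e2 = cubic_triangle_edges[OF T2]
  have N: "nbrs E v = {b, c, u}" "nbrs E b = {v, c, b'}" "nbrs E c = {v, b, c'}"
    "nbrs E w = {q, r, u}" "nbrs E q = {w, r, q'}" "nbrs E r = {w, q, r'}"
    using T1 T2 unfolding cubic_triangle_def by auto
  have dd: "distinct [v, b, c]" "distinct [w, q, r]" using T1 T2 by (simp_all add: cubic_triangle_def)
  have dV: "distinct [v, b, c, u, w, q, r]" "distinct [r, q, w, u, c, b, v]" using dd dis un by auto
  \<comment> \<open>The edges \<open>{b, c}\<close> and \<open>{q, r}\<close> survive, so the two
    outer colours of each triangle differ, as \<open>rich_offers\<close> requires.\<close>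
  let ?V = "{v, b, c, u, w, q, r}" and ?S = "{v, u, w}"
  have outer: "b' \<notin> ?V" "c' \<notin> ?V"
  proof -
    have "b \<notin> nbrs E u" "b \<notin> nbrs E w" "c \<notin> nbrs E u" "c \<notin> nbrs E w" unfolding u N using dV by simp_all
    moreover have "b \<in> nbrs E b'" "c \<in> nbrs E c'" using adj_sym[OF e1(5)] adj_sym[OF e1(6)] by simp_all
    ultimately show "b' \<notin> ?V" "c' \<notin> ?V" using b'c' T1 unfolding cubic_triangle_def by auto
  qed
  have outer': "q' \<notin> ?V" "r' \<notin> ?V"
  proof -
    have "q \<notin> nbrs E u" "q \<notin> nbrs E v" "r \<notin> nbrs E u" "r \<notin> nbrs E v"
      "q \<notin> nbrs E b" "q \<notin> nbrs E c" "r \<notin> nbrs E b" "r \<notin> nbrs E c"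
      unfolding u N using dV b'c' by auto
    moreover have "q \<in> nbrs E q'" "r \<in> nbrs E r'" using adj_sym[OF e2(5)] adj_sym[OF e2(6)] by simp_all
    ultimately show "q' \<notin> ?V" "r' \<notin> ?V" using T2 unfolding cubic_triangle_def by auto
  qed
  show False
  proof (rule reducible[of u v ?S ?V])
    show "y \<in> ?V" if "x \<in> ?S" "{x, y} \<in> E" for x y
    proof -
      have "y \<in> nbrs E x" using that(2) by simp
      moreover from that(1) have "nbrs E x \<subseteq> ?V" by (elim insertE emptyE) (simp_all add: N u)
      ultimately show ?thesis by blast
    qed
  next
    fix \<phi> :: "'a set \<Rightarrow> colour" assume \<phi>: "strong (delete E ?S) \<phi>"
    have x: "\<phi> {b, b'} \<noteq> \<phi> {c, c'}" "\<phi> {q, q'} \<noteq> \<phi> {r, r'}"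
      using strong_distance2[OF \<phi>, of b c b' c'] strong_distance2[OF \<phi>, of q r q' r'] e1 e2 dV outer outer'
      by (auto simp: delete_iff)
    obtain B1 B2 where B: "\<And>z. {b', z} \<in> E \<Longrightarrow> z \<noteq> b \<Longrightarrow> \<phi> {b', z} \<in> {B1, B2}"
      using far_colours_edge[OF e1(5), of \<phi>] by blast
    obtain C1 C2 where C: "\<And>z. {c', z} \<in> E \<Longrightarrow> z \<noteq> c \<Longrightarrow> \<phi> {c', z} \<in> {C1, C2}"
      using far_colours_edge[OF e1(6), of \<phi>] by blast
    obtain Q1 Q2 where Q: "\<And>z. {q', z} \<in> E \<Longrightarrow> z \<noteq> q \<Longrightarrow> \<phi> {q', z} \<in> {Q1, Q2}"
      using far_colours_edge[OF e2(5), of \<phi>] by blast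
    obtain R1 R2 where R: "\<And>z. {r', z} \<in> E \<Longrightarrow> z \<noteq> r \<Longrightarrow> \<phi> {r', z} \<in> {R1, R2}"
      using far_colours_edge[OF e2(6), of \<phi>] by blast
    obtain y y' where yy: "y \<noteq> y'" "offers (\<phi> {b, b'}) B1 B2 (\<phi> {c, c'}) C1 C2 y y'"
      "offers (\<phi> {q, q'}) Q1 Q2 (\<phi> {r, r'}) R1 R2 y' y"
      using rich_pair[OF rich_offers[OF x(1)] rich_offers[OF x(2)]] by blast
    obtain ta tb tc where t: "port_colours (\<phi> {b, b'}) B1 B2 (\<phi> {c, c'}) C1 C2 y ta tb tc" "y' \<notin> {tb, tc}"
      using yy(2) unfolding offers_def by blast
    obtain ta' tb' tc' where t': "port_colours (\<phi> {q, q'}) Q1 Q2 (\<phi> {r, r'}) R1 R2 y' ta' tb' tc'" "y \<notin> {tb', tc'}"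
      using yy(3) unfolding offers_def by blast
    define \<psi> where "\<psi> = \<phi>({v, b} := tc, {b, c} := ta, {v, c} := tb, {v, u} := y,
      {w, q} := tc', {q, r} := ta', {w, r} := tb', {w, u} := y')"
    have val: "\<psi> {v, b} = tc" "\<psi> {b, c} = ta" "\<psi> {v, c} = tb" "\<psi> {v, u} = y"
      "\<psi> {w, q} = tc'" "\<psi> {q, r} = ta'" "\<psi> {w, r} = tb'" "\<psi> {w, u} = y'"
      using dV by (simp_all add: \<psi>_def doubleton_eq_iff)
    have old: "\<psi> e = \<phi> e" if "\<not> e \<subseteq> ?V" for e using that by (auto simp: \<psi>_def)
    have o: "\<psi> {b, b'} = \<phi> {b, b'}" "\<psi> {c, c'} = \<phi> {c, c'}" "\<psi> {q, q'} = \<phi> {q, q'}" "\<psi> {r, r'} = \<phi> {r, r'}"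
      "\<psi> {b', z} = \<phi> {b', z}" "\<psi> {c', z} = \<phi> {c', z}" "\<psi> {q', z} = \<phi> {q', z}" "\<psi> {r', z} = \<phi> {r', z}" for z
      using outer outer' by (auto intro!: old)
    have "proper_at E \<psi> s" if "s \<in> ?V" for s
    proof (rule subdivision_proper[OF T1 T2 u _ _ _ _ _ _ _ _ _ that])
      show "distinct [\<psi> {v, b}, \<psi> {b, c}, \<psi> {v, c}, \<psi> {v, u}, \<psi> {b, b'}, \<psi> {c, c'}]"
        using t(1) unfolding val o port_colours_def by auto
      show "distinct [\<psi> {w, q}, \<psi> {q, r}, \<psi> {w, r}, \<psi> {w, u}, \<psi> {q, q'}, \<psi> {r, r'}]"
        using t'(1) unfolding val o port_colours_def by auto
      show "\<psi> {v, u} \<noteq> \<psi> {w, u}" "\<psi> {w, u} \<notin> {\<psi> {v, b}, \<psi> {v, c}}" "\<psi> {v, u} \<notin> {\<psi> {w, q}, \<psi> {w, r}}"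
        using yy(1) t(2) t'(2) unfolding val by auto
      show "\<psi> {b', z} \<notin> {\<psi> {v, b}, \<psi> {b, c}}" if "{b', z} \<in> E" "z \<noteq> b" for z
        using B[OF that] t(1) unfolding val o port_colours_def by auto
      show "\<psi> {c', z} \<notin> {\<psi> {v, c}, \<psi> {b, c}}" if "{c', z} \<in> E" "z \<noteq> c" for z
        using C[OF that] t(1) unfolding val o port_colours_def by auto
      show "\<psi> {q', z} \<notin> {\<psi> {w, q}, \<psi> {q, r}}" if "{q', z} \<in> E" "z \<noteq> q" for z
        using Q[OF that] t'(1) unfolding val o port_colours_def by auto
      show "\<psi> {r', z} \<notin> {\<psi> {w, r}, \<psi> {q, r}}" if "{r', z} \<in> E" "z \<noteq> r" for z
        using R[OF that] t'(1) unfolding val o port_colours_def by auto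
    qed
    then show "\<exists>\<psi>. (\<forall>e\<in>E. \<not> e \<subseteq> ?V \<longrightarrow> \<psi> e = \<phi> e) \<and> (\<forall>s\<in>?V. proper_at E \<psi> s)"
      using old by (intro exI[of _ \<psi>]) blast
  qed (use e in auto)
qed


section \<open>Cubic structure and three pairwise joined triangles\<close>

lemma degree_3:
  assumes "{u, w} \<in> E"
  obtains p q where "nbrs E u = {w, p, q}" "distinct [w, p, q]"
proof -
  obtain p where p: "p \<noteq> w" "{u, p} \<in> E" using no_pendant[OF assms] by blast
  have "\<not> nbrs E u \<subseteq> {w, p}"
  proof
    assume "nbrs E u \<subseteq> {w, p}"
    then have "nbrs E u = {w, p}" using assms p by auto
    then show False using no_degree_2 p by blast
  qed
  then obtain q where q: "{u, q} \<in> E" "q \<noteq> w" "q \<noteq> p" by (metis insertCI nbrs_iff subsetI)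
  have "nbrs E u = {w, p, q}" by (rule nbrs_eq) (use assms p q in auto)
  then show ?thesis using that p q by auto
qed

lemma obtain_triangle:
  assumes "{u, w} \<in> E"
  obtains b c u' b' c' where "cubic_triangle E u b c u' b' c'"
proof -
  obtain p q where N: "nbrs E u = {w, p, q}" "distinct [w, p, q]" using degree_3[OF assms] .
  then have e: "{u, w} \<in> E" "{u, p} \<in> E" "{u, q} \<in> E" by (auto simp flip: nbrs_iff)
  from claw[OF e N(2)] obtain b c where bc: "{u, b} \<in> E" "{b, c} \<in> E" "{u, c} \<in> E" using e by blast
  obtain u' b' c' where "cubic_triangle E u b c u' b' c'" using obtain_cubic_triangle[OF bc] .
  then show ?thesis by (rule that)
qed

lemma outer_triangle:
  assumes T: "cubic_triangle E a b c a' b' c'"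
  obtains p q p' q' where "cubic_triangle E a' p q a p' q'" "{a', p, q} \<inter> {a, b, c} = {}"
proof -
  note e = cubic_triangle_edges[OF T]
  obtain p q r p' q' where T': "cubic_triangle E a' p q r p' q'" using obtain_triangle[OF adj_sym[OF e(4)]] .
  have a': "a' \<notin> {a, b, c}" using T unfolding cubic_triangle_def by auto
  then have "{a, b, c} \<noteq> {a', p, q}" by auto
  then have dis: "{a, b, c} \<inter> {a', p, q} = {}" by (rule triangles_disjoint[OF T T'])
  have "a = r" by (rule cubic_triangle_unique(1)[OF T' adj_sym[OF e(4)]]) (use dis in auto)
  then show ?thesis using that T' dis by blast
qed

text \<open>The corners \<open>a1, a2, a3\<close> are pairwise non-adjacent by
  \<open>no_double_link\<close>, so their outer edges leave the configuration. All three edges at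
  each \<open>xi\<close> survive the deletion and are mutually adjacent, which gives the two
  distinct far colours, different from the outer colour, that \<open>cycle_colours\<close>
  assumes.\<close>

lemma no_three_cycle:
  assumes T1: "cubic_triangle E a1 b1 c1 x1 c3 b2" and T2: "cubic_triangle E a2 b2 c2 x2 c1 b3"
    and T3: "cubic_triangle E a3 b3 c3 x3 c2 b1" and d: "distinct [a1, b1, c1, a2, b2, c2, a3, b3, c3]"
  shows False
proof -
  have d': "distinct [c3, b3, a3, c2, b2, a2, c1, b1, a1]" using d by auto
  note e1 = cubic_triangle_edges[OF T1] and e2 = cubic_triangle_edges[OF T2] and e3 = cubic_triangle_edges[OF T3]
  note e = e1 e2 e3 e1[THEN adj_sym] e2[THEN adj_sym] e3[THEN adj_sym]
  have N: "nbrs E a1 = {b1, c1, x1}" "nbrs E b1 = {a1, c1, c3}" "nbrs E c1 = {a1, b1, b2}"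
    "nbrs E a2 = {b2, c2, x2}" "nbrs E b2 = {a2, c2, c1}" "nbrs E c2 = {a2, b2, b3}"
    "nbrs E a3 = {b3, c3, x3}" "nbrs E b3 = {a3, c3, c2}" "nbrs E c3 = {a3, b3, b1}"
    using T1 T2 T3 unfolding cubic_triangle_def by simp_all
  have aa: "{a1, a2} \<notin> E" "{a2, a3} \<notin> E" "{a1, a3} \<notin> E"
  proof -
    show "{a1, a2} \<notin> E" using no_double_link[of b1 a1 c1 c2 a2 b2] d d' e by auto
    show "{a2, a3} \<notin> E" using no_double_link[of b2 a2 c2 c3 a3 b3] d d' e by auto
    show "{a1, a3} \<notin> E" using no_double_link[of c1 a1 b1 b3 a3 c3] d d' e by auto
  qed
  let ?V = "{a1, b1, c1, a2, b2, c2, a3, b3, c3}" and ?S = "{b1, c1, b2, c2, b3, c3}"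
  have S: "nbrs E s \<subseteq> ?V" if "s \<in> ?S" for s using that by (elim insertE emptyE) (simp_all add: N)
  have x1: "x1 \<notin> ?V"
  proof -
    have "a1 \<notin> nbrs E b2" "a1 \<notin> nbrs E c2" "a1 \<notin> nbrs E b3" "a1 \<notin> nbrs E c3" unfolding N using d by simp_all
    moreover have "a1 \<in> nbrs E x1" using adj_sym[OF e1(4)] by simp
    moreover have "x1 \<noteq> a2" "x1 \<noteq> a3" using e1(4) aa by auto
    moreover have "x1 \<notin> {a1, b1, c1}" using T1 unfolding cubic_triangle_def by auto
    ultimately show ?thesis by (metis insert_iff singletonD)
  qed
  have x2: "x2 \<notin> ?V"
  proof -
    have "a2 \<notin> nbrs E b1" "a2 \<notin> nbrs E c1" "a2 \<notin> nbrs E b3" "a2 \<notin> nbrs E c3" unfolding N using d d' by simp_all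
    moreover have "a2 \<in> nbrs E x2" using adj_sym[OF e2(4)] by simp
    moreover have "x2 \<noteq> a1" "x2 \<noteq> a3" using e2(4) adj_sym[OF e2(4)] aa by auto
    moreover have "x2 \<notin> {a2, b2, c2}" using T2 unfolding cubic_triangle_def by auto
    ultimately show ?thesis by (metis insert_iff singletonD)
  qed
  have x3: "x3 \<notin> ?V"
  proof -
    have "a3 \<notin> nbrs E b1" "a3 \<notin> nbrs E c1" "a3 \<notin> nbrs E b2" "a3 \<notin> nbrs E c2" unfolding N using d d' by simp_all
    moreover have "a3 \<in> nbrs E x3" using adj_sym[OF e3(4)] by simp
    moreover have "x3 \<noteq> a1" "x3 \<noteq> a2" using adj_sym[OF e3(4)] aa by auto
    moreover have "x3 \<notin> {a3, b3, c3}" using T3 unfolding cubic_triangle_def by auto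
    ultimately show ?thesis by (metis insert_iff singletonD)
  qed
  show False
  proof (rule reducible[of b1 c1 ?S ?V])
    show "w \<in> ?V" if "u \<in> ?S" "{u, w} \<in> E" for u w using nbrs_mem[OF S[OF that(1)] that(2)] .
  next
    fix \<phi> :: "'a set \<Rightarrow> colour" assume \<phi>: "strong (delete E ?S) \<phi>"
    have far: "\<exists>A A'. (\<forall>z. {x, z} \<in> E \<longrightarrow> z \<noteq> a \<longrightarrow> \<phi> {x, z} \<in> {A, A'}) \<and> A \<noteq> A' \<and> \<phi> {a, x} \<notin> {A, A'}"
      if ax: "{a, x} \<in> E" "x \<notin> ?V" for a x
    proof -
      obtain p q where pq: "nbrs E x = {a, p, q}" "distinct [a, p, q]" using degree_3[OF adj_sym[OF ax(1)]] .
      have e: "{x, a} \<in> E" "{x, p} \<in> E" "{x, q} \<in> E" using pq(1) by (auto simp flip: nbrs_iff)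
      have "{x, z} \<in> delete E ?S" if "{x, z} \<in> E" for z
      proof -
        have "x \<notin> ?S" using ax(2) by auto
        moreover have "z \<notin> ?S" using nbrs_mem[OF S adj_sym[OF that]] ax(2) by blast
        ultimately show ?thesis using that by (simp add: delete_iff)
      qed
      then have "\<phi> {x, p} \<noteq> \<phi> {x, q}" "\<phi> {x, a} \<noteq> \<phi> {x, p}" "\<phi> {x, a} \<noteq> \<phi> {x, q}"
        using strong_adjacent[OF \<phi>] e pq(2) by auto
      moreover have "{a, x} = {x, a}" by (rule insert_commute)
      moreover have "\<phi> {x, z} \<in> {\<phi> {x, p}, \<phi> {x, q}}" if "{x, z} \<in> E" "z \<noteq> a" for z
      proof -
        have "z \<in> nbrs E x" using that(1) by simp
        then show ?thesis using that(2) unfolding pq(1) by auto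
      qed
      ultimately have "(\<forall>z. {x, z} \<in> E \<longrightarrow> z \<noteq> a \<longrightarrow> \<phi> {x, z} \<in> {\<phi> {x, p}, \<phi> {x, q}}) \<and>
        \<phi> {x, p} \<noteq> \<phi> {x, q} \<and> \<phi> {a, x} \<notin> {\<phi> {x, p}, \<phi> {x, q}}" by simp
      then show ?thesis by blast
    qed
    obtain A1 A1' where A1: "\<And>z. {x1, z} \<in> E \<Longrightarrow> z \<noteq> a1 \<Longrightarrow> \<phi> {x1, z} \<in> {A1, A1'}" "A1 \<noteq> A1'" "\<phi> {a1, x1} \<notin> {A1, A1'}"
      using far[OF e1(4) x1] by blast
    obtain A2 A2' where A2: "\<And>z. {x2, z} \<in> E \<Longrightarrow> z \<noteq> a2 \<Longrightarrow> \<phi> {x2, z} \<in> {A2, A2'}" "A2 \<noteq> A2'" "\<phi> {a2, x2} \<notin> {A2, A2'}"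
      using far[OF e2(4) x2] by blast
    obtain A3 A3' where A3: "\<And>z. {x3, z} \<in> E \<Longrightarrow> z \<noteq> a3 \<Longrightarrow> \<phi> {x3, z} \<in> {A3, A3'}" "A3 \<noteq> A3'" "\<phi> {a3, x3} \<notin> {A3, A3'}"
      using far[OF e3(4) x3] by blast
    obtain y12 y23 y31 m1 m2 m3 s1 r1 s2 r2 s3 r3 where
      "cycle_sol (\<phi> {a1, x1}) A1 A1' (\<phi> {a2, x2}) A2 A2' (\<phi> {a3, x3}) A3 A3' y12 y23 y31 m1 m2 m3 s1 r1 s2 r2 s3 r3"
      using cycle_colours[OF A1(2,3) A2(2,3) A3(2,3)] unfolding cycle_solvable_def by blast
    then have t: "distinct [\<phi> {a1, x1}, y31, y12, m1, s1, r1]" "distinct [\<phi> {a2, x2}, y12, y23, m2, s2, r2]"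
      "distinct [\<phi> {a3, x3}, y23, y31, m3, s3, r3]"
      "distinct [m1, r1, m2, s2]" "distinct [m2, r2, m3, s3]" "distinct [m3, r3, m1, s1]"
      "s1 \<notin> {A1, A1'}" "r1 \<notin> {A1, A1'}" "s2 \<notin> {A2, A2'}" "r2 \<notin> {A2, A2'}" "s3 \<notin> {A3, A3'}" "r3 \<notin> {A3, A3'}"
      unfolding cycle_sol_def by blast+
    define \<psi> where "\<psi> = \<phi>({a1, b1} := s1, {a1, c1} := r1, {b1, c1} := m1, {a2, b2} := s2, {a2, c2} := r2, {b2, c2} := m2,
      {a3, b3} := s3, {a3, c3} := r3, {b3, c3} := m3, {c1, b2} := y12, {c2, b3} := y23, {c3, b1} := y31)"
    have v: "\<psi> {a1, b1} = s1" "\<psi> {a1, c1} = r1" "\<psi> {b1, c1} = m1" "\<psi> {a2, b2} = s2" "\<psi> {a2, c2} = r2" "\<psi> {b2, c2} = m2"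
      "\<psi> {a3, b3} = s3" "\<psi> {a3, c3} = r3" "\<psi> {b3, c3} = m3" "\<psi> {c1, b2} = y12" "\<psi> {c2, b3} = y23" "\<psi> {c3, b1} = y31"
      unfolding \<psi>_def using d d' by (simp_all add: doubleton_eq_iff)
    have c: "{b1, a1} = {a1, b1}" "{c1, a1} = {a1, c1}" "{c1, b1} = {b1, c1}" "{b2, a2} = {a2, b2}" "{c2, a2} = {a2, c2}"
      "{c2, b2} = {b2, c2}" "{b3, a3} = {a3, b3}" "{c3, a3} = {a3, c3}" "{c3, b3} = {b3, c3}"
      "{b2, c1} = {c1, b2}" "{b3, c2} = {c2, b3}" "{b1, c3} = {c3, b1}"
      by (rule insert_commute)+
    have old: "\<psi> e = \<phi> e" if "\<not> e \<subseteq> ?V" for e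
      unfolding \<psi>_def by (simp del: fun_upd_apply add: fun_upd_outside[OF that])
    have o: "\<psi> {a1, x1} = \<phi> {a1, x1}" "\<psi> {a2, x2} = \<phi> {a2, x2}" "\<psi> {a3, x3} = \<phi> {a3, x3}"
      "\<psi> {x1, z} = \<phi> {x1, z}" "\<psi> {x2, z} = \<phi> {x2, z}" "\<psi> {x3, z} = \<phi> {x3, z}" for z
      by (rule old, use x1 x2 x3 in blast)+
    have near: "\<psi> {w, z} \<in> {\<psi> {w, p}, \<psi> {w, q}}" if "nbrs E w = {p, q, r}" "{w, z} \<in> E" "z \<noteq> r" for w p q r z
    proof -
      have "z \<in> nbrs E w" using that(2) by simp
      then show ?thesis using that(1,3) by auto
    qed
    have "proper_at E \<psi> u" if "u \<in> {a1, b1, c1}" for u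
    proof (rule proper_at_triangle[OF T1 _ _ _ _ that])
      show "distinct [\<psi> {a1, b1}, \<psi> {b1, c1}, \<psi> {a1, c1}, \<psi> {a1, x1}, \<psi> {b1, c3}, \<psi> {c1, b2}]"
        using t(1) unfolding c v o by auto
      show "\<psi> {x1, z} \<notin> {\<psi> {a1, b1}, \<psi> {a1, c1}}" if "{x1, z} \<in> E" "z \<noteq> a1" for z
        using A1(1)[OF that] t(7,8) unfolding v o by auto
      show "\<psi> {c3, z} \<notin> {\<psi> {a1, b1}, \<psi> {b1, c1}}" if "{c3, z} \<in> E" "z \<noteq> b1" for z
        using near[OF N(9) that] t(6) unfolding c v by auto
      show "\<psi> {b2, z} \<notin> {\<psi> {a1, c1}, \<psi> {b1, c1}}" if "{b2, z} \<in> E" "z \<noteq> c1" for z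
        using near[OF N(5) that] t(4) unfolding c v by auto
    qed
    moreover have "proper_at E \<psi> u" if "u \<in> {a2, b2, c2}" for u
    proof (rule proper_at_triangle[OF T2 _ _ _ _ that])
      show "distinct [\<psi> {a2, b2}, \<psi> {b2, c2}, \<psi> {a2, c2}, \<psi> {a2, x2}, \<psi> {b2, c1}, \<psi> {c2, b3}]"
        using t(2) unfolding c v o by auto
      show "\<psi> {x2, z} \<notin> {\<psi> {a2, b2}, \<psi> {a2, c2}}" if "{x2, z} \<in> E" "z \<noteq> a2" for z
        using A2(1)[OF that] t(9,10) unfolding v o by auto
      show "\<psi> {c1, z} \<notin> {\<psi> {a2, b2}, \<psi> {b2, c2}}" if "{c1, z} \<in> E" "z \<noteq> b2" for z
        using near[OF N(3) that] t(4) unfolding c v by auto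
      show "\<psi> {b3, z} \<notin> {\<psi> {a2, c2}, \<psi> {b2, c2}}" if "{b3, z} \<in> E" "z \<noteq> c2" for z
        using near[OF N(8) that] t(5) unfolding c v by auto
    qed
    moreover have "proper_at E \<psi> u" if "u \<in> {a3, b3, c3}" for u
    proof (rule proper_at_triangle[OF T3 _ _ _ _ that])
      show "distinct [\<psi> {a3, b3}, \<psi> {b3, c3}, \<psi> {a3, c3}, \<psi> {a3, x3}, \<psi> {b3, c2}, \<psi> {c3, b1}]"
        using t(3) unfolding c v o by auto
      show "\<psi> {x3, z} \<notin> {\<psi> {a3, b3}, \<psi> {a3, c3}}" if "{x3, z} \<in> E" "z \<noteq> a3" for z
        using A3(1)[OF that] t(11,12) unfolding v o by auto
      show "\<psi> {c2, z} \<notin> {\<psi> {a3, b3}, \<psi> {b3, c3}}" if "{c2, z} \<in> E" "z \<noteq> b3" for z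
        using near[OF N(6) that] t(5) unfolding c v by auto
      show "\<psi> {b1, z} \<notin> {\<psi> {a3, c3}, \<psi> {b3, c3}}" if "{b1, z} \<in> E" "z \<noteq> c3" for z
        using near[OF N(2) that] t(6) unfolding c v by auto
    qed
    ultimately show "\<exists>\<psi>. (\<forall>e\<in>E. \<not> e \<subseteq> ?V \<longrightarrow> \<psi> e = \<phi> e) \<and> (\<forall>u\<in>?V. proper_at E \<psi> u)"
      using old by (intro exI[of _ \<psi>]) blast
  qed (use e1 in auto)
qed

text \<open>The form in which \<open>no_three_cycle\<close> is applied: the triangles at two outer
  neighbours of a triangle are not joined to each other.\<close>

lemma no_link_triangle:
  assumes T: "cubic_triangle E a b c a' b' c'" and d: "distinct [b', x, x', c', y, y']"
    and X: "{b', x} \<in> E" "{x, x'} \<in> E" "{b', x'} \<in> E" and Y: "{c', y} \<in> E" "{y, y'} \<in> E" "{c', y'} \<in> E"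
    and xy: "{x, y} \<in> E"
  shows False
proof -
  note e = cubic_triangle_edges[OF T]
  have dT: "distinct [a, b, c]" "b' \<notin> {a, b, c}" "c' \<notin> {a, b, c}" using T unfolding cubic_triangle_def by auto
  obtain u v w where TX: "cubic_triangle E x' b' x u v w" by (rule obtain_cubic_triangle[of x' b' x]) (use X adj_sym in auto)
  obtain p q r where TY: "cubic_triangle E y' y c' p q r" by (rule obtain_cubic_triangle[of y' y c']) (use Y adj_sym in auto)
  have "{a, b, c} \<inter> {x', b', x} = {}" by (rule triangles_disjoint[OF T TX]) (use dT in auto)
  moreover have "{a, b, c} \<inter> {y', y, c'} = {}" by (rule triangles_disjoint[OF T TY]) (use dT in auto)
  ultimately have dis: "{a, b, c} \<inter> {x', b', x} = {}" "{a, b, c} \<inter> {y', y, c'} = {}" .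
  have "b = v" by (rule cubic_triangle_unique(2)[OF TX adj_sym[OF e(5)]]) (use dis in auto)
  moreover have "y = w" by (rule cubic_triangle_unique(3)[OF TX xy]) (use d in auto)
  moreover have "x = q" by (rule cubic_triangle_unique(2)[OF TY adj_sym[OF xy]]) (use d in auto)
  moreover have "c = r" by (rule cubic_triangle_unique(3)[OF TY adj_sym[OF e(6)]]) (use dis in auto)
  ultimately have TX: "cubic_triangle E x' b' x u b y" and TY: "cubic_triangle E y' y c' p x c" using TX TY by simp_all
  have "distinct [a, c, b, x', b', x, y', y, c']" using d dT(1) dis by auto
  then show False by (rule no_three_cycle[OF cubic_triangle_swap[OF T] TX TY])
qed

end


section \<open>Moving colourings and adding edges\<close>

text \<open>A homomorphism that is injective on each neighbourhood keeps adjacent edges distinct and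
  maps conflicts across an edge to such conflicts, so colourings can be pulled back along
  it.\<close>

lemma strong_hom:
  assumes G: "strong G \<phi>" and edge: "\<And>x y. {x, y} \<in> F \<Longrightarrow> {\<theta> x, \<theta> y} \<in> G"
    and inj: "\<And>u v w. {u, v} \<in> F \<Longrightarrow> {u, w} \<in> F \<Longrightarrow> v \<noteq> w \<Longrightarrow> \<theta> v \<noteq> \<theta> w"
  shows "strong F (\<lambda>e. \<phi> (\<theta> ` e))"
  unfolding strong_def proper_at_def
proof (intro conjI allI impI)
  fix u v w assume h: "{u, v} \<in> F" "{u, w} \<in> F" "v \<noteq> w"
  then show "\<phi> (\<theta> ` {u, v}) \<noteq> \<phi> (\<theta> ` {u, w})"
    using strong_adjacent[OF G edge[OF h(1)] edge[OF h(2)] inj[OF h]] by simp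
next
  fix u v w z assume h: "{u, v} \<in> F" "{u, w} \<in> F" "{v, z} \<in> F" "w \<noteq> v" "z \<noteq> u"
  have vu: "{v, u} \<in> F" using h(1) by (simp add: insert_commute)
  show "\<phi> (\<theta> ` {u, w}) \<noteq> \<phi> (\<theta> ` {v, z})"
    using strong_distance2[OF G edge[OF h(1)] edge[OF h(2)] edge[OF h(3)]] inj[OF h(2,1,4)] inj[OF h(3) vu h(5)]
    by simp
qed

text \<open>\<open>admissible\<close> without the prism clause, which is checked only after both new
  edges have been added.\<close>

definition claw_free_edges :: "'a set set \<Rightarrow> bool" where
  "claw_free_edges G \<longleftrightarrow> finite G \<and> (\<forall>e\<in>G. card e = 2) \<and> (\<forall>v. card (nbrs G v) \<le> 3) \<and>
     (\<forall>v x y z. {v, x} \<in> G \<longrightarrow> {v, y} \<in> G \<longrightarrow> {v, z} \<in> G \<longrightarrow> distinct [x, y, z] \<longrightarrow>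
        {x, y} \<in> G \<or> {y, z} \<in> G \<or> {x, z} \<in> G)"

text \<open>Each endpoint has exactly two neighbours before the insertion, and these are adjacent.
  The degree rises to 3, and the old adjacent pair prevents a claw at the endpoint.\<close>

lemma claw_free_insert:
  assumes G: "claw_free_edges G" and pq: "p \<noteq> q"
    and p: "nbrs G p = {m, n}" "{m, n} \<in> G" and q: "nbrs G q = {m', n'}" "{m', n'} \<in> G"
  shows "claw_free_edges (insert {p, q} G)"
proof -
  let ?H = "insert {p, q} G"
  have N: "nbrs ?H v = (if v = p then {m, n, q} else if v = q then {m', n', p} else nbrs G v)" for v
  proof -
    have "nbrs ?H v = nbrs G v \<union> (if v = p then {q} else {}) \<union> (if v = q then {p} else {})"
      by (auto simp: doubleton_eq_iff)
    then show ?thesis using p(1) q(1) pq by auto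
  qed
  have card: "card {x, y, z} \<le> 3" for x y z :: 'a
    using card_length[of "[x, y, z]"] by simp
  have "card (nbrs ?H v) \<le> 3" for v
    using G card unfolding N claw_free_edges_def by (cases "v = p"; cases "v = q") (simp_all del: card_insert_disjoint)
  moreover have "{x, y} \<in> ?H \<or> {y, z} \<in> ?H \<or> {x, z} \<in> ?H"
    if h: "{v, x} \<in> ?H" "{v, y} \<in> ?H" "{v, z} \<in> ?H" "distinct [x, y, z]" for v x y z
  proof -
    have two: "{x, y} \<in> ?H \<or> {y, z} \<in> ?H \<or> {x, z} \<in> ?H"
      if "x \<in> {i, j, k}" "y \<in> {i, j, k}" "z \<in> {i, j, k}" "{i, j} \<in> G" for i j k
    proof -
      have "{i, j} = {x, y} \<or> {i, j} = {y, z} \<or> {i, j} = {x, z}"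
        using that(1-3) h(4) by (elim insertE emptyE) (simp_all add: doubleton_eq_iff)
      then show ?thesis using that(4) by (metis insertI2)
    qed
    have mem: "x \<in> nbrs ?H v" "y \<in> nbrs ?H v" "z \<in> nbrs ?H v" using h by simp_all
    show ?thesis
    proof (cases "v = p \<or> v = q")
      case True
      then show ?thesis using mem two[of m n q] two[of m' n' p] p(2) q(2) unfolding N by (auto split: if_splits)
    next
      case False
      then have "{v, x} \<in> G" "{v, y} \<in> G" "{v, z} \<in> G" using mem unfolding N by simp_all
      then show ?thesis using G h(4) unfolding claw_free_edges_def by blast
    qed
  qed
  moreover have "finite ?H" "\<forall>e\<in>?H. card e = 2" using G pq unfolding claw_free_edges_def by auto
  ultimately show ?thesis unfolding claw_free_edges_def by blast
qed

text \<open>\<open>g\<close> is an outer colour of the triangle and thus forbidden on its edges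
  anyway. If it occurs among the far colours \<open>B1\<close>, \<open>B2\<close>, it may be
  exchanged there for a fresh colour, giving the pair \<open>D1, D2\<close>.\<close>

lemma widen_port_colours:
  fixes z g :: colour
  assumes d: "distinct [z, B1, B2, C1, C2]" and g: "g \<notin> {z, C1, C2}"
  obtains D1 D2 t where "distinct [z, g, D1, D2, C1, C2, t]" "{B1, B2} \<subseteq> {g, D1, D2}"
proof -
  obtain D1 D2 where D: "distinct [z, g, D1, D2, C1, C2]" "{B1, B2} \<subseteq> {g, D1, D2}"
  proof -
    consider "g \<notin> {B1, B2}" | "g = B1" | "g = B2" by blast
    then show ?thesis
    proof cases
      case 1
      then show ?thesis using that[of B1 B2] d g by auto
    next
      case 2
      obtain k where "avoids k [z, g, B2, C1, C2]" by (erule fresh_colour[rotated]) simp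
      then show ?thesis using that[of k B2] d g 2 by auto
    next
      case 3
      obtain k where "avoids k [z, g, B1, C1, C2]" by (erule fresh_colour[rotated]) simp
      then show ?thesis using that[of k B1] d g 3 by auto
    qed
  qed
  obtain t where "avoids t [z, g, D1, D2, C1, C2]" by (erule fresh_colour[rotated]) simp
  then show ?thesis using that[of D1 D2 t] D by auto
qed

text \<open>An end triangle with linking corner \<open>a\<close>: \<open>z\<close> and
  \<open>g\<close> are the outer colours at \<open>b\<close> and \<open>c\<close>, with far pairs
  \<open>B\<close> and \<open>C\<close>. The edge \<open>ac\<close> sees \<open>C\<close> and takes
  \<open>p\<close> from the widened pair; \<open>ab\<close> sees \<open>B\<close> and takes
  \<open>q\<close> from \<open>C\<close>; \<open>t\<close>, outside everything listed, goes on
  \<open>bc\<close>. The two pairs left for \<open>p\<close>, \<open>q\<close> and the link colour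
  \<open>y\<close> are the input format of \<open>path_colours\<close>.\<close>

lemma end_triangle_choices:
  fixes z g :: colour
  assumes d: "distinct [z, B1, B2, C1, C2]" and g: "g \<notin> {z, C1, C2}"
  obtains D1 D2 t where "distinct [D1, D2, C1, C2]"
    "\<And>y p q. p \<in> {D1, D2} \<Longrightarrow> q \<in> {C1, C2} \<Longrightarrow> y \<in> {D1, D2} \<union> {C1, C2} \<Longrightarrow> y \<noteq> p \<Longrightarrow> y \<noteq> q \<Longrightarrow>
      distinct [q, t, p, y, z, g] \<and> {q, t} \<inter> {B1, B2} = {} \<and> {p, t} \<inter> {C1, C2} = {}"
proof -
  obtain D1 D2 t where D: "distinct [z, g, D1, D2, C1, C2, t]" "{B1, B2} \<subseteq> {g, D1, D2}"
    using widen_port_colours[OF d g] .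
  show ?thesis
  proof (rule that[of D1 D2 t])
    show "distinct [D1, D2, C1, C2]" using D(1) by auto
    fix y p q assume h: "p \<in> {D1, D2}" "q \<in> {C1, C2}" "y \<in> {D1, D2} \<union> {C1, C2}" "y \<noteq> p" "y \<noteq> q"
    have "q \<notin> {g, D1, D2}" "t \<notin> {g, D1, D2}" "p \<notin> {C1, C2}" "t \<notin> {C1, C2}" using D(1) h(1,2) by auto
    then have "{q, t} \<inter> {B1, B2} = {}" "{p, t} \<inter> {C1, C2} = {}" using D(2) by auto
    moreover have "distinct [q, t, p, y, z, g]"
    proof -
      have "y \<notin> {z, g, t}" "p \<notin> {z, g, t}" "q \<notin> {z, g, t, p}" "t \<notin> {z, g}" "z \<noteq> g" using h(1-3) D(1) by auto
      then show ?thesis using h(4,5) by auto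
    qed
    ultimately show "distinct [q, t, p, y, z, g] \<and> {q, t} \<inter> {B1, B2} = {} \<and> {p, t} \<inter> {C1, C2} = {}" by blast
  qed
qed


section \<open>The path of three triangles and the final contradiction\<close>

context critical
begin

text \<open>Any triangle can be the middle one. Equal end triangles, or an edge from the free corner
  \<open>a2\<close> to an end triangle, would give a double link; an edge between the ends would
  give three pairwise joined triangles.\<close>

lemma triangle_path:
  assumes "E \<noteq> {}"
  obtains a1 b1 c1 p1 q1 a2 b2 c2 x2 a3 b3 c3 p3 q3 where
    "cubic_triangle E a1 b1 c1 b2 p1 q1" "cubic_triangle E a2 b2 c2 x2 a1 a3" "cubic_triangle E a3 b3 c3 c2 p3 q3"
    "distinct [a1, b1, c1, a2, b2, c2, a3, b3, c3]"
    "{p1, q1, p3, q3, x2} \<inter> {a1, b1, c1, a2, b2, c2, a3, b3, c3} = {}"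
proof -
  obtain e where "e \<in> E" using assms by blast
  then obtain a2 w where "{a2, w} \<in> E" using admissible_edgeE[OF adm] by metis
  then obtain b2 c2 x2 a1 a3 where T2: "cubic_triangle E a2 b2 c2 x2 a1 a3" by (rule obtain_triangle)
  have T2b: "cubic_triangle E b2 c2 a2 a1 a3 x2" by (rule cubic_triangle_rotate[OF T2])
  have T2c: "cubic_triangle E c2 a2 b2 a3 x2 a1" by (rule cubic_triangle_rotate[OF T2b])
  obtain b1 c1 p1 q1 where T1: "cubic_triangle E a1 b1 c1 b2 p1 q1" and dis12: "{a1, b1, c1} \<inter> {b2, c2, a2} = {}"
    using outer_triangle[OF T2b] .
  obtain b3 c3 p3 q3 where T3: "cubic_triangle E a3 b3 c3 c2 p3 q3" and dis23: "{a3, b3, c3} \<inter> {c2, a2, b2} = {}"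
    using outer_triangle[OF T2c] .
  note e1 = cubic_triangle_edges[OF T1] and e2 = cubic_triangle_edges[OF T2] and e3 = cubic_triangle_edges[OF T3]
  note e = e1 e2 e3 e1[THEN adj_sym] e2[THEN adj_sym] e3[THEN adj_sym]
  have dT: "distinct [a1, b1, c1]" "distinct [a2, b2, c2]" "distinct [a3, b3, c3]"
    using T1 T2 T3 by (simp_all add: cubic_triangle_def)
  have "a3 \<notin> {a1, b1, c1}"
  proof
    assume "a3 \<in> {a1, b1, c1}"
    moreover have "a3 \<noteq> a1"
    proof
      assume "a3 = a1"
      then have "c2 \<in> nbrs E a1" using adj_sym[OF e2(6)] by simp
      then show False using T1 dis12 dT(2) unfolding cubic_triangle_def by auto
    qed
    ultimately consider "a3 = b1" | "a3 = c1" by blast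
    then show False
    proof cases
      case 1
      have "distinct [c1, a1, b1, a2, b2, c2]" using dT dis12 by auto
      then show False by (rule no_double_link) (use e 1 in auto)
    next
      case 2
      have "distinct [b1, a1, c1, a2, b2, c2]" using dT dis12 by auto
      then show False by (rule no_double_link) (use e 2 in auto)
    qed
  qed
  then have "{a1, b1, c1} \<noteq> {a3, b3, c3}" by auto
  then have dis13: "{a1, b1, c1} \<inter> {a3, b3, c3} = {}" by (rule triangles_disjoint[OF T1 T3])
  have d: "distinct [a1, b1, c1, a2, b2, c2, a3, b3, c3]" using dT dis12 dis23 dis13 by auto
  have d': "distinct [c3, b3, a3, c2, b2, a2, c1, b1, a1]" using d by auto
  have N: "nbrs E a1 = {b1, c1, b2}" "nbrs E b2 = {a2, c2, a1}" "nbrs E c2 = {a2, b2, a3}" "nbrs E a3 = {b3, c3, c2}"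
    using T1 T2 T3 unfolding cubic_triangle_def by simp_all
  have l13: "{s, t} \<notin> E" if si: "s \<in> {b1, c1}" and ti: "t \<in> {b3, c3}" for s t
  proof
    assume st: "{s, t} \<in> E"
    obtain s' where s': "{a1, s'} \<in> E" "{s, s'} \<in> E" "{a1, s} \<in> E" "s' \<in> {b1, c1}"
      using si e1 adj_sym[OF e1(2)] by blast
    obtain t' where t': "{a3, t'} \<in> E" "{t, t'} \<in> E" "{a3, t} \<in> E" "t' \<in> {b3, c3}"
      using ti e3 adj_sym[OF e3(2)] by blast
    have "s \<noteq> s'" "t \<noteq> t'" using s'(2) t'(2) no_loop by blast+
    then have "distinct [a1, s, s', a3, t, t']" using si ti s'(4) t'(4) d by auto
    then show False by (rule no_link_triangle[OF T2]) (use s' t' st in auto)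
  qed
  have l12: "{a2, s} \<notin> E" if si: "s \<in> {b1, c1}" for s
  proof
    assume st: "{a2, s} \<in> E"
    obtain s' where s': "{a1, s'} \<in> E" "{s, s'} \<in> E" "{a1, s} \<in> E" "s' \<in> {b1, c1}"
      using si e1 adj_sym[OF e1(2)] by blast
    have "s \<noteq> s'" using s' no_loop by blast
    then have "distinct [s', a1, s, c2, b2, a2]" using si s'(4) d by auto
    then show False by (rule no_double_link) (use s' e adj_sym[OF st] adj_sym[OF s'(1)] adj_sym[OF s'(2)] in auto)
  qed
  have l23: "{a2, s} \<notin> E" if si: "s \<in> {b3, c3}" for s
  proof
    assume st: "{a2, s} \<in> E"
    obtain s' where s': "{a3, s'} \<in> E" "{s, s'} \<in> E" "{a3, s} \<in> E" "s' \<in> {b3, c3}"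
      using si e3 adj_sym[OF e3(2)] by blast
    have "s \<noteq> s'" using s' no_loop by blast
    then have "distinct [s', a3, s, b2, c2, a2]" using si s'(4) d by auto
    then show False by (rule no_double_link) (use s' e adj_sym[OF st] adj_sym[OF s'(1)] adj_sym[OF s'(2)] in auto)
  qed
  let ?V = "{a1, b1, c1, a2, b2, c2, a3, b3, c3}"
  have out1: "w \<notin> ?V" if s: "s \<in> {b1, c1}" "{s, w} \<in> E" "w \<notin> {a1, b1, c1}" for s w
  proof -
    have "s \<notin> nbrs E b2" "s \<notin> nbrs E c2" "s \<notin> nbrs E a3" unfolding N using s(1) d d' by auto
    moreover have "s \<in> nbrs E w" using adj_sym[OF s(2)] by simp
    moreover have "w \<noteq> a2" using l12[OF s(1)] adj_sym[OF s(2)] by auto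
    moreover have "w \<noteq> b3" "w \<noteq> c3" using l13[OF s(1)] s(2) by auto
    ultimately show ?thesis using s(3) by (metis insert_iff singletonD)
  qed
  have out3: "w \<notin> ?V" if s: "s \<in> {b3, c3}" "{s, w} \<in> E" "w \<notin> {a3, b3, c3}" for s w
  proof -
    have "s \<notin> nbrs E b2" "s \<notin> nbrs E c2" "s \<notin> nbrs E a1" unfolding N using s(1) d d' by auto
    moreover have "s \<in> nbrs E w" using adj_sym[OF s(2)] by simp
    moreover have "w \<noteq> a2" using l23[OF s(1)] adj_sym[OF s(2)] by auto
    moreover have "w \<noteq> b1" "w \<noteq> c1" using l13[of _ s] s(1) adj_sym[OF s(2)] by auto
    ultimately show ?thesis using s(3) by (metis insert_iff singletonD)
  qed
  have "p1 \<notin> ?V" by (rule out1[of b1]) (use T1 e1 in \<open>auto simp: cubic_triangle_def\<close>)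
  moreover have "q1 \<notin> ?V" by (rule out1[of c1]) (use T1 e1 in \<open>auto simp: cubic_triangle_def\<close>)
  moreover have "p3 \<notin> ?V" by (rule out3[of b3]) (use T3 e3 in \<open>auto simp: cubic_triangle_def\<close>)
  moreover have "q3 \<notin> ?V" by (rule out3[of c3]) (use T3 e3 in \<open>auto simp: cubic_triangle_def\<close>)
  moreover have "x2 \<notin> ?V"
  proof -
    have "a2 \<notin> nbrs E a1" "a2 \<notin> nbrs E a3" unfolding N using d d' by auto
    moreover have "a2 \<in> nbrs E x2" using adj_sym[OF e2(4)] by simp
    moreover have "x2 \<notin> {b1, c1, b3, c3}" using l12 l23 e2(4) by auto
    moreover have "x2 \<notin> {a2, b2, c2}" using T2 unfolding cubic_triangle_def by auto
    ultimately show ?thesis by (metis insert_iff singletonD)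
  qed
  ultimately have "{p1, q1, p3, q3, x2} \<inter> ?V = {}" by blast
  then show ?thesis using that[OF T1 T2 T3 d] by blast
qed


text \<open>\<open>pendant_colours\<close> forbids at most five colours, which leaves room to avoid
  one prescribed colour \<open>k0\<close> as well.\<close>

lemma extend_pendant:
  fixes \<psi> :: "'a set \<Rightarrow> colour"
  assumes F: "strong F \<psi>" "F \<subseteq> E" and cq: "{c, q} \<in> E" "\<And>w. {c, w} \<in> E \<Longrightarrow> {q, w} \<notin> E" "\<And>w. {c, w} \<notin> F"
  obtains k where "k \<noteq> k0" "strong (insert {c, q} F) (\<psi>({c, q} := k))"
proof -
  obtain L where L: "length L \<le> 5" "\<And>w. {q, w} \<in> E \<Longrightarrow> w \<noteq> c \<Longrightarrow> \<psi> {q, w} \<in> set L"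
    "\<And>w z. {q, w} \<in> E \<Longrightarrow> w \<noteq> c \<Longrightarrow> {w, z} \<in> E \<Longrightarrow> \<psi> {w, z} \<in> set L"
    using pendant_colours[OF adm cq(1,2), of \<psi>] by blast
  obtain k where k: "avoids k (k0 # L)" by (erule fresh_colour[rotated]) (use L(1) in simp)
  have qc: "w \<noteq> c" if "{q, w} \<in> F" for w using that cq(3)[of q] by (auto simp: insert_commute)
  have "strong (insert {c, q} F) (\<psi>({c, q} := k))"
  proof (rule strong_pendant[OF F(1) cq(3)])
    show "c \<noteq> q" by (rule no_loop[OF cq(1)])
    show "{q, q} \<notin> F" using no_loop F(2) by blast
    show "\<psi> {q, w} \<noteq> k" if "{q, w} \<in> F" for w
      using L(2)[OF subsetD[OF F(2) that] qc[OF that]] k by (auto simp: avoids_iff)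
    show "\<psi> {w, z} \<noteq> k" if "{q, w} \<in> F" "{w, z} \<in> F" for w z
      using L(3)[OF subsetD[OF F(2) that(1)] qc[OF that(1)] subsetD[OF F(2) that(2)]] k by (auto simp: avoids_iff)
  qed
  then show ?thesis using that k by auto
qed

lemma no_edges: "E = {}"
proof (rule ccontr)
  assume "E \<noteq> {}"
  then obtain a1 b1 c1 p1 q1 a2 b2 c2 x2 a3 b3 c3 p3 q3 where
    T1: "cubic_triangle E a1 b1 c1 b2 p1 q1" and T2: "cubic_triangle E a2 b2 c2 x2 a1 a3"
    and T3: "cubic_triangle E a3 b3 c3 c2 p3 q3" and d: "distinct [a1, b1, c1, a2, b2, c2, a3, b3, c3]"
    and out: "{p1, q1, p3, q3, x2} \<inter> {a1, b1, c1, a2, b2, c2, a3, b3, c3} = {}"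
    by (rule triangle_path)
  define V where "V = {a1, b1, c1, a2, b2, c2, a3, b3, c3}"
  \<comment> \<open>\<open>a2\<close> is kept: of its edges only \<open>{a2, x2}\<close> survives,
    and its colour is retained.\<close>
  define S where "S = {a1, b1, c1, b2, c2, a3, b3, c3}"
  have SV: "S \<subseteq> V" unfolding S_def V_def by blast
  have a2S: "a2 \<notin> S" unfolding S_def using d by auto
  have d': "distinct [c3, b3, a3, c2, b2, a2, c1, b1, a1]" using d by auto
  note e1 = cubic_triangle_edges[OF T1] and e2 = cubic_triangle_edges[OF T2] and e3 = cubic_triangle_edges[OF T3]
  have inV: "a1 \<in> V" "b1 \<in> V" "c1 \<in> V" "a2 \<in> V" "b2 \<in> V" "c2 \<in> V" "a3 \<in> V" "b3 \<in> V" "c3 \<in> V"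
    unfolding V_def by simp_all
  have inS: "b1 \<in> S" "c1 \<in> S" "b3 \<in> S" "c3 \<in> S" unfolding S_def by simp_all
  have outV: "p1 \<notin> V" "q1 \<notin> V" "p3 \<notin> V" "q3 \<notin> V" "x2 \<notin> V" using out unfolding V_def by blast+
  have away: "{w, m, n} \<inter> V = {}" if T: "cubic_triangle E w m n r s t" and w: "w \<notin> V" for w m n r s t
  proof -
    have nw: "w \<notin> {a1, b1, c1}" "w \<notin> {a2, b2, c2}" "w \<notin> {a3, b3, c3}" using w unfolding V_def by blast+
    have "{w, m, n} \<inter> {a1, b1, c1} = {}" by (rule triangles_disjoint[OF T T1]) (use nw(1) in auto)
    moreover have "{w, m, n} \<inter> {a2, b2, c2} = {}" by (rule triangles_disjoint[OF T T2]) (use nw(2) in auto)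
    moreover have "{w, m, n} \<inter> {a3, b3, c3} = {}" by (rule triangles_disjoint[OF T T3]) (use nw(3) in auto)
    moreover have "V = {a1, b1, c1} \<union> {a2, b2, c2} \<union> {a3, b3, c3}" unfolding V_def by blast
    ultimately show ?thesis by blast
  qed
  have T1b: "cubic_triangle E b1 c1 a1 p1 q1 b2" by (rule cubic_triangle_rotate[OF T1])
  have T1c: "cubic_triangle E c1 a1 b1 q1 b2 p1" by (rule cubic_triangle_rotate[OF T1b])
  have T3b: "cubic_triangle E b3 c3 a3 p3 q3 c2" by (rule cubic_triangle_rotate[OF T3])
  have T3c: "cubic_triangle E c3 a3 b3 q3 c2 p3" by (rule cubic_triangle_rotate[OF T3b])
  obtain m1 n1 i1 j1 where P1: "cubic_triangle E p1 m1 n1 b1 i1 j1" using outer_triangle[OF T1b] .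
  obtain k1 l1 i1' j1' where Q1: "cubic_triangle E q1 k1 l1 c1 i1' j1'" using outer_triangle[OF T1c] .
  obtain m3 n3 i3 j3 where P3: "cubic_triangle E p3 m3 n3 b3 i3 j3" using outer_triangle[OF T3b] .
  obtain k3 l3 i3' j3' where Q3: "cubic_triangle E q3 k3 l3 c3 i3' j3'" using outer_triangle[OF T3c] .
  obtain u2 v2 i2 j2 where X2: "cubic_triangle E x2 u2 v2 a2 i2 j2" using outer_triangle[OF T2] .
  have aw: "{p1, m1, n1} \<inter> V = {}" "{q1, k1, l1} \<inter> V = {}" "{p3, m3, n3} \<inter> V = {}" "{q3, k3, l3} \<inter> V = {}"
    "{x2, u2, v2} \<inter> V = {}"
    by (rule away[OF P1 outV(1)] away[OF Q1 outV(2)] away[OF P3 outV(3)] away[OF Q3 outV(4)] away[OF X2 outV(5)])+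
  have port_nb: "z = m \<or> z = n \<or> z = w" if "cubic_triangle E w' m n w r s" "{w', z} \<in> E" for w' m n w r s z
  proof -
    have "z \<in> nbrs E w'" using that(2) by simp
    then show ?thesis using that(1) unfolding cubic_triangle_def by blast
  qed
  have one: "z = w" if "cubic_triangle E w' m n w r s" "{w', m, n} \<inter> V = {}" "{w', z} \<in> E" "z \<in> V" for w' m n w r s z
    using port_nb[OF that(1,3)] that(2,4) by blast
  \<comment> \<open>Each outer neighbour lies in a triangle off \<open>V\<close> and therefore has a
    single neighbour in \<open>V\<close>.\<close>
  have pq_ne: "p1 \<noteq> q1" "p1 \<noteq> p3" "p1 \<noteq> q3" "q1 \<noteq> p3" "q1 \<noteq> q3" "p3 \<noteq> q3"
  proof -
    have "{p1, c1} \<notin> E" "{p1, b3} \<notin> E" "{p1, c3} \<notin> E" "{q1, b3} \<notin> E" "{q1, c3} \<notin> E" "{p3, c3} \<notin> E"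
      using one[OF P1 aw(1), of c1] one[OF P1 aw(1), of b3] one[OF P1 aw(1), of c3] one[OF Q1 aw(2), of b3]
        one[OF Q1 aw(2), of c3] one[OF P3 aw(3), of c3] inV d by fastforce+
    then show "p1 \<noteq> q1" "p1 \<noteq> p3" "p1 \<noteq> q3" "q1 \<noteq> p3" "q1 \<noteq> q3" "p3 \<noteq> q3"
      using adj_sym[OF e1(6)] adj_sym[OF e3(5)] adj_sym[OF e3(6)] by blast+
  qed
  \<comment> \<open>An edge between outer neighbours \<open>p\<close>, \<open>q\<close> would lie in
    the triangle at \<open>p\<close>, which would then be joined to \<open>a b c\<close> by two
    edges.\<close>
  have link: "{p, q} \<notin> E"
    if T: "cubic_triangle E a b c a' p q" and P: "cubic_triangle E p m n b i j" and aw: "{p, m, n} \<inter> V = {}"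
      and abc: "{a, b, c} \<subseteq> V" and q: "q \<notin> V" for a b c a' p q m n i j
  proof
    assume pq: "{p, q} \<in> E"
    have "q \<noteq> b" using q abc by blast
    then consider "q = m" | "q = n" using port_nb[OF P pq] by blast
    then show False
    proof cases
      case 1
      have "distinct [a, b, c, n, p, m]" using T P aw abc unfolding cubic_triangle_def by auto
      then show False
        by (rule no_double_link)
          (use cubic_triangle_edges[OF T] cubic_triangle_edges[OF P] 1 adj_sym[OF cubic_triangle_edges(3)[OF P]]
            adj_sym[OF cubic_triangle_edges(2)[OF P]] in auto)
    next
      case 2
      have "distinct [a, b, c, m, p, n]" using T P aw abc unfolding cubic_triangle_def by auto
      then show False
        by (rule no_double_link)
          (use cubic_triangle_edges[OF T] cubic_triangle_edges[OF P] 2 adj_sym[OF cubic_triangle_edges(1)[OF P]] in auto)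
    qed
  qed
  have pq1: "{p1, q1} \<notin> E" using link[OF T1 P1 aw(1) _ outV(2)] inV by blast
  have pq3: "{p3, q3} \<notin> E" using link[OF T3 P3 aw(3) _ outV(4)] inV by blast
  define F where "F = delete E S"
  have FE: "F \<subseteq> E" unfolding F_def by (rule delete_subset)
  have F_iff: "{x, y} \<in> F \<longleftrightarrow> {x, y} \<in> E \<and> x \<notin> S \<and> y \<notin> S" for x y unfolding F_def by (rule delete_iff)
  have port_F: "nbrs F w' = {m, n}" "{m, n} \<in> F" "{w', m} \<in> F" "{w', n} \<in> F"
    if T: "cubic_triangle E w' m n w r s" and aw: "{w', m, n} \<inter> V = {}" and w: "w \<in> S" for w' m n w r s
  proof -
    have "w' \<notin> S" "m \<notin> S" "n \<notin> S" using aw SV by blast+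
    then show mn: "{m, n} \<in> F" "{w', m} \<in> F" "{w', n} \<in> F" using cubic_triangle_edges[OF T] by (simp_all add: F_iff)
    have "z = m \<or> z = n" if "{w', z} \<in> F" for z
    proof -
      have "{w', z} \<in> E" "z \<notin> S" using that by (simp_all add: F_iff)
      then show ?thesis using port_nb[OF T] w by blast
    qed
    then have "nbrs F w' \<subseteq> {m, n}" unfolding nbrs_def by blast
    then show "nbrs F w' = {m, n}" using mn by auto
  qed
  note F1P = port_F[OF P1 aw(1) inS(1)] and F1Q = port_F[OF Q1 aw(2) inS(2)]
    and F3P = port_F[OF P3 aw(3) inS(3)] and F3Q = port_F[OF Q3 aw(4) inS(4)]
  \<comment> \<open>\<open>p1\<close> and \<open>q1\<close> have each lost one neighbour by the
    deletion, so the new edge keeps all degrees at most 3.\<close>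
  define G1 where "G1 = insert {p1, q1} F"
  define G where "G = insert {p3, q3} G1"
  have FG: "F \<subseteq> G" unfolding G_def G1_def by blast
  have pqG: "{p1, q1} \<in> G" "{p3, q3} \<in> G" unfolding G_def G1_def by blast+
  have G_cases: "{x, y} \<in> F \<or> {x, y} = {p1, q1} \<or> {x, y} = {p3, q3}" if "{x, y} \<in> G" for x y
    using that unfolding G_def G1_def by blast
  have G_E: "{x, y} \<in> E \<or> {x, y} = {p1, q1} \<or> {x, y} = {p3, q3}" if "{x, y} \<in> G" for x y
    using G_cases[OF that] FE by auto
  have "claw_free_edges F" using admissible_delete[OF adm, of S] unfolding F_def admissible_def claw_free_edges_def by blast
  then have cG1: "claw_free_edges G1"
    unfolding G1_def using pq_ne(1) F1P(1,2) F1Q(1,2) by (rule claw_free_insert)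
  have "nbrs G1 p3 = {m3, n3}" "nbrs G1 q3 = {k3, l3}"
    unfolding F3P(1)[symmetric] F3Q(1)[symmetric] using pq_ne unfolding G1_def by (auto simp: doubleton_eq_iff)
  moreover have "{m3, n3} \<in> G1" "{k3, l3} \<in> G1" using F3P(2) F3Q(2) unfolding G1_def by blast+
  ultimately have cG: "claw_free_edges G"
    unfolding G_def using claw_free_insert[OF cG1 pq_ne(6)] by blast
  have no_common: False
    if P: "cubic_triangle E p m n w i j" "{p, m, n} \<inter> V = {}" "nbrs F p = {m, n}"
      and Q: "cubic_triangle E q k l w' i' j'" "nbrs F q = {k, l}" and pq: "{p, q} \<notin> E" "p \<noteq> q"
      and z: "{p, z} \<in> F" "{q, z} \<in> F" for p q m n w i j k l w' i' j' z
  proof -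
    have zz: "z \<in> nbrs F p" "z \<in> nbrs F q" using z by simp_all
    then have "z \<in> {m, n}" "z \<in> {k, l}" unfolding P(3) Q(2) .
    moreover have "{p, m, n} \<inter> {q, k, l} = {}"
    proof (rule triangles_disjoint[OF P(1) Q(1)])
      have "q \<notin> {p, m, n}" using pq cubic_triangle_edges[OF P(1)] by auto
      then show "{p, m, n} \<noteq> {q, k, l}" by (metis insertI1)
    qed
    ultimately show False by blast
  qed
  \<comment> \<open>The new edges lie in no triangle, so the two triangles of a hypothetical prism
    in \<open>G\<close> are triangles of \<open>E\<close>.\<close>
  have triangle_edge: "{x, y} \<in> E" if h: "{x, y} \<in> G" "{y, z} \<in> G" "{x, z} \<in> G" "distinct [x, y, z]" for x y z
  proof -
    have no1: False if "{p1, z} \<in> G" "{q1, z} \<in> G" "z \<noteq> p1" "z \<noteq> q1" for z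
    proof -
      have "{p1, z} \<in> F" "{q1, z} \<in> F" using G_cases[OF that(1)] G_cases[OF that(2)] that(3,4) pq_ne
        by (auto simp: doubleton_eq_iff)
      then show False by (rule no_common[OF P1 aw(1) F1P(1) Q1 F1Q(1) pq1 pq_ne(1)])
    qed
    have no3: False if "{p3, z} \<in> G" "{q3, z} \<in> G" "z \<noteq> p3" "z \<noteq> q3" for z
    proof -
      have "{p3, z} \<in> F" "{q3, z} \<in> F" using G_cases[OF that(1)] G_cases[OF that(2)] that(3,4) pq_ne
        by (auto simp: doubleton_eq_iff)
      then show False by (rule no_common[OF P3 aw(3) F3P(1) Q3 F3Q(1) pq3 pq_ne(6)])
    qed
    have "{x, y} \<noteq> {p1, q1}" using no1[of z] h by (auto simp: doubleton_eq_iff)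
    moreover have "{x, y} \<noteq> {p3, q3}" using no3[of z] h by (auto simp: doubleton_eq_iff)
    ultimately show ?thesis using G_cases[OF h(1)] FE by blast
  qed
  have no_prism: "\<not> {{a, b}, {b, c}, {a, c}, {a', b'}, {b', c'}, {a', c'}, {a, a'}, {b, b'}, {c, c'}} \<subseteq> G"
    if dd: "distinct [a, b, c, a', b', c']" for a b c a' b' c'
  proof
    assume "{{a, b}, {b, c}, {a, c}, {a', b'}, {b', c'}, {a', c'}, {a, a'}, {b, b'}, {c, c'}} \<subseteq> G"
    then have g: "{a, b} \<in> G" "{b, c} \<in> G" "{a, c} \<in> G" "{a', b'} \<in> G" "{b', c'} \<in> G" "{a', c'} \<in> G"
      "{a, a'} \<in> G" "{b, b'} \<in> G" "{c, c'} \<in> G" by auto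
    have gs: "{y, x} \<in> G" if "{x, y} \<in> G" for x y using that by (simp add: insert_commute)
    have t: "{a, b} \<in> E" "{b, c} \<in> E" "{a, c} \<in> E" "{a', b'} \<in> E" "{b', c'} \<in> E" "{a', c'} \<in> E"
    proof -
      show "{a, b} \<in> E" by (rule triangle_edge[of a b c]) (use g dd in auto)
      show "{b, c} \<in> E" by (rule triangle_edge[of b c a]) (use g gs[OF g(1)] gs[OF g(3)] dd in auto)
      show "{a, c} \<in> E" by (rule triangle_edge[of a c b]) (use g gs[OF g(2)] dd in auto)
      show "{a', b'} \<in> E" by (rule triangle_edge[of a' b' c']) (use g dd in auto)
      show "{b', c'} \<in> E" by (rule triangle_edge[of b' c' a']) (use g gs[OF g(4)] gs[OF g(6)] dd in auto)
      show "{a', c'} \<in> E" by (rule triangle_edge[of a' c' b']) (use g gs[OF g(5)] dd in auto)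
    qed
    note t' = t[THEN adj_sym]
    \<comment> \<open>Two rungs of the prism in \<open>E\<close> would be a double link. With only
      two new edges available, both are rungs and the third rung is old. It joins the triangles at
      \<open>p1\<close> and \<open>q1\<close>, which together with \<open>a1 b1 c1\<close> are three
      pairwise joined triangles.\<close>
    have at_most_one: "\<not> ({a, a'} \<in> E \<and> {b, b'} \<in> E)" "\<not> ({b, b'} \<in> E \<and> {c, c'} \<in> E)" "\<not> ({a, a'} \<in> E \<and> {c, c'} \<in> E)"
      using no_double_link[of c a b c' a' b'] no_double_link[of a b c a' b' c'] no_double_link[of b a c b' a' c'] t t' dd
      by auto
    have H: False
      if xy: "{x, y} = {p1, q1}" and uv: "{u, v} \<in> E"
        and X: "{x, u} \<in> E" "{u, w} \<in> E" "{x, w} \<in> E" and Y: "{y, v} \<in> E" "{v, w'} \<in> E" "{y, w'} \<in> E"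
        and ds: "distinct [x, u, w, y, v, w']" for x y u v w w'
    proof -
      consider "x = p1" "y = q1" | "x = q1" "y = p1" using xy by (auto simp: doubleton_eq_iff)
      then show False
      proof cases
        case 1
        show False by (rule no_link_triangle[OF T1, of u w v w']) (use 1 X Y uv ds in auto)
      next
        case 2
        show False by (rule no_link_triangle[OF T1, of v w' u w]) (use 2 X Y adj_sym[OF uv] ds in auto)
      qed
    qed
    have k: "{a, a'} \<in> E \<or> {a, a'} = {p1, q1} \<or> {a, a'} = {p3, q3}" "{b, b'} \<in> E \<or> {b, b'} = {p1, q1} \<or> {b, b'} = {p3, q3}"
      "{c, c'} \<in> E \<or> {c, c'} = {p1, q1} \<or> {c, c'} = {p3, q3}"
      by (rule G_E[OF g(7)] G_E[OF g(8)] G_E[OF g(9)])+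
    have ne: "{a, a'} \<noteq> {b, b'}" "{b, b'} \<noteq> {c, c'}" "{a, a'} \<noteq> {c, c'}" using dd by (auto simp: doubleton_eq_iff)
    consider "{a, a'} = {p1, q1}" "{b, b'} \<in> E" | "{a, a'} = {p1, q1}" "{c, c'} \<in> E"
      | "{b, b'} = {p1, q1}" "{a, a'} \<in> E" | "{b, b'} = {p1, q1}" "{c, c'} \<in> E"
      | "{c, c'} = {p1, q1}" "{a, a'} \<in> E" | "{c, c'} = {p1, q1}" "{b, b'} \<in> E"
      using k ne at_most_one by metis
    then show False
    proof cases
      case 1 show False by (rule H[OF 1, of c c']) (use t t' dd in auto)
    next
      case 2 show False by (rule H[OF 2, of b b']) (use t t' dd in auto)
    next
      case 3 show False by (rule H[OF 3, of c c']) (use t t' dd in auto)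
    next
      case 4 show False by (rule H[OF 4, of a a']) (use t t' dd in auto)
    next
      case 5 show False by (rule H[OF 5, of b b']) (use t t' dd in auto)
    next
      case 6 show False by (rule H[OF 6, of a a']) (use t t' dd in auto)
    qed
  qed
  have admG: "admissible G" using cG no_prism unfolding admissible_def claw_free_edges_def by blast
  have cardG: "card G < card E"
  proof -
    \<comment> \<open>Two edges are added, so three removed ones suffice for a strict
      decrease.\<close>
    let ?D = "{{a1, b1}, {b1, c1}, {a1, c1}}"
    have fE: "finite E" using adm by (simp add: admissible_def)
    have "card ?D = 3" using d d' by (simp add: card_insert_if doubleton_eq_iff)
    have "F \<inter> ?D = {}" using inS by (auto simp: F_def delete_def)
    then have "card (F \<union> ?D) = card F + 3"
      using \<open>card ?D = 3\<close> card_Un_disjoint[of F ?D] finite_subset[OF FE fE] by simp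
    moreover have "card (F \<union> ?D) \<le> card E" by (rule card_mono[OF fE]) (use FE e1 in auto)
    moreover have "card G \<le> card F + 2"
      unfolding G_def G1_def using card_insert_le_m1 finite_subset[OF FE fE] by (simp add: card_insert_if)
    ultimately show ?thesis by simp
  qed
  obtain \<phi> :: "'a set \<Rightarrow> colour" where \<phi>: "strong G \<phi>" using smaller[OF admG cardG] by blast
  \<comment> \<open>The fold sends the link \<open>{b1, p1}\<close> to the new edge
    \<open>{q1, p1}\<close>, and likewise at the other end, so these links inherit the colours of
    the new edges.\<close>
  define \<theta> where "\<theta> = (\<lambda>x. x)(b1 := q1, b3 := q3)"
  have \<theta>: "\<theta> b1 = q1" "\<theta> b3 = q3" "\<And>x. x \<notin> S \<Longrightarrow> \<theta> x = x" using d inS unfolding \<theta>_def by auto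
  have outS: "p1 \<notin> S" "q1 \<notin> S" "p3 \<notin> S" "q3 \<notin> S" "x2 \<notin> S" using outV SV by blast+
  define F1 where "F1 = insert {b1, p1} (insert {b3, p3} F)"
  have F1E: "F1 \<subseteq> E" unfolding F1_def using FE e1 e3 by blast
  have F1_cases: "{x, y} \<in> F \<and> x \<notin> S \<and> y \<notin> S \<or> x = b1 \<and> y = p1 \<or> x = p1 \<and> y = b1 \<or> x = b3 \<and> y = p3 \<or> x = p3 \<and> y = b3"
    if "{x, y} \<in> F1" for x y
    using that F_iff[of x y] unfolding F1_def by (auto simp: doubleton_eq_iff)
  have F1S: "{x, y} \<in> F1 \<Longrightarrow> x \<in> S \<Longrightarrow> x = b1 \<and> y = p1 \<or> x = b3 \<and> y = p3" for x y
    using F1_cases[of x y] outS by auto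
  have \<psi>0: "strong F1 (\<lambda>e. \<phi> (\<theta> ` e))"
  proof (rule strong_hom[OF \<phi>])
    fix x y assume "{x, y} \<in> F1"
    from F1_cases[OF this] show "{\<theta> x, \<theta> y} \<in> G"
      using \<theta> outS FG pqG by (auto simp: insert_commute)
  next
    fix u v w assume h: "{u, v} \<in> F1" "{u, w} \<in> F1" "v \<noteq> w"
    \<comment> \<open>The fold could identify two neighbours of \<open>p1\<close> only if
      \<open>q1\<close> were a neighbour of \<open>p1\<close> in \<open>E\<close>, which
      \<open>pq1\<close> excludes; similarly for \<open>p3\<close>.\<close>
    have key: "\<theta> v \<noteq> \<theta> w" if h: "{u, v} \<in> F1" "{u, w} \<in> F1" "v \<noteq> w" "v \<in> S" for v w
    proof -
      have "{v, u} \<in> F1" using h(1) by (simp add: insert_commute)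
      then consider "v = b1" "u = p1" | "v = b3" "u = p3" using F1S h(4) by blast
      then show ?thesis
      proof cases
        case 1
        have "w \<notin> S" using F1S[of w u] h(2,3) 1 pq_ne by (auto simp: insert_commute)
        moreover have "w \<noteq> q1" using h(2) F1E pq1 1 by auto
        ultimately show ?thesis using 1 \<theta> by auto
      next
        case 2
        have "w \<notin> S" using F1S[of w u] h(2,3) 2 pq_ne by (auto simp: insert_commute)
        moreover have "w \<noteq> q3" using h(2) F1E pq3 2 by auto
        ultimately show ?thesis using 2 \<theta> by auto
      qed
    qed
    show "\<theta> v \<noteq> \<theta> w"
    proof (cases "v \<in> S \<or> w \<in> S")
      case True
      then show ?thesis using key[OF h] key[of w v] h by metis
    next
      case False
      then show ?thesis using \<theta>(3) h(3) by simp
    qed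
  qed
  define \<psi>0 where "\<psi>0 = (\<lambda>e. \<phi> (\<theta> ` e))"
  have \<psi>0_F: "\<psi>0 {x, y} = \<phi> {x, y}" if "x \<notin> S" "y \<notin> S" for x y using \<theta>(3) that by (simp add: \<psi>0_def)
  have \<psi>0_p: "\<psi>0 {b1, p1} = \<phi> {p1, q1}" "\<psi>0 {b3, p3} = \<phi> {p3, q3}"
    using \<theta> outS by (simp_all add: \<psi>0_def insert_commute)
  have c1F: "{c1, w} \<notin> F1" and c3F: "{c3, w} \<notin> F1" for w
    using F1S[of c1 w] F1S[of c3 w] inS d by auto
  have no_tri: "{q, w} \<notin> E" if T: "cubic_triangle E c a b q a' b'" and w: "{c, w} \<in> E" for a b c q a' b' w
  proof -
    consider "w = a" | "w = b" | "w = q" using cubic_triangle_unique(1)[OF T w] by blast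
    then show ?thesis by cases (use outer_not_adjacent[OF T] no_loop[of q q] in auto)
  qed
  \<comment> \<open>The second link is still pendant. Its colour must differ from that of
    \<open>{b1, p1}\<close>, since \<open>{b1, c1}\<close> joins the two.\<close>
  obtain g1 where g1: "g1 \<noteq> \<phi> {p1, q1}" "strong (insert {c1, q1} F1) (\<psi>0({c1, q1} := g1))"
    using extend_pendant[OF \<psi>0[folded \<psi>0_def] F1E e1(6) no_tri[OF T1c] c1F] by blast
  have c3F': "{c3, w} \<notin> insert {c1, q1} F1" for w
    using c3F[of w] inV outV d by (auto simp: doubleton_eq_iff)
  have F2E: "insert {c1, q1} F1 \<subseteq> E" using F1E e1(6) by blast
  obtain g3 where g3: "g3 \<noteq> \<phi> {p3, q3}"
    "strong (insert {c3, q3} (insert {c1, q1} F1)) (\<psi>0({c1, q1} := g1, {c3, q3} := g3))"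
    using extend_pendant[OF g1(2) F2E e3(6) no_tri[OF T3c] c3F'] by blast
  define F3 where "F3 = insert {c3, q3} (insert {c1, q1} F1)"
  define \<chi> where "\<chi> = \<psi>0({c1, q1} := g1, {c3, q3} := g3)"
  have \<chi>: "strong F3 \<chi>" unfolding F3_def \<chi>_def by (rule g3(2))
  have FF3: "F \<subseteq> F3" unfolding F3_def F1_def by blast
  have \<chi>_F: "\<chi> {x, y} = \<phi> {x, y}" if "x \<notin> S" "y \<notin> S" for x y
    using \<psi>0_F[OF that] that inS unfolding \<chi>_def by (auto simp: doubleton_eq_iff)
  have ne4: "b1 \<noteq> c1" "b1 \<noteq> c3" "b3 \<noteq> c1" "b3 \<noteq> c3" "c1 \<noteq> c3" "c3 \<noteq> c1" using d by auto
  have pqV: "p1 \<noteq> c1" "p1 \<noteq> c3" "p3 \<noteq> c1" "p3 \<noteq> c3" "q1 \<noteq> c3" "q3 \<noteq> c1" "q1 \<noteq> b1" "q1 \<noteq> b3" "q3 \<noteq> b1" "q3 \<noteq> b3"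
    using inV outV by blast+
  have \<chi>v: "\<chi> {b1, p1} = \<phi> {p1, q1}" "\<chi> {b3, p3} = \<phi> {p3, q3}" "\<chi> {c1, q1} = g1" "\<chi> {c3, q3} = g3"
    unfolding \<chi>_def using \<psi>0_p ne4 pqV by (auto simp: doubleton_eq_iff)
  \<comment> \<open>With \<open>{p, q}\<close> present in \<open>G\<close>, these five edges are
    pairwise within distance 2; this is the disjointness for which the edge was added.\<close>
  have ends: "distinct [\<phi> {p, q}, \<chi> {p, m}, \<chi> {p, n}, \<chi> {q, k}, \<chi> {q, l}] \<and> \<chi> {c, q} \<notin> {\<chi> {q, k}, \<chi> {q, l}}"
    if P: "nbrs F p = {m, n}" "{p, m} \<in> F" "{p, n} \<in> F" "m \<noteq> n" and Q: "nbrs F q = {k, l}" "{q, k} \<in> F" "{q, l} \<in> F" "k \<noteq> l"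
      and pq: "{p, q} \<in> G" "p \<noteq> q" "{p, q} \<notin> E" and c: "{c, q} \<in> F3" "c \<in> S" for p q m n k l c
  proof -
    have qp: "{q, p} \<in> G" "{q, c} \<in> F3" using pq(1) c(1) by (simp_all add: insert_commute)
    have S: "p \<notin> S" "q \<notin> S" "m \<notin> S" "n \<notin> S" "k \<notin> S" "l \<notin> S" using P Q by (simp_all add: F_iff)
    have ne: "m \<noteq> q" "n \<noteq> q" "k \<noteq> p" "l \<noteq> p" "c \<noteq> k" "c \<noteq> l"
      using P(2,3) Q(2,3) pq(3) FE adj_sym[of q p] S c(2) by auto
    have G: "{p, m} \<in> G" "{p, n} \<in> G" "{q, k} \<in> G" "{q, l} \<in> G" using P Q FG by blast+
    have F3: "{q, k} \<in> F3" "{q, l} \<in> F3" using Q FF3 by blast+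
    have "\<phi> {p, q} \<noteq> \<phi> {p, m}" "\<phi> {p, q} \<noteq> \<phi> {p, n}" "\<phi> {p, m} \<noteq> \<phi> {p, n}"
      using strong_adjacent[OF \<phi>] pq(1) G ne P(4) by metis+
    moreover have "\<phi> {q, p} \<noteq> \<phi> {q, k}" "\<phi> {q, p} \<noteq> \<phi> {q, l}" "\<phi> {q, k} \<noteq> \<phi> {q, l}"
      using strong_adjacent[OF \<phi>] qp(1) G ne Q(4) by metis+
    moreover have "\<phi> {p, m} \<noteq> \<phi> {q, k}" "\<phi> {p, m} \<noteq> \<phi> {q, l}" "\<phi> {p, n} \<noteq> \<phi> {q, k}" "\<phi> {p, n} \<noteq> \<phi> {q, l}"
      using strong_distance2[OF \<phi> pq(1)] G ne by metis+
    moreover have "\<chi> {q, c} \<noteq> \<chi> {q, k}" "\<chi> {q, c} \<noteq> \<chi> {q, l}"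
      using strong_adjacent[OF \<chi> qp(2)] F3 ne by metis+
    moreover have "{q, p} = {p, q}" "{c, q} = {q, c}" by (rule insert_commute)+
    ultimately show ?thesis using \<chi>_F S by simp
  qed
  have cF3: "{c1, q1} \<in> F3" "{c3, q3} \<in> F3" unfolding F3_def by blast+
  have mn: "m1 \<noteq> n1" "k1 \<noteq> l1" "m3 \<noteq> n3" "k3 \<noteq> l3" "u2 \<noteq> v2"
    using P1 Q1 P3 Q3 X2 by (simp_all add: cubic_triangle_def)
  have en1: "distinct [\<phi> {p1, q1}, \<chi> {p1, m1}, \<chi> {p1, n1}, \<chi> {q1, k1}, \<chi> {q1, l1}]" "g1 \<notin> {\<chi> {q1, k1}, \<chi> {q1, l1}}"
    using ends[OF F1P(1,3,4) mn(1) F1Q(1,3,4) mn(2) pqG(1) pq_ne(1) pq1 cF3(1) inS(2)] \<chi>v by simp_all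
  have en3: "distinct [\<phi> {p3, q3}, \<chi> {p3, m3}, \<chi> {p3, n3}, \<chi> {q3, k3}, \<chi> {q3, l3}]" "g3 \<notin> {\<chi> {q3, k3}, \<chi> {q3, l3}}"
    using ends[OF F3P(1,3,4) mn(3) F3Q(1,3,4) mn(4) pqG(2) pq_ne(6) pq3 cF3(2) inS(4)] \<chi>v by simp_all
  have "g1 \<notin> {\<phi> {p1, q1}, \<chi> {q1, k1}, \<chi> {q1, l1}}" using g1(1) en1(2) by simp
  then obtain D1 D2 t1 where D: "distinct [D1, D2, \<chi> {q1, k1}, \<chi> {q1, l1}]"
    "\<And>y p q. p \<in> {D1, D2} \<Longrightarrow> q \<in> {\<chi> {q1, k1}, \<chi> {q1, l1}} \<Longrightarrow> y \<in> {D1, D2} \<union> {\<chi> {q1, k1}, \<chi> {q1, l1}} \<Longrightarrow> y \<noteq> p \<Longrightarrow> y \<noteq> q \<Longrightarrow>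
      distinct [q, t1, p, y, \<phi> {p1, q1}, g1] \<and> {q, t1} \<inter> {\<chi> {p1, m1}, \<chi> {p1, n1}} = {} \<and> {p, t1} \<inter> {\<chi> {q1, k1}, \<chi> {q1, l1}} = {}"
    using end_triangle_choices[OF en1(1)] by blast
  have "g3 \<notin> {\<phi> {p3, q3}, \<chi> {q3, k3}, \<chi> {q3, l3}}" using g3(1) en3(2) by simp
  then obtain G1' G2' t3 where G': "distinct [G1', G2', \<chi> {q3, k3}, \<chi> {q3, l3}]"
    "\<And>y p q. p \<in> {G1', G2'} \<Longrightarrow> q \<in> {\<chi> {q3, k3}, \<chi> {q3, l3}} \<Longrightarrow> y \<in> {G1', G2'} \<union> {\<chi> {q3, k3}, \<chi> {q3, l3}} \<Longrightarrow> y \<noteq> p \<Longrightarrow> y \<noteq> q \<Longrightarrow>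
      distinct [q, t3, p, y, \<phi> {p3, q3}, g3] \<and> {q, t3} \<inter> {\<chi> {p3, m3}, \<chi> {p3, n3}} = {} \<and> {p, t3} \<inter> {\<chi> {q3, k3}, \<chi> {q3, l3}} = {}"
    using end_triangle_choices[OF en3(1)] by blast
  have xF: "{x2, a2} \<in> F3" "{x2, u2} \<in> F3" "{x2, v2} \<in> F3"
  proof -
    have "u2 \<notin> S" "v2 \<notin> S" using aw(5) SV by blast+
    then show "{x2, a2} \<in> F3" "{x2, u2} \<in> F3" "{x2, v2} \<in> F3"
      using cubic_triangle_edges[OF X2] a2S outS(5) F_iff FF3 by blast+
  qed
  have uv: "a2 \<noteq> u2" "a2 \<noteq> v2" using aw(5) inV by blast+
  have "distinct [\<chi> {x2, a2}, \<chi> {x2, u2}, \<chi> {x2, v2}]"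
    using strong_adjacent[OF \<chi>] xF uv mn(5) by simp
  from path_colours[OF this D(1) G'(1)] obtain y p q z p' q' m s r where
    sol: "path_sol (\<chi> {x2, a2}) {\<chi> {x2, u2}, \<chi> {x2, v2}} {D1, D2} {\<chi> {q1, k1}, \<chi> {q1, l1}} {G1', G2'} {\<chi> {q3, k3}, \<chi> {q3, l3}}
      y p q z p' q' m s r"
    unfolding path_solvable_def by blast
  have sol': "p \<in> {D1, D2}" "q \<in> {\<chi> {q1, k1}, \<chi> {q1, l1}}" "y \<in> {D1, D2} \<union> {\<chi> {q1, k1}, \<chi> {q1, l1}}" "y \<noteq> p" "y \<noteq> q"
    "p' \<in> {G1', G2'}" "q' \<in> {\<chi> {q3, k3}, \<chi> {q3, l3}}" "z \<in> {G1', G2'} \<union> {\<chi> {q3, k3}, \<chi> {q3, l3}}" "z \<noteq> p'" "z \<noteq> q'"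
    by (insert sol[unfolded path_sol_def], elim conjE, assumption)+
  have t1: "distinct [q, t1, p, y, \<phi> {p1, q1}, g1]" "{q, t1} \<inter> {\<chi> {p1, m1}, \<chi> {p1, n1}} = {}" "{p, t1} \<inter> {\<chi> {q1, k1}, \<chi> {q1, l1}} = {}"
    by (insert D(2)[OF sol'(1-5)], elim conjE, assumption)+
  have t3: "distinct [q', t3, p', z, \<phi> {p3, q3}, g3]" "{q', t3} \<inter> {\<chi> {p3, m3}, \<chi> {p3, n3}} = {}" "{p', t3} \<inter> {\<chi> {q3, k3}, \<chi> {q3, l3}} = {}"
    by (insert G'(2)[OF sol'(6-10)], elim conjE, assumption)+
  have t2: "distinct [\<chi> {x2, a2}, y, z, m, s, r]" "m \<notin> {p, q, p', q'}" "s \<notin> {\<chi> {x2, u2}, \<chi> {x2, v2}}" "s \<notin> {p, q}"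
    "r \<notin> {\<chi> {x2, u2}, \<chi> {x2, v2}}" "r \<notin> {p', q'}"
    by (insert sol[unfolded path_sol_def], elim conjE, assumption)+
  \<comment> \<open>\<open>{a1, b1}\<close> sees the colours at \<open>p1\<close> and takes one from
    \<open>q1\<close>; \<open>{a1, c1}\<close> sees those at \<open>q1\<close> and takes one from
    the widened pair. The third triangle follows the same pattern.\<close>
  define \<psi> where "\<psi> = \<chi>({a1, b1} := q, {a1, c1} := p, {b1, c1} := t1, {a3, b3} := q', {a3, c3} := p', {b3, c3} := t3,
    {a1, b2} := y, {a3, c2} := z, {a2, b2} := s, {a2, c2} := r, {b2, c2} := m)"
  have v: "\<psi> {a1, b1} = q" "\<psi> {a1, c1} = p" "\<psi> {b1, c1} = t1" "\<psi> {a3, b3} = q'" "\<psi> {a3, c3} = p'" "\<psi> {b3, c3} = t3"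
    "\<psi> {a1, b2} = y" "\<psi> {a3, c2} = z" "\<psi> {a2, b2} = s" "\<psi> {a2, c2} = r" "\<psi> {b2, c2} = m"
    unfolding \<psi>_def using d d' by (simp_all add: doubleton_eq_iff)
  have old: "\<psi> e = \<chi> e" if "\<not> e \<subseteq> V" for e
    unfolding \<psi>_def by (simp del: fun_upd_apply add: fun_upd_outside[OF that] inV)
  have o: "\<psi> {b1, p1} = \<phi> {p1, q1}" "\<psi> {c1, q1} = g1" "\<psi> {b3, p3} = \<phi> {p3, q3}" "\<psi> {c3, q3} = g3" "\<psi> {a2, x2} = \<chi> {x2, a2}"
    using old[of "{b1, p1}"] old[of "{c1, q1}"] old[of "{b3, p3}"] old[of "{c3, q3}"] old[of "{a2, x2}"] outV \<chi>v
    by (simp_all add: insert_commute)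
  have c: "{b1, a1} = {a1, b1}" "{c1, a1} = {a1, c1}" "{c1, b1} = {b1, c1}" "{b2, a2} = {a2, b2}" "{c2, a2} = {a2, c2}"
    "{c2, b2} = {b2, c2}" "{b3, a3} = {a3, b3}" "{c3, a3} = {a3, c3}" "{c3, b3} = {b3, c3}" "{b2, a1} = {a1, b2}" "{c2, a3} = {a3, c2}"
    by (rule insert_commute)+
  have far: "\<psi> {w', z} \<in> {\<chi> {w', m}, \<chi> {w', n}}" if "cubic_triangle E w' m n w r s" "w' \<notin> V" "{w', z} \<in> E" "z \<noteq> w" for w' m n w r s z
    using port_nb[OF that(1,3)] that(2,4) old[of "{w', z}"] by auto
  have near: "\<psi> {w, z} \<in> {\<psi> {w, i}, \<psi> {w, j}}" if "nbrs E w = {i, j, k}" "{w, z} \<in> E" "z \<noteq> k" for w i j k z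
  proof -
    have "z \<in> nbrs E w" using that(2) by simp
    then show ?thesis using that(1,3) by auto
  qed
  have N: "nbrs E a1 = {b1, c1, b2}" "nbrs E b2 = {a2, c2, a1}" "nbrs E c2 = {a2, b2, a3}" "nbrs E a3 = {b3, c3, c2}"
    using T1 T2 T3 unfolding cubic_triangle_def by simp_all
  have pr1: "proper_at E \<psi> u" if "u \<in> {a1, b1, c1}" for u
  proof (rule proper_at_triangle[OF T1 _ _ _ _ that])
    show "distinct [\<psi> {a1, b1}, \<psi> {b1, c1}, \<psi> {a1, c1}, \<psi> {a1, b2}, \<psi> {b1, p1}, \<psi> {c1, q1}]"
      unfolding v o by (rule t1(1))
    show "\<psi> {b2, z} \<notin> {\<psi> {a1, b1}, \<psi> {a1, c1}}" if "{b2, z} \<in> E" "z \<noteq> a1" for z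
      using near[OF N(2) that] t2(2,4) unfolding c v by auto
    show "\<psi> {p1, z} \<notin> {\<psi> {a1, b1}, \<psi> {b1, c1}}" if "{p1, z} \<in> E" "z \<noteq> b1" for z
      using far[OF P1 outV(1) that] t1(2) unfolding v by auto
    show "\<psi> {q1, z} \<notin> {\<psi> {a1, c1}, \<psi> {b1, c1}}" if "{q1, z} \<in> E" "z \<noteq> c1" for z
      using far[OF Q1 outV(2) that] t1(3) unfolding v by auto
  qed
  have pr3: "proper_at E \<psi> u" if "u \<in> {a3, b3, c3}" for u
  proof (rule proper_at_triangle[OF T3 _ _ _ _ that])
    show "distinct [\<psi> {a3, b3}, \<psi> {b3, c3}, \<psi> {a3, c3}, \<psi> {a3, c2}, \<psi> {b3, p3}, \<psi> {c3, q3}]"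
      unfolding v o by (rule t3(1))
    show "\<psi> {c2, z} \<notin> {\<psi> {a3, b3}, \<psi> {a3, c3}}" if "{c2, z} \<in> E" "z \<noteq> a3" for z
      using near[OF N(3) that] t2(2,6) unfolding c v by auto
    show "\<psi> {p3, z} \<notin> {\<psi> {a3, b3}, \<psi> {b3, c3}}" if "{p3, z} \<in> E" "z \<noteq> b3" for z
      using far[OF P3 outV(3) that] t3(2) unfolding v by auto
    show "\<psi> {q3, z} \<notin> {\<psi> {a3, c3}, \<psi> {b3, c3}}" if "{q3, z} \<in> E" "z \<noteq> c3" for z
      using far[OF Q3 outV(4) that] t3(3) unfolding v by auto
  qed
  have pr2: "proper_at E \<psi> u" if "u \<in> {a2, b2, c2}" for u
  proof (rule proper_at_triangle[OF T2 _ _ _ _ that])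
    show "distinct [\<psi> {a2, b2}, \<psi> {b2, c2}, \<psi> {a2, c2}, \<psi> {a2, x2}, \<psi> {b2, a1}, \<psi> {c2, a3}]"
      using t2(1) unfolding c v o by auto
    show "\<psi> {x2, z} \<notin> {\<psi> {a2, b2}, \<psi> {a2, c2}}" if "{x2, z} \<in> E" "z \<noteq> a2" for z
      using far[OF X2 outV(5) that] t2(3,5) unfolding v by auto
    show "\<psi> {a1, z} \<notin> {\<psi> {a2, b2}, \<psi> {b2, c2}}" if "{a1, z} \<in> E" "z \<noteq> b2" for z
      using near[OF N(1) that] t2(2,4) unfolding v by auto
    show "\<psi> {a3, z} \<notin> {\<psi> {a2, c2}, \<psi> {b2, c2}}" if "{a3, z} \<in> E" "z \<noteq> c2" for z
      using near[OF N(4) that] t2(2,6) unfolding v by auto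
  qed
  have "strong E \<psi>"
  proof (rule strong_extend)
    have "strong {e \<in> F3. \<not> e \<subseteq> V} \<chi>" by (rule strong_mono[OF \<chi>]) blast
    then show "strong {e \<in> F3. \<not> e \<subseteq> V} \<psi>" by (rule strong_cong) (use old in blast)
    show "e \<in> {e \<in> F3. \<not> e \<subseteq> V} \<or> e \<subseteq> V" if e: "e \<in> E" for e
    proof (cases "e \<subseteq> V")
      case False
      obtain x y where xy: "e = {x, y}" "y \<notin> V"
      proof -
        obtain x y where "e = {x, y}" using admissible_edgeE[OF adm e] by blast
        then show ?thesis using that[of x y] that[of y x] False by (auto simp: insert_commute)
      qed
      have "e \<in> F3"
      proof (cases "x \<in> S")
        case True
        then have "x = b1 \<and> y = p1 \<or> x = c1 \<and> y = q1 \<or> x = b3 \<and> y = p3 \<or> x = c3 \<and> y = q3"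
        proof -
          have y: "y \<in> nbrs E x" using e xy(1) by simp
          have N': "nbrs E b1 = {a1, c1, p1}" "nbrs E c1 = {a1, b1, q1}" "nbrs E b3 = {a3, c3, p3}" "nbrs E c3 = {a3, b3, q3}"
            using T1 T3 by (simp_all add: cubic_triangle_def)
          consider "x \<in> {a1, b2, c2, a3}" | "x = b1" | "x = c1" | "x = b3" | "x = c3"
            using True unfolding S_def by blast
          then show ?thesis
          proof cases
            case 1
            then have "nbrs E x \<subseteq> V" by (elim insertE emptyE) (simp_all add: N inV)
            then show ?thesis using y xy(2) by blast
          next
            case 2
            then have "y \<in> {a1, c1, p1}" using y N'(1) by simp
            then show ?thesis using 2 xy(2) inV by auto
          next
            case 3
            then have "y \<in> {a1, b1, q1}" using y N'(2) by simp
            then show ?thesis using 3 xy(2) inV by auto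
          next
            case 4
            then have "y \<in> {a3, c3, p3}" using y N'(3) by simp
            then show ?thesis using 4 xy(2) inV by auto
          next
            case 5
            then have "y \<in> {a3, b3, q3}" using y N'(4) by simp
            then show ?thesis using 5 xy(2) inV by auto
          qed
        qed
        then show ?thesis unfolding xy(1) F3_def F1_def by blast
      next
        case False
        then show ?thesis using e xy SV F_iff[of x y] FF3 by blast
      qed
      then show ?thesis using False by blast
    qed simp
    show "proper_at E \<psi> u" if "u \<in> V" for u
      using that pr1 pr2 pr3 unfolding V_def by blast
  qed
  then show False using uncolourable by blast
qed

end


section \<open>The strong chromatic index\<close>

lemma admissible_colourable:
  assumes "admissible E"
  shows "\<exists>\<phi> :: 'a set \<Rightarrow> colour. strong (E :: 'a set set) \<phi>"
  using assms
proof (induction "card E" arbitrary: E rule: less_induct)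
  case less
  show ?case
  proof (rule ccontr)
    assume "\<nexists>\<phi> :: 'a set \<Rightarrow> colour. strong E \<phi>"
    then interpret critical E by unfold_locales (use less in auto)
    \<comment> \<open>A minimal counterexample has no edges, and then any constant colouring is
      strong.\<close>
    have "strong E (\<lambda>_. Col0)" unfolding no_edges strong_def proper_at_def by simp
    then show False using uncolourable by blast
  qed
qed

section \<open>From edge sets back to graphs\<close>

lemma strong_edge_coloringI:
  fixes \<phi> :: "'a set \<Rightarrow> colour"
  assumes G: "finite_simple_graph G" and \<phi>: "strong (edges G) \<phi>"
  shows "strong_edge_coloring G 7 (\<lambda>e. Suc (colour_index (\<phi> e)))"
  unfolding strong_edge_coloring_def
proof (intro conjI ballI impI)
  have "colour_index k \<le> 6" for k by (cases k) simp_all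
  then show "(\<lambda>e. Suc (colour_index (\<phi> e))) ` edges G \<subseteq> {1..7}" by (auto simp: Suc_le_eq numeral_eq_Suc less_Suc_eq_le)
next
  fix e e' assume e: "e \<in> edges G" "e' \<in> edges G"
    and near: "edges_at_distance_1 e e' \<or> edges_at_distance_2 G e e'"
  have pair: "\<exists>w. f = {s, w}" if "f \<in> edges G" "s \<in> f" for f s
  proof -
    have "card f = 2" using G that(1) by (simp add: finite_simple_graph_def)
    then obtain x y where "f = {x, y}" by (auto simp: card_2_iff)
    then show ?thesis using that(2) by (auto simp: insert_commute)
  qed
  have "\<phi> e \<noteq> \<phi> e'"
  proof (cases "e \<inter> e' = {}")
    case False
    then obtain s where s: "s \<in> e" "s \<in> e'" by blast
    obtain w z where wz: "e = {s, w}" "e' = {s, z}" using pair e s by metis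
    have "e \<noteq> e'" using near by (auto simp: edges_at_distance_1_def edges_at_distance_2_def)
    then show ?thesis using strong_adjacent[OF \<phi>, of s w z] e wz by auto
  next
    case True
    then obtain g where g: "g \<in> edges G" "e \<inter> g \<noteq> {}" "e' \<inter> g \<noteq> {}"
      using near by (auto simp: edges_at_distance_1_def edges_at_distance_2_def)
    then obtain s t where st: "s \<in> e" "s \<in> g" "t \<in> e'" "t \<in> g" by blast
    then have "s \<noteq> t" using True by blast
    obtain w where w: "e = {s, w}" using pair[OF e(1) st(1)] by blast
    obtain z where z: "e' = {t, z}" using pair[OF e(2) st(3)] by blast
    have "g = {s, t}" using pair[OF g(1) st(2)] st(4) \<open>s \<noteq> t\<close> by auto
    moreover have "w \<noteq> t" "z \<noteq> s" using True w z by auto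
    ultimately show ?thesis using strong_distance2[OF \<phi>, of s t w z] g(1) e w z by auto
  qed
  then show "Suc (colour_index (\<phi> e)) \<noteq> Suc (colour_index (\<phi> e'))" by (simp add: colour_index_inject)
qed

lemma verts_edges_simps:
  "verts (induced_subgraph G S) = S" "edges (induced_subgraph G S) = {e \<in> edges G. e \<subseteq> S}"
  "verts claw = {0, 1, 2, 3}" "edges claw = {{0, 1}, {0, 2}, {0, 3}}"
  "verts triangular_prism = {0, 1, 2, 3, 4, 5}"
  "edges triangular_prism = {{0, 1}, {1, 2}, {0, 2}, {3, 4}, {4, 5}, {3, 5}, {0, 3}, {1, 4}, {2, 5}}"
  by (simp_all add: verts_def edges_def induced_subgraph_def claw_def triangular_prism_def)

lemma claw_free_adjacent:
  assumes G: "finite_simple_graph G" and cf: "claw_free G"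
    and e: "{v, x} \<in> edges G" "{v, y} \<in> edges G" "{v, z} \<in> edges G" and d: "distinct [x, y, z]"
  shows "{x, y} \<in> edges G \<or> {y, z} \<in> edges G \<or> {x, z} \<in> edges G"
proof (rule ccontr)
  assume "\<not> ?thesis"
  then have ne: "{x, y} \<notin> edges G" "{y, z} \<notin> edges G" "{x, z} \<notin> edges G"
    "{y, x} \<notin> edges G" "{z, y} \<notin> edges G" "{z, x} \<notin> edges G" by (simp_all add: insert_commute)
  have loop: "{u} \<notin> edges G" for u using G unfolding finite_simple_graph_def by fastforce
  have dv: "v \<noteq> x" "v \<noteq> y" "v \<noteq> z" "x \<noteq> v" "y \<noteq> v" "z \<noteq> v" using e loop by auto
  have e': "{x, v} \<in> edges G" "{y, v} \<in> edges G" "{z, v} \<in> edges G" using e by (simp_all add: insert_commute)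
  let ?S = "{v, x, y, z}"
  define f :: "'a \<Rightarrow> nat" where "f = (\<lambda>u. if u = v then 0 else if u = x then 1 else if u = y then 2 else 3)"
  have f: "f v = 0" "f x = 1" "f y = 2" "f z = 3" using d dv by (auto simp: f_def)
  have "bij_betw f ?S {0, 1, 2, 3}"
    unfolding bij_betw_def inj_on_def using f by auto
  moreover have "\<forall>u\<in>?S. \<forall>w\<in>?S. {u, w} \<in> {e \<in> edges G. e \<subseteq> ?S} \<longleftrightarrow> {f u, f w} \<in> {{0, 1}, {0, 2}, {0, 3}}"
    using e e' ne loop by (auto simp: f doubleton_eq_iff)
  ultimately have "graph_isomorphic (induced_subgraph G ?S) claw"
    unfolding graph_isomorphic_def verts_edges_simps by blast
  moreover have "?S \<subseteq> verts G" using G e unfolding finite_simple_graph_def by blast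
  ultimately show False using cf unfolding claw_free_def by blast
qed

lemma card_nbrs:
  assumes G: "finite_simple_graph G" and sc: "subcubic G"
  shows "finite (nbrs (edges G) v)" "card (nbrs (edges G) v) \<le> 3"
proof -
  have "edges G \<subseteq> Pow (verts G)" "finite (verts G)" using G by (auto simp: finite_simple_graph_def)
  then have "finite (edges G)" by (meson finite_Pow_iff finite_subset)
  then have fin: "finite {e \<in> edges G. v \<in> e}" by simp
  have inj: "inj_on (\<lambda>w. {v, w}) (nbrs (edges G) v)" by (auto simp: inj_on_def doubleton_eq_iff)
  have im: "(\<lambda>w. {v, w}) ` nbrs (edges G) v \<subseteq> {e \<in> edges G. v \<in> e}" by auto
  show "finite (nbrs (edges G) v)" using finite_subset[OF im fin] inj by (rule finite_imageD)
  have "card (nbrs (edges G) v) \<le> degree G v" unfolding degree_def by (rule card_inj_on_le[OF inj im fin])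
  moreover have "nbrs (edges G) v = {}" if "v \<notin> verts G" using that G unfolding finite_simple_graph_def nbrs_def by blast
  ultimately show "card (nbrs (edges G) v) \<le> 3" using sc unfolding subcubic_def by (cases "v \<in> verts G") force+
qed

text \<open>Each of the six vertices already has three neighbours inside the prism. Hence nothing
  outside is reachable and no further edge exists among them, so the prism subgraph is an induced
  component.\<close>

lemma no_prism_subgraph:
  assumes G: "finite_simple_graph G" and sc: "subcubic G"
    and np: "\<forall>C \<in> connected_components G. \<not> graph_isomorphic C triangular_prism"
    and d: "distinct [a, b, c, a', b', c']"
    and e: "{{a, b}, {b, c}, {a, c}, {a', b'}, {b', c'}, {a', c'}, {a, a'}, {b, b'}, {c, c'}} \<subseteq> edges G"
  shows False
proof -
  have d': "distinct [c', b', a', c, b, a]" using d by auto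
  have nb: "nbrs (edges G) v = {x, y, z}"
    if "{v, x} \<in> edges G" "{v, y} \<in> edges G" "{v, z} \<in> edges G" "distinct [x, y, z]" for v x y z
  proof -
    have "{x, y, z} \<subseteq> nbrs (edges G) v" using that by auto
    moreover have "card {x, y, z} = 3" using that(4) by auto
    ultimately show ?thesis using card_seteq[of "nbrs (edges G) v" "{x, y, z}"] card_nbrs[OF G sc] by metis
  qed
  have c: "{b, a} = {a, b}" "{c, a} = {a, c}" "{c, b} = {b, c}" "{b', a'} = {a', b'}" "{c', a'} = {a', c'}"
    "{c', b'} = {b', c'}" "{a', a} = {a, a'}" "{b', b} = {b, b'}" "{c', c} = {c, c'}" by (rule insert_commute)+
  have N: "nbrs (edges G) a = {b, c, a'}" "nbrs (edges G) b = {a, c, b'}" "nbrs (edges G) c = {a, b, c'}"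
    "nbrs (edges G) a' = {b', c', a}" "nbrs (edges G) b' = {a', c', b}" "nbrs (edges G) c' = {a', b', c}"
    by (rule nb; use e d d' c in simp)+
  let ?S = "{a, b, c, a', b', c'}"
  have closed: "w \<in> ?S" if "u \<in> ?S" "{u, w} \<in> edges G" for u w
  proof -
    have "w \<in> nbrs (edges G) u" using that(2) by simp
    moreover from that(1) have "nbrs (edges G) u \<subseteq> ?S" by (elim insertE emptyE) (simp_all add: N)
    ultimately show ?thesis by blast
  qed
  have SV: "?S \<subseteq> verts G" using G e unfolding finite_simple_graph_def by auto
  have "u \<in> ?S" if "reachable G a u" for u
    using that unfolding reachable_def by (induction rule: rtranclp_induct) (use closed in blast)+
  moreover have "reachable G a u" if "u \<in> ?S" for u
  proof -
    have r: "reachable G a b" "reachable G a c" "reachable G a a'"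
      unfolding reachable_def using e by (auto intro: r_into_rtranclp)
    moreover have "reachable G a b'" "reachable G a c'"
      using r e unfolding reachable_def by (auto intro: rtranclp.rtrancl_into_rtrancl)
    moreover have "reachable G a a" unfolding reachable_def by simp
    ultimately show ?thesis using that by blast
  qed
  ultimately have "{u \<in> verts G. reachable G a u} = ?S" using SV by blast
  moreover have "a \<in> verts G" using SV by blast
  ultimately have "induced_subgraph G ?S \<in> connected_components G"
    unfolding connected_components_def by (metis (mono_tags, lifting) mem_Collect_eq)
  moreover have "graph_isomorphic (induced_subgraph G ?S) triangular_prism"
  proof -
    define f :: "'a \<Rightarrow> nat" where "f = (\<lambda>u. if u = a then 0 else if u = b then 1 else if u = c then 2
      else if u = a' then 3 else if u = b' then 4 else 5)"
    have f: "f a = 0" "f b = 1" "f c = 2" "f a' = 3" "f b' = 4" "f c' = 5" using d d' by (simp_all add: f_def)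
    have "bij_betw f ?S {0, 1, 2, 3, 4, 5}"
      unfolding bij_betw_def inj_on_def using f by auto
    moreover have "{u, w} \<in> {e \<in> edges G. e \<subseteq> ?S} \<longleftrightarrow> {f u, f w} \<in> {{0, 1}, {1, 2}, {0, 2}, {3, 4}, {4, 5}, {3, 5}, {0, 3}, {1, 4}, {2, 5}}"
      if "u \<in> ?S" "w \<in> ?S" for u w
    proof -
      have "{u, w} \<in> {e \<in> edges G. e \<subseteq> ?S} \<longleftrightarrow> w \<in> nbrs (edges G) u" using that by (simp only: mem_Collect_eq nbrs_iff insert_subset empty_subsetI simp_thms)
      also have "\<dots> \<longleftrightarrow> {f u, f w} \<in> {{0, 1}, {1, 2}, {0, 2}, {3, 4}, {4, 5}, {3, 5}, {0, 3}, {1, 4}, {2, 5}}"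
        using that by (elim insertE emptyE) (simp_all only: N f, use d d' in \<open>simp_all add: doubleton_eq_iff\<close>)
      finally show ?thesis .
    qed
    ultimately show ?thesis
      unfolding graph_isomorphic_def verts_edges_simps by (intro exI[of _ f] conjI ballI)
  qed
  ultimately show False using np by blast
qed

theorem theorem2:
  fixes G :: "'a ugraph"
  assumes "finite_simple_graph G"
    and "claw_free G"
    and "subcubic G"
    and "\<forall>C \<in> connected_components G. \<not> graph_isomorphic C triangular_prism"
  shows "strong_chromatic_index G \<le> 7"
proof -
  have "edges G \<subseteq> Pow (verts G)" "finite (verts G)" using assms(1) by (auto simp: finite_simple_graph_def)
  then have fin: "finite (edges G)" by (meson finite_Pow_iff finite_subset)
  have two: "\<forall>e\<in>edges G. card e = 2" using assms(1) by (simp add: finite_simple_graph_def)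
  have "admissible (edges G)"
    unfolding admissible_def
  proof (intro conjI allI impI notI)
    show "card (nbrs (edges G) v) \<le> 3" for v by (rule card_nbrs(2)[OF assms(1,3)])
    show "{x, y} \<in> edges G \<or> {y, z} \<in> edges G \<or> {x, z} \<in> edges G"
      if "{v, x} \<in> edges G" "{v, y} \<in> edges G" "{v, z} \<in> edges G" "distinct [x, y, z]" for v x y z
      by (rule claw_free_adjacent[OF assms(1,2) that])
    show False if "distinct [a, b, c, a', b', c']"
      "{{a, b}, {b, c}, {a, c}, {a', b'}, {b', c'}, {a', c'}, {a, a'}, {b, b'}, {c, c'}} \<subseteq> edges G" for a b c a' b' c'
      by (rule no_prism_subgraph[OF assms(1,3,4) that])
  qed (fact fin, fact two)
  then obtain \<phi> :: "'a set \<Rightarrow> colour" where "strong (edges G) \<phi>" using admissible_colourable by blast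
  then have "strong_edge_coloring G 7 (\<lambda>e. Suc (colour_index (\<phi> e)))" by (rule strong_edge_coloringI[OF assms(1)])
  then show ?thesis unfolding strong_chromatic_index_def by (intro Least_le) auto
qed

end
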